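(* Let $h\in(0,1)$ and $k\ge 1$. Let $\phi$ be strictly convex and $\mathcal{C}^2$ on the convex set $\Omega\subset\mathbb{R}^d$, and assume $F_0=\overline{\mathrm{conv}(\mathrm{supp}(P))}\subset\mathring{\Omega}$. Assume that $P$ is absolutely continuous with respect to the Lebesgue measure and satisfies $P\|u\|^p<\infty$ for some $p>2$. Then there exists an $h$-trimmed $k$-optimal codebook $\mathbf{c}^*_h$ (i.e. a minimizer of $R_h$ over $\Omega^{(k)}$) such that \[ \lim_{n\to+\infty} R_{n,h}(\hat{\mathbf{c}}_{n,h})=R_h(\mathbf{c}^*_h)\quad\text{almost everywhere}. \] Moreover, up to extracting a subsequence, \[ \lim_{n\to+\infty} D(\hat{\mathbf{c}}_{n,h},\mathbf{c}^*_h)=0\quad\text{almost everywhere}, \] where $D(\mathbf{c},\mathbf{c}')=\min_{\sigma\in\Sigma_k}\max_{i\in\{1,\dots,k\}}|c_i-c'_{\sigma(i)}|$ and $\Sigma_k$ is the set of all permutations of $\{1,\dots,k\}$. Finally, if $\mathbf{c}^*_h$ is unique, then $\lim_{n\to+\infty}D(\hat{\mathbf{c}}_{n,h},\mathbf{c}^*_h)=0$ almost everywhere (without taking a subsequence).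
   Context: For $x,y\in\Omega$, $d_\phi(x,y)=\phi(x)-\phi(y)-\langle\nabla_y\phi,x-y\rangle$ (Bregman divergence). A ($k$-point) codebook is $\mathbf{c}=(c_1,\dots,c_k)\in\Omega^{(k)}$ (a $k$-tuple of points of $\Omega$), and $d_\phi(x,\mathbf{c})=\min_{i}d_\phi(x,c_i)$. $P$ is a probability distribution on $\mathbb{R}^d$; $Qf(u)$ denotes the integral of $f$ with respect to $Q$; $\|\cdot\|=|\cdot|$ is the Euclidean norm. $B_\phi(\mathbf{c},r)=\{x:\sqrt{d_\phi(x,\mathbf{c})}<r\}$, and $\bar B_\phi(\mathbf{c},r)$ is the same set with $\le$. $r_h(\mathbf{c})$ is the smallest $r\ge 0$ such that $P(B_\phi(\mathbf{c},r))\le h\le P(\bar B_\phi(\mathbf{c},r))$. $\mathcal{P}_h$ is the set of probability measures $\frac1h Q$ where $Q$ is a sub-measure of $P$ (i.e. $Q(A)\le P(A)$ for all Borel $A$) with $Q(\mathbb{R}^d)=h$. $\mathcal{P}_h(\mathbf{c})$ is the set of $\tilde P\in\mathcal{P}_h$ that coincide with $P/h$ on $B_\phi(\mathbf{c},r_h(\mathbf{c}))$ and have support included in $\bar B_\phi(\mathbf{c},r_h(\mathbf{c}))$. The $h$-trimmed distortion is $R_h(\mathbf{c})=h\,\tilde P_{\mathbf{c}}d_\phi(u,\mathbf{c})$ for any $\tilde P_{\mathbf{c}}\in\mathcal{P}_h(\mathbf{c})$ (the value does not depend on the choice). $X_1,\dots,X_n$ are i.i.d. with law $P$, $P_n$ is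 the empirical distribution, $R_{n,h}$ is the $h$-trimmed distortion defined with $P_n$ in place of $P$, and $\hat{\mathbf{c}}_{n,h}$ is a minimizer of $R_{n,h}$ over $\Omega^{(k)}$. *)

theory Defs
  imports "HOL-Probability.Probability" "HOL-Combinatorics.Permutations"
begin

section \<open>Bregman divergences\<close>

definition strictly_convex_on :: "'a::real_vector set \<Rightarrow> ('a \<Rightarrow> real) \<Rightarrow> bool" where
  "strictly_convex_on \<Omega> \<phi> \<longleftrightarrow> convex \<Omega> \<and>
     (\<forall>x\<in>\<Omega>. \<forall>y\<in>\<Omega>. \<forall>t. x \<noteq> y \<longrightarrow> 0 < t \<longrightarrow> t < 1 \<longrightarrow>
        \<phi> ((1 - t) *\<^sub>R x + t *\<^sub>R y) < (1 - t) * \<phi> x + t * \<phi> y)"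

text \<open>The set \<open>\<Omega>\<close> need not be open, so derivatives are taken within \<open>\<Omega>\<close>. They are unique as soon
  as \<open>\<Omega>\<close> is convex with nonempty interior, and are the usual ones at interior points.\<close>

definition C2_on :: "'a::euclidean_space set \<Rightarrow> ('a \<Rightarrow> real) \<Rightarrow> bool" where
  "C2_on \<Omega> \<phi> \<longleftrightarrow>
     (\<exists>(\<phi>' :: 'a \<Rightarrow> 'a \<Rightarrow>\<^sub>L real) (\<phi>'' :: 'a \<Rightarrow> 'a \<Rightarrow>\<^sub>L ('a \<Rightarrow>\<^sub>L real)).
        (\<forall>x\<in>\<Omega>. (\<phi> has_derivative blinfun_apply (\<phi>' x)) (at x within \<Omega>)) \<and>
        (\<forall>x\<in>\<Omega>. (\<phi>' has_derivative blinfun_apply (\<phi>'' x)) (at x within \<Omega>)) \<and>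
        continuous_on \<Omega> \<phi>'')"

definition gradient_within :: "('a::euclidean_space \<Rightarrow> real) \<Rightarrow> 'a set \<Rightarrow> 'a \<Rightarrow> 'a" where
  "gradient_within \<phi> \<Omega> y = (THE g. (\<phi> has_derivative (\<lambda>v. g \<bullet> v)) (at y within \<Omega>))"

definition bregman :: "'a::euclidean_space set \<Rightarrow> ('a \<Rightarrow> real) \<Rightarrow> 'a \<Rightarrow> 'a \<Rightarrow> real" where
  "bregman \<Omega> \<phi> x y = \<phi> x - \<phi> y - gradient_within \<phi> \<Omega> y \<bullet> (x - y)"

section \<open>Codebooks\<close>

text \<open>A \<open>k\<close>-tuple is an extensional function on \<open>{..<k}\<close>.\<close>

definition codebooks :: "'a set \<Rightarrow> nat \<Rightarrow> (nat \<Rightarrow> 'a) set" where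
  "codebooks \<Omega> k = ({..<k} \<rightarrow>\<^sub>E \<Omega>)"

definition bregman_codebook ::
  "'a::euclidean_space set \<Rightarrow> ('a \<Rightarrow> real) \<Rightarrow> nat \<Rightarrow> 'a \<Rightarrow> (nat \<Rightarrow> 'a) \<Rightarrow> real" where
  "bregman_codebook \<Omega> \<phi> k x c = Min ((\<lambda>i. bregman \<Omega> \<phi> x (c i)) ` {..<k})"

definition codebook_dist :: "nat \<Rightarrow> (nat \<Rightarrow> 'a::euclidean_space) \<Rightarrow> (nat \<Rightarrow> 'a) \<Rightarrow> real" where
  "codebook_dist k c c' =
     Min ((\<lambda>\<sigma>. Max ((\<lambda>i. norm (c i - c' (\<sigma> i))) ` {..<k})) ` {\<sigma>. \<sigma> permutes {..<k}})"

definition bregman_ball ::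
  "'a::euclidean_space set \<Rightarrow> ('a \<Rightarrow> real) \<Rightarrow> nat \<Rightarrow> (nat \<Rightarrow> 'a) \<Rightarrow> real \<Rightarrow> 'a set" where
  "bregman_ball \<Omega> \<phi> k c r = {x\<in>\<Omega>. sqrt (bregman_codebook \<Omega> \<phi> k x c) < r}"

definition bregman_cball ::
  "'a::euclidean_space set \<Rightarrow> ('a \<Rightarrow> real) \<Rightarrow> nat \<Rightarrow> (nat \<Rightarrow> 'a) \<Rightarrow> real \<Rightarrow> 'a set" where
  "bregman_cball \<Omega> \<phi> k c r = {x\<in>\<Omega>. sqrt (bregman_codebook \<Omega> \<phi> k x c) \<le> r}"

section \<open>Trimmed distortion\<close>

text \<open>A convex set \<open>\<Omega>\<close>, hence a Bregman ball, need not be Borel, and \<open>\<phi>\<close> is arbitrary outside \<open>\<Omega>\<close>.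
  Measures of balls and integrals of divergences are therefore taken with respect to the completion,
  where these sets and functions are measurable whenever the measure is concentrated on the interior
  of \<open>\<Omega>\<close>. On Borel sets and functions the completion changes nothing.\<close>

definition trim_radius ::
  "'a::euclidean_space set \<Rightarrow> ('a \<Rightarrow> real) \<Rightarrow> nat \<Rightarrow> 'a measure \<Rightarrow> real \<Rightarrow> (nat \<Rightarrow> 'a) \<Rightarrow> real" where
  "trim_radius \<Omega> \<phi> k P h c =
     (LEAST r. 0 \<le> r \<and> measure (completion P) (bregman_ball \<Omega> \<phi> k c r) \<le> h \<and>
               h \<le> measure (completion P) (bregman_cball \<Omega> \<phi> k c r))"

definition measure_support :: "'a::topological_space measure \<Rightarrow> 'a set" where
  "measure_support P = {x. \<forall>U. open U \<longrightarrow> x \<in> U \<longrightarrow> 0 < emeasure P U}"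

definition trimmed_measures :: "'a::euclidean_space measure \<Rightarrow> real \<Rightarrow> 'a measure set" where
  "trimmed_measures P h =
     {scale_measure (ennreal (1 / h)) Q | Q.
        sets Q = sets borel \<and> (\<forall>A\<in>sets borel. emeasure Q A \<le> emeasure P A) \<and>
        emeasure Q UNIV = ennreal h}"

definition trimmed_measures_at ::
  "'a::euclidean_space set \<Rightarrow> ('a \<Rightarrow> real) \<Rightarrow> nat \<Rightarrow> 'a measure \<Rightarrow> real \<Rightarrow> (nat \<Rightarrow> 'a) \<Rightarrow> 'a measure set" where
  "trimmed_measures_at \<Omega> \<phi> k P h c =
     {Q \<in> trimmed_measures P h.
        (\<forall>A\<in>sets borel. A \<subseteq> bregman_ball \<Omega> \<phi> k c (trim_radius \<Omega> \<phi> k P h c) \<longrightarrow>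
           emeasure Q A = ennreal (1 / h) * emeasure P A) \<and>
        measure_support Q \<subseteq> bregman_cball \<Omega> \<phi> k c (trim_radius \<Omega> \<phi> k P h c)}"

text \<open>The integral is the same for every element of \<open>trimmed_measures_at\<close>, which justifies the
  arbitrary choice.\<close>

definition trimmed_distortion ::
  "'a::euclidean_space set \<Rightarrow> ('a \<Rightarrow> real) \<Rightarrow> nat \<Rightarrow> 'a measure \<Rightarrow> real \<Rightarrow> (nat \<Rightarrow> 'a) \<Rightarrow> real" where
  "trimmed_distortion \<Omega> \<phi> k P h c =
     h * (LINT u | completion (SOME Q. Q \<in> trimmed_measures_at \<Omega> \<phi> k P h c).
            bregman_codebook \<Omega> \<phi> k u c)"

definition optimal_codebook ::
  "'a::euclidean_space set \<Rightarrow> ('a \<Rightarrow> real) \<Rightarrow> nat \<Rightarrow> 'a measure \<Rightarrow> real \<Rightarrow> (nat \<Rightarrow> 'a) \<Rightarrow> bool" where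
  "optimal_codebook \<Omega> \<phi> k P h c \<longleftrightarrow>
     is_arg_min (trimmed_distortion \<Omega> \<phi> k P h) (\<lambda>c. c \<in> codebooks \<Omega> k) c"

text \<open>The law of a uniformly chosen sample point among \<open>X 0 \<omega>, \<dots>, X (n - 1) \<omega>\<close>, for \<open>n \<ge> 1\<close>.\<close>

definition empirical_measure :: "(nat \<Rightarrow> 'w \<Rightarrow> 'a::euclidean_space) \<Rightarrow> nat \<Rightarrow> 'w \<Rightarrow> 'a measure" where
  "empirical_measure X n \<omega> = distr (uniform_count_measure {..<n}) borel (\<lambda>i. X i \<omega>)"

end

theory Submission
  imports Defs
begin

text \<open>Write the trimmed distortion as the integral of the divergence against a trimming weight \<open>w\<close>. By
  duality it is also the maximum over \<open>s \<ge> 0\<close> of \<open>\<integral> min (d(u, c)) s dP - s (1 - h)\<close>, an expression in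
  bounded functions, to which the law of large numbers applies. The codepoints of an empirical optimum
  are the centroids of their cells. Those with cells of non-vanishing mass stay bounded because the sample
  norms have bounded averages, so along a subsequence the empirical optima converge, except for
  codepoints whose cells lose all their mass. The limit has risk at most the infimum, and since an additional
  codepoint strictly decreases the risk under an absolutely continuous law, no codepoint is lost.
  This gives existence, the convergence of the values, and the case of a unique optimum.

  It remains to find one codebook that is a limit point for almost every sample. An empirical
  optimum comes from one of finitely many configurations of weights and cells. If two of them tie on
  a non-null set of samples, then the derivatives of their costs in every sample point agree almost everywhere
  there, which forces equal centroids because the gradient is injective. Hence the empirical optimum
  is eventually unique up to relabelling, and visiting a given neighbourhood infinitely often is an
  exchangeable event, of probability 0 or 1 by the Hewitt--Savage law. By a Lindelof argument, some codebook
  has all its neighbourhoods visited infinitely often.\<close>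

section \<open>Bregman divergences\<close>

text \<open>The target \<open>c_opt\<close> is fixed before the sample, whereas compactness gives
  limit points that depend on the sample; several optima are what makes the second claim hard. The
  Hewitt--Savage law needs an event that is measurable and symmetric in the sample, and nothing of
  the kind is assumed of \<open>c_hat\<close>. So visits are counted for minimal configurations,
  which depend on the sample alone and range over a finite set, and the absence of ties carries the
  visits over to whatever optimum \<open>c_hat\<close> selects. Two obstacles shape the details.
  First, \<open>\<Omega>\<close> need not be open or Borel, so \<open>\<phi>\<close>, its gradient
  and the divergence are cut off outside the interior of \<open>\<Omega>\<close>, a null set for
  every concentrated measure. Second, \<open>n * h\<close> need not be an integer, so a
  configuration may contain one fractional weight; cells of mass at least 3 leave room to avoid the
  fractional indices of two configurations at once. The moment assumption enters as square
  integrability of the norm, through Chebyshev's inequality.\<close>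

lemma has_derivative_within_segment:
  fixes f :: "'a::real_normed_vector \<Rightarrow> real"
  assumes "convex S" "x \<in> S" "z \<in> S" "(f has_derivative D) (at x within S)"
  shows "((\<lambda>t. f (x + t *\<^sub>R (z - x))) has_real_derivative D (z - x)) (at 0 within {0..1})"
proof -
  have sub: "(\<lambda>t. x + t *\<^sub>R (z - x)) ` {0..1} \<subseteq> S"
  proof clarify
    fix t :: real assume "t \<in> {0..1}"
    then have "(1 - t) *\<^sub>R x + t *\<^sub>R z \<in> S"
      using assms by (intro convexD) auto
    then show "x + t *\<^sub>R (z - x) \<in> S" by (simp add: algebra_simps)
  qed
  interpret D: bounded_linear D using assms(4) by (rule has_derivative_bounded_linear)
  have "((\<lambda>t. x + t *\<^sub>R (z - x)) has_derivative (\<lambda>t. t *\<^sub>R (z - x))) (at 0 within {0..1})"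
    by (auto intro!: derivative_eq_intros)
  moreover have "(f has_derivative D) (at (x + 0 *\<^sub>R (z - x)) within (\<lambda>t. x + t *\<^sub>R (z - x)) ` {0..1})"
    using has_derivative_subset[OF assms(4) sub] by simp
  ultimately have "((\<lambda>t. f (x + t *\<^sub>R (z - x))) has_derivative (\<lambda>t. D (t *\<^sub>R (z - x)))) (at 0 within {0..1})"
    by (rule has_derivative_in_compose)
  moreover have "(\<lambda>t. D (t *\<^sub>R (z - x))) = (*) (D (z - x))"
    by (simp add: D.scaleR fun_eq_iff)
  ultimately show ?thesis
    by (simp add: has_field_derivative_def)
qed

text \<open>A derivative within \<open>S\<close> is tested only along directions
  \<open>z - x\<close> with \<open>z\<close> in \<open>S\<close>. A ball in \<open>S\<close>
  supplies two such directions whose difference is a multiple of any given \<open>v\<close>, so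
  linearity determines \<open>D1 v\<close>.\<close>

lemma has_derivative_within_convex_unique:
  fixes f :: "'a::euclidean_space \<Rightarrow> real"
  assumes S: "convex S" "interior S \<noteq> {}" "x \<in> S"
    and D1: "(f has_derivative D1) (at x within S)" and D2: "(f has_derivative D2) (at x within S)"
  shows "D1 = D2"
proof
  fix v :: 'a
  interpret D1: bounded_linear D1 using D1 by (rule has_derivative_bounded_linear)
  interpret D2: bounded_linear D2 using D2 by (rule has_derivative_bounded_linear)
  have eq: "D1 (z - x) = D2 (z - x)" if "z \<in> S" for z
  proof -
    have "at (0::real) within {0..1} \<noteq> bot"
      by (simp add: trivial_limit_within islimpt_finite islimpt_Icc)
    then show ?thesis
      using has_derivative_within_segment[OF S(1,3) that D1] has_derivative_within_segment[OF S(1,3) that D2]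
      unfolding has_real_derivative_iff_has_vector_derivative
      by (metis vector_derivative_unique_within)
  qed
  obtain z where "z \<in> interior S" using S(2) by auto
  then obtain e where e: "e > 0" "cball z e \<subseteq> S" by (meson mem_interior_cball)
  define \<epsilon> where "\<epsilon> = e / (norm v + 1)"
  have \<epsilon>: "\<epsilon> > 0" using e by (simp add: \<epsilon>_def add_nonneg_pos)
  have "\<epsilon> * norm v \<le> e"
    using e by (simp add: \<epsilon>_def divide_le_eq add_nonneg_pos mult_left_mono)
  then have "z + \<epsilon> *\<^sub>R v \<in> S" "z \<in> S"
    using e \<epsilon> by (auto intro!: subsetD[OF e(2)] simp: dist_norm)
  from eq[OF this(1)] eq[OF this(2)]
  have "D1 z + \<epsilon> * D1 v - D1 x = D2 z + \<epsilon> * D2 v - D2 x" "D1 z - D1 x = D2 z - D2 x"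
    by (simp_all add: D1.diff D2.diff D1.add D2.add D1.scaleR D2.scaleR)
  then have "\<epsilon> * D1 v = \<epsilon> * D2 v" by linarith
  then show "D1 v = D2 v" using \<epsilon> by simp
qed

text \<open>The nonempty interior makes the \<open>THE\<close> in \<open>gradient_within\<close>
  denote the gradient at every point of the convex set, boundary included.\<close>

locale bregman_setting =
  fixes \<Omega> :: "'a::euclidean_space set" and \<phi> :: "'a \<Rightarrow> real"
  assumes strict_convex: "strictly_convex_on \<Omega> \<phi>"
    and C2: "C2_on \<Omega> \<phi>"
    and interior_nonempty: "interior \<Omega> \<noteq> {}"
begin

abbreviation "grad \<equiv> gradient_within \<phi> \<Omega>"
abbreviation "breg \<equiv> bregman \<Omega> \<phi>"

lemma convex_domain: "convex \<Omega>"
  using strict_convex by (simp add: strictly_convex_on_def)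

lemma strict_convexD:
  "\<lbrakk>x \<in> \<Omega>; y \<in> \<Omega>; x \<noteq> y; 0 < t; t < 1\<rbrakk>
    \<Longrightarrow> \<phi> ((1 - t) *\<^sub>R x + t *\<^sub>R y) < (1 - t) * \<phi> x + t * \<phi> y"
  using strict_convex unfolding strictly_convex_on_def by blast

lemma convex_interior_domain: "convex (interior \<Omega>)"
  by (rule convex_interior[OF convex_domain])

lemma grad_C2:
  obtains \<phi>' :: "'a \<Rightarrow> 'a \<Rightarrow>\<^sub>L real"
  where "continuous_on \<Omega> \<phi>'" "\<And>x. x \<in> \<Omega> \<Longrightarrow> (\<phi> has_derivative blinfun_apply (\<phi>' x)) (at x within \<Omega>)"
    "\<And>x v. x \<in> \<Omega> \<Longrightarrow> blinfun_apply (\<phi>' x) v = grad x \<bullet> v"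
proof -
  obtain \<phi>' :: "'a \<Rightarrow> 'a \<Rightarrow>\<^sub>L real" and \<phi>'' :: "'a \<Rightarrow> 'a \<Rightarrow>\<^sub>L ('a \<Rightarrow>\<^sub>L real)"
    where d: "\<And>x. x \<in> \<Omega> \<Longrightarrow> (\<phi> has_derivative blinfun_apply (\<phi>' x)) (at x within \<Omega>)"
      and d2: "\<And>x. x \<in> \<Omega> \<Longrightarrow> (\<phi>' has_derivative blinfun_apply (\<phi>'' x)) (at x within \<Omega>)"
    using C2 unfolding C2_on_def by blast
  have "blinfun_apply (\<phi>' x) v = grad x \<bullet> v" if x: "x \<in> \<Omega>" for x v
  proof -
    define g where "g = (\<Sum>b\<in>Basis. blinfun_apply (\<phi>' x) b *\<^sub>R b)"
    have g: "blinfun_apply (\<phi>' x) = (\<lambda>v. g \<bullet> v)"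
    proof
      fix v
      have "blinfun_apply (\<phi>' x) v = blinfun_apply (\<phi>' x) (\<Sum>b\<in>Basis. (v \<bullet> b) *\<^sub>R b)"
        by (simp add: euclidean_representation)
      also have "\<dots> = (\<Sum>b\<in>Basis. (v \<bullet> b) * blinfun_apply (\<phi>' x) b)"
        by (simp only: blinfun.sum_right blinfun.scaleR_right real_scaleR_def)
      also have "\<dots> = g \<bullet> v"
        unfolding g_def inner_sum_left
        by (intro sum.cong refl) (simp add: inner_commute[of v])
      finally show "blinfun_apply (\<phi>' x) v = g \<bullet> v" .
    qed
    have "grad x = g"
      unfolding gradient_within_def
    proof (rule the_equality)
      show "(\<phi> has_derivative (\<lambda>v. g \<bullet> v)) (at x within \<Omega>)"
        using d[OF x] g by simp
      fix g' assume "(\<phi> has_derivative (\<lambda>v. g' \<bullet> v)) (at x within \<Omega>)"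
      then have "(\<lambda>v. g' \<bullet> v) = (\<lambda>v. g \<bullet> v)"
        using has_derivative_within_convex_unique[OF convex_domain interior_nonempty x _ d[OF x]] g by auto
      then show "g' = g" by (metis vector_eq_rdot)
    qed
    then show ?thesis using g by simp
  qed
  moreover have "continuous_on \<Omega> \<phi>'"
    by (rule has_derivative_continuous_on[OF d2])
  ultimately show ?thesis using that d by blast
qed

lemma has_derivative_grad:
  assumes "x \<in> \<Omega>"
  shows "(\<phi> has_derivative (\<lambda>v. grad x \<bullet> v)) (at x within \<Omega>)"
proof -
  obtain \<phi>' :: "'a \<Rightarrow> 'a \<Rightarrow>\<^sub>L real"
    where "\<And>x. x \<in> \<Omega> \<Longrightarrow> (\<phi> has_derivative blinfun_apply (\<phi>' x)) (at x within \<Omega>)"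
      "\<And>x v. x \<in> \<Omega> \<Longrightarrow> blinfun_apply (\<phi>' x) v = grad x \<bullet> v"
    using grad_C2 by metis
  moreover from this assms have "blinfun_apply (\<phi>' x) = (\<lambda>v. grad x \<bullet> v)" by (intro ext)
  ultimately show ?thesis using assms by metis
qed

lemma has_derivative_grad_interior:
  "x \<in> interior \<Omega> \<Longrightarrow> (\<phi> has_derivative (\<lambda>v. grad x \<bullet> v)) (at x)"
  using has_derivative_grad[of x] interior_subset[of \<Omega>] at_within_interior[of x \<Omega>] by auto

lemma continuous_on_phi: "continuous_on \<Omega> \<phi>"
  by (rule has_derivative_continuous_on[OF has_derivative_grad])

lemma continuous_on_grad: "continuous_on \<Omega> grad"
proof -
  obtain \<phi>' :: "'a \<Rightarrow> 'a \<Rightarrow>\<^sub>L real" where c: "continuous_on \<Omega> \<phi>'"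
    and e: "\<And>x v. x \<in> \<Omega> \<Longrightarrow> blinfun_apply (\<phi>' x) v = grad x \<bullet> v"
    using grad_C2 by metis
  have "continuous_on \<Omega> (\<lambda>x. \<Sum>b\<in>Basis. blinfun_apply (\<phi>' x) b *\<^sub>R b)"
    by (intro continuous_intros c)
  moreover have "(\<Sum>b\<in>Basis. blinfun_apply (\<phi>' x) b *\<^sub>R b) = grad x" if "x \<in> \<Omega>" for x
    using that by (simp add: e euclidean_representation)
  ultimately show ?thesis by (simp cong: continuous_on_cong)
qed

text \<open>The one-sided difference quotient along the segment suffices, so boundary points of
  \<open>\<Omega>\<close> are included.\<close>

lemma grad_le_diff:
  assumes "x \<in> \<Omega>" "z \<in> \<Omega>"
  shows "grad x \<bullet> (z - x) \<le> \<phi> z - \<phi> x"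
proof (cases "x = z")
  case False
  have "((\<lambda>t. (\<phi> (x + t *\<^sub>R (z - x)) - \<phi> x) / t) \<longlongrightarrow> grad x \<bullet> (z - x)) (at 0 within {0..1})"
    using has_derivative_within_segment[OF convex_domain assms has_derivative_grad[OF assms(1)]]
    by (simp add: has_field_derivative_iff)
  moreover have "\<forall>\<^sub>F t in at 0 within {0..1}. (\<phi> (x + t *\<^sub>R (z - x)) - \<phi> x) / t \<le> \<phi> z - \<phi> x"
    unfolding eventually_at
  proof (intro exI[of _ 1] conjI ballI impI)
    fix t :: real assume t: "t \<in> {0..1}" "t \<noteq> 0 \<and> dist t 0 < 1"
    then have "\<phi> ((1 - t) *\<^sub>R x + t *\<^sub>R z) < (1 - t) * \<phi> x + t * \<phi> z"
      by (intro strict_convexD) (use assms False in auto)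
    moreover have "(1 - t) *\<^sub>R x + t *\<^sub>R z = x + t *\<^sub>R (z - x)" by (simp add: algebra_simps)
    ultimately show "(\<phi> (x + t *\<^sub>R (z - x)) - \<phi> x) / t \<le> \<phi> z - \<phi> x"
      using t by (simp add: field_simps)
  qed simp
  moreover have "at (0::real) within {0..1} \<noteq> bot"
    by (simp add: trivial_limit_within islimpt_Icc)
  ultimately show ?thesis by (intro tendsto_upperbound) auto
qed simp

lemma bregman_nonneg: "x \<in> \<Omega> \<Longrightarrow> y \<in> \<Omega> \<Longrightarrow> 0 \<le> breg x y"
  using grad_le_diff[of y x] by (simp add: bregman_def)

lemma bregman_self [simp]: "breg x x = 0"
  by (simp add: bregman_def)

text \<open>The gradient inequality is only weak; applying it at the midpoint, where
  \<open>\<phi>\<close> lies strictly below the chord, makes it strict at the endpoint.\<close>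

lemma bregman_pos:
  assumes "x \<in> \<Omega>" "y \<in> \<Omega>" "x \<noteq> y"
  shows "0 < breg x y"
proof -
  define z where "z = (1 - 1/2) *\<^sub>R y + (1/2::real) *\<^sub>R x"
  have z: "z \<in> \<Omega>" unfolding z_def using assms by (intro convexD[OF convex_domain]) auto
  have "\<phi> z < (1 - 1/2) * \<phi> y + (1/2) * \<phi> x"
    unfolding z_def by (rule strict_convexD) (use assms in auto)
  moreover have "grad y \<bullet> (z - y) \<le> \<phi> z - \<phi> y" by (rule grad_le_diff[OF assms(2) z])
  moreover have "z - y = (1/2) *\<^sub>R (x - y)"
    by (simp add: z_def algebra_simps flip: scaleR_add_left)
  ultimately show ?thesis by (simp add: bregman_def)
qed

lemma bregman_eq_0_iff: "x \<in> \<Omega> \<Longrightarrow> y \<in> \<Omega> \<Longrightarrow> breg x y = 0 \<longleftrightarrow> x = y"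
  using bregman_pos[of x y] by force

text \<open>\<open>breg x y + breg y x\<close> is the inner product of
  \<open>grad x - grad y\<close> with \<open>x - y\<close>, so distinct points with equal gradients
  would contradict positivity.\<close>

lemma inj_on_grad: "inj_on grad \<Omega>"
proof (rule inj_onI, rule ccontr)
  fix x y assume xy: "x \<in> \<Omega>" "y \<in> \<Omega>" "grad x = grad y" "x \<noteq> y"
  then have "0 < breg x y + breg y x"
    using bregman_pos[of x y] bregman_pos[of y x] by simp
  then show False using xy by (simp add: bregman_def inner_diff_right)
qed

lemma continuous_on_bregman_fst: "continuous_on \<Omega> (\<lambda>u. breg u y)"
  unfolding bregman_def by (intro continuous_intros continuous_on_phi)

lemma continuous_on_bregman: "continuous_on (\<Omega> \<times> \<Omega>) (\<lambda>(u, y). breg u y)"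
  unfolding bregman_def case_prod_unfold
  by (intro continuous_intros continuous_on_compose2[OF continuous_on_phi]
      continuous_on_compose2[OF continuous_on_grad]) auto

text \<open>Bias-variance identity: apart from \<open>\<phi> (x i)\<close>, the divergence is affine
  in its first argument, so only the weighted mean matters. The mean is given through
  \<open>W *\<^sub>R m\<close>, which lets \<open>m\<close> be arbitrary for a cell of zero
  weights.\<close>

lemma bregman_mean_decomposition:
  fixes x :: "'i \<Rightarrow> 'a"
  assumes "finite A" "W = (\<Sum>i\<in>A. w i)" "(\<Sum>i\<in>A. w i *\<^sub>R x i) = W *\<^sub>R m"
  shows "(\<Sum>i\<in>A. w i * breg (x i) c) = (\<Sum>i\<in>A. w i * breg (x i) m) + W * breg m c"
    and "(\<Sum>i\<in>A. w i * breg (x i) m) = (\<Sum>i\<in>A. w i * \<phi> (x i)) - W * \<phi> m"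
proof -
  have *: "(\<Sum>i\<in>A. w i * breg (x i) y) = (\<Sum>i\<in>A. w i * \<phi> (x i)) - W * \<phi> y - W * (grad y \<bullet> (m - y))" for y
  proof -
    have "(\<Sum>i\<in>A. w i * breg (x i) y) =
        (\<Sum>i\<in>A. w i * \<phi> (x i)) - (\<Sum>i\<in>A. w i) * \<phi> y - (\<Sum>i\<in>A. w i * (grad y \<bullet> (x i - y)))"
      by (simp add: bregman_def right_diff_distrib sum_subtractf sum_distrib_right)
    also have "(\<Sum>i\<in>A. w i * (grad y \<bullet> (x i - y))) = grad y \<bullet> ((\<Sum>i\<in>A. w i *\<^sub>R x i) - (\<Sum>i\<in>A. w i) *\<^sub>R y)"
      by (simp add: inner_diff_right inner_sum_right right_diff_distrib sum_subtractf sum_distrib_right scaleR_sum_left)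
    also have "\<dots> = W * (grad y \<bullet> (m - y))"
      using assms by (simp add: algebra_simps)
    finally show ?thesis using assms by simp
  qed
  show "(\<Sum>i\<in>A. w i * breg (x i) m) = (\<Sum>i\<in>A. w i * \<phi> (x i)) - W * \<phi> m"
    using *[of m] by simp
  then show "(\<Sum>i\<in>A. w i * breg (x i) c) = (\<Sum>i\<in>A. w i * breg (x i) m) + W * breg m c"
    using *[of c] by (simp add: bregman_def algebra_simps)
qed

end

section \<open>The trimming radius\<close>

text \<open>If every point of \<open>E\<close> had a neighbourhood meeting \<open>E\<close> in a
  null set, a countable subcover would make \<open>E\<close> null.\<close>

lemma exists_point_positive_measure:
  fixes M :: "'a::second_countable_topology measure"
  assumes "sets M = sets borel" "E \<in> sets borel" "emeasure M E \<noteq> 0"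
  shows "\<exists>u\<in>E. \<forall>V. open V \<longrightarrow> u \<in> V \<longrightarrow> emeasure M (V \<inter> E) \<noteq> 0"
proof (rule ccontr)
  assume "\<not> ?thesis"
  then have *: "\<exists>V. open V \<and> u \<in> V \<and> emeasure M (V \<inter> E) = 0" if "u \<in> E" for u
    using that by blast
  define F where "F = {V. open V \<and> emeasure M (V \<inter> E) = 0}"
  obtain F' where F': "F' \<subseteq> F" "countable F'" "\<Union>F' = \<Union>F"
    using Lindelof[of F] by (auto simp: F_def)
  have "E = (\<Union>V\<in>F'. V \<inter> E)"
    using * F'(3) unfolding F_def by blast
  moreover have "(\<Union>V\<in>F'. V \<inter> E) \<in> null_sets M"
    using F' assms by (intro null_sets_UN') (auto simp: F_def null_sets_def)
  ultimately show False using assms by (auto simp: null_sets_def)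
qed

lemma closed_measure_support: "closed (measure_support M)"
proof -
  have "- measure_support M = \<Union>{U. open U \<and> emeasure M U = 0}"
    by (auto simp: measure_support_def zero_less_iff_neq_zero)
  then have "open (- measure_support M)"
    by (metis (mono_tags, lifting) mem_Collect_eq open_Union)
  then show ?thesis by (simp add: closed_def)
qed

lemma AE_measure_support:
  fixes M :: "'a::second_countable_topology measure"
  assumes "sets M = sets borel"
  shows "AE u in M. u \<in> measure_support M"
proof -
  have E: "- measure_support M \<in> sets borel"
    by (simp add: closed_measure_support borel_comp borel_closed)
  have "emeasure M (- measure_support M) = 0"
  proof (rule ccontr)
    assume "emeasure M (- measure_support M) \<noteq> 0"
    then obtain u where u: "u \<in> - measure_support M"
      "\<And>V. open V \<Longrightarrow> u \<in> V \<Longrightarrow> emeasure M (V \<inter> - measure_support M) \<noteq> 0"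
      using exists_point_positive_measure[OF assms E] by blast
    then obtain V where "open V" "u \<in> V" "emeasure M V = 0"
      by (auto simp: measure_support_def zero_less_iff_neq_zero)
    moreover have "emeasure M (V \<inter> - measure_support M) \<le> emeasure M V"
      using \<open>open V\<close> assms by (intro emeasure_mono) auto
    ultimately show False using u(2) by fastforce
  qed
  then show ?thesis
    using E assms sets_eq_imp_space_eq[OF assms]
    by (intro AE_I'[of "- measure_support M"]) (auto simp: null_sets_def)
qed

text \<open>The infimum of the levels of mass at least \<open>h\<close>: right continuity gives the
  closed bound, left limits the open one. Minimality, the last clause, is what identifies the
  \<open>LEAST\<close> in \<open>trim_radius\<close>.\<close>

lemma (in prob_space) quantile_exists:
  fixes g :: "'a \<Rightarrow> real"
  assumes [measurable]: "g \<in> borel_measurable M" and g: "\<And>u. 0 \<le> g u" and h: "0 < h" "h < 1"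
  obtains r where "0 \<le> r" "prob {u \<in> space M. g u < r} \<le> h" "h \<le> prob {u \<in> space M. g u \<le> r}"
    "\<And>r'. h \<le> prob {u \<in> space M. g u \<le> r'} \<Longrightarrow> r \<le> r'"
proof -
  let ?F = "\<lambda>r. prob {u \<in> space M. g u \<le> r}"
  define T where "T = {r. h \<le> ?F r}"
  have T_nonneg: "0 \<le> r" if "r \<in> T" for r
  proof (rule ccontr)
    assume "\<not> 0 \<le> r"
    then have "{u \<in> space M. g u \<le> r} = {}" using g by (auto simp: not_le) (meson le_less_trans not_le)
    with that h show False by (auto simp: T_def)
  qed
  have "(\<lambda>n::nat. ?F (real n)) \<longlonglongrightarrow> prob (\<Union>n::nat. {u \<in> space M. g u \<le> real n})"
    by (rule finite_Lim_measure_incseq) (auto simp: incseq_def)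
  also have "(\<Union>n::nat. {u \<in> space M. g u \<le> real n}) = space M"
    using real_arch_simple by auto
  finally have "\<forall>\<^sub>F n in sequentially. h < ?F (real n)"
    using h by (intro order_tendstoD) (auto simp: prob_space)
  then obtain n where "h < ?F (real n)" by (auto simp: eventually_sequentially)
  then have T_ne: "T \<noteq> {}" by (auto simp: T_def intro: less_imp_le)
  have bdd: "bdd_below T" using T_nonneg by (auto simp: bdd_below_def)
  define r where "r = Inf T"
  have r0: "0 \<le> r" unfolding r_def using T_ne T_nonneg by (intro cInf_greatest) auto
  have lower: "r \<le> r'" if "r' \<in> T" for r'
    unfolding r_def using that bdd by (rule cInf_lower)
  have "(\<lambda>n::nat. ?F (r + 1 / Suc n)) \<longlonglongrightarrow> prob (\<Inter>n::nat. {u \<in> space M. g u \<le> r + 1 / Suc n})"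
    by (rule finite_Lim_measure_decseq) (auto simp: decseq_def frac_le intro: order_trans)
  moreover have "h \<le> ?F (r + 1 / Suc n)" for n
  proof -
    have "r < r + 1 / Suc n" by simp
    then obtain t where "t \<in> T" "t < r + 1 / Suc n"
      using cInf_lessD[OF T_ne] unfolding r_def by blast
    then have "h \<le> ?F t" "?F t \<le> ?F (r + 1 / Suc n)"
      by (auto simp: T_def intro!: finite_measure_mono)
    then show ?thesis by linarith
  qed
  moreover have "(\<Inter>n::nat. {u \<in> space M. g u \<le> r + 1 / Suc n}) = {u \<in> space M. g u \<le> r}"
  proof -
    have "g u \<le> r" if "\<And>n::nat. g u \<le> r + 1 / Suc n" for u
    proof (rule LIMSEQ_le_const)
      show "(\<lambda>n. r + 1 / Suc n) \<longlonglongrightarrow> r"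
        using tendsto_add[OF tendsto_const[of r] LIMSEQ_inverse_real_of_nat] by (simp add: inverse_eq_divide)
    qed (use that in auto)
    moreover have "g u \<le> r + 1 / Suc n" if "g u \<le> r" for u n using that by (simp add: add_increasing2)
    ultimately show ?thesis by auto
  qed
  ultimately have le: "h \<le> ?F r" by (auto intro: LIMSEQ_le_const)
  have ge: "prob {u \<in> space M. g u < r} \<le> h"
  proof -
    have "(\<lambda>n::nat. ?F (r - 1 / Suc n)) \<longlonglongrightarrow> prob (\<Union>n::nat. {u \<in> space M. g u \<le> r - 1 / Suc n})"
      by (rule finite_Lim_measure_incseq) (auto simp: incseq_def frac_le intro: order_trans diff_left_mono)
    moreover have "?F (r - 1 / Suc n) \<le> h" for n
    proof (rule ccontr)
      assume "\<not> ?thesis"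
      then have "r - 1 / Suc n \<in> T" by (auto simp: T_def)
      from lower[OF this] show False by simp
    qed
    moreover have "(\<Union>n::nat. {u \<in> space M. g u \<le> r - 1 / Suc n}) = {u \<in> space M. g u < r}"
    proof -
      have "\<exists>n::nat. g u \<le> r - 1 / Suc n" if "g u < r" for u
      proof -
        obtain n where "inverse (real (Suc n)) < r - g u" 
          using reals_Archimedean[of "r - g u"] \<open>g u < r\<close> by (metis diff_gt_0_iff_gt)
        then show ?thesis by (intro exI[of _ n]) (simp add: inverse_eq_divide)
      qed
      moreover have "g u < r" if "g u \<le> r - 1 / Suc n" for u n
        using that by (smt (verit) of_nat_0_less_iff zero_less_Suc zero_less_divide_1_iff)
      ultimately show ?thesis by blast
    qed
    ultimately show ?thesis by (auto intro: LIMSEQ_le_const2)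
  qed
  show ?thesis using that[OF r0 ge le] lower by (auto simp: T_def)
qed

lemma continuous_on_Min:
  fixes f :: "'i \<Rightarrow> 'a::topological_space \<Rightarrow> real"
  assumes "finite A" "A \<noteq> {}" "\<And>i. i \<in> A \<Longrightarrow> continuous_on S (f i)"
  shows "continuous_on S (\<lambda>u. Min ((\<lambda>i. f i u) ` A))"
  using assms by (induction rule: finite_ne_induct) (auto intro!: continuous_on_min)

locale trimming = bregman_setting +
  fixes k :: nat and h :: real
  assumes k: "1 \<le> k" and h: "0 < h" "h < 1"
begin

abbreviation "cbreg u c \<equiv> bregman_codebook \<Omega> \<phi> k u c"
abbreviation "distortion \<equiv> \<lambda>P. trimmed_distortion \<Omega> \<phi> k P h"

text \<open>Borel on the whole space, which \<open>cbreg\<close> need not be; the two agree almost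
  everywhere under a concentrated measure.\<close>

definition cdist :: "(nat \<Rightarrow> 'a) \<Rightarrow> 'a \<Rightarrow> real" where
  "cdist c u = (if u \<in> interior \<Omega> then cbreg u c else 0)"

text \<open>Covers both \<open>P\<close> and the empirical measure of points in the interior of
  \<open>\<Omega>\<close>.\<close>

definition concentrated :: "'a measure \<Rightarrow> bool" where
  "concentrated P \<longleftrightarrow> prob_space P \<and> sets P = sets borel \<and> measure_support P \<subseteq> interior \<Omega>"

lemma concentratedD:
  assumes "concentrated P"
  shows "prob_space P" "sets P = sets borel" "space P = UNIV" "measure_support P \<subseteq> interior \<Omega>"
  using assms sets_eq_imp_space_eq[of P borel] by (auto simp: concentrated_def)

lemma cbreg_le: "j < k \<Longrightarrow> cbreg u c \<le> breg u (c j)"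
  unfolding bregman_codebook_def by (intro Min_le) auto

lemma cbreg_attained: obtains j where "j < k" "cbreg u c = breg u (c j)"
proof -
  have "cbreg u c \<in> (\<lambda>i. breg u (c i)) ` {..<k}"
    unfolding bregman_codebook_def using k by (intro Min_in) (auto simp: lessThan_empty_iff)
  then show ?thesis using that by auto
qed

lemma cbreg_nonneg: "u \<in> \<Omega> \<Longrightarrow> c \<in> codebooks \<Omega> k \<Longrightarrow> 0 \<le> cbreg u c"
  by (rule cbreg_attained[of u c]) (auto intro!: bregman_nonneg simp: codebooks_def)

lemma cdist_nonneg: "c \<in> codebooks \<Omega> k \<Longrightarrow> 0 \<le> cdist c u"
  using cbreg_nonneg interior_subset by (auto simp: cdist_def)

lemma continuous_on_cbreg: "continuous_on \<Omega> (\<lambda>u. cbreg u c)"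
  unfolding bregman_codebook_def using k
  by (intro continuous_on_Min continuous_on_bregman_fst) (auto simp: lessThan_empty_iff)

lemma borel_measurable_cdist [measurable]: "cdist c \<in> borel_measurable borel"
  unfolding cdist_def
  by (intro borel_measurable_continuous_on_if continuous_on_subset[OF continuous_on_cbreg] interior_subset
      continuous_intros) auto

lemma open_cbreg: "open T \<Longrightarrow> open {u \<in> interior \<Omega>. cbreg u c \<in> T}"
  using continuous_open_preimage[OF continuous_on_subset[OF continuous_on_cbreg interior_subset], of T c]
  by (simp add: Int_def vimage_def)

lemma AE_concentrated: "concentrated P \<Longrightarrow> AE u in P. u \<in> interior \<Omega>"
  using AE_measure_support[of P] by (auto simp: concentrated_def elim!: eventually_mono)

lemma integral_completion_cbreg:
  assumes "sets Q = sets borel" "AE u in Q. u \<in> interior \<Omega>"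
  shows "(LINT u|completion Q. cbreg u c) = (LINT u|Q. cdist c u)"
proof -
  have [measurable]: "cdist c \<in> borel_measurable Q"
    using assms(1) borel_measurable_cdist by (simp cong: measurable_cong_sets)
  have ae: "AE u in completion Q. cdist c u = cbreg u c"
    using AE_completion[OF assms(2)] by eventually_elim (simp add: cdist_def)
  have "(\<lambda>u. cbreg u c) \<in> borel_measurable (completion Q)"
  proof (rule measurableI)
    fix B :: "real set" assume B: "B \<in> sets borel"
    show "(\<lambda>u. cbreg u c) -` B \<inter> space (completion Q) \<in> sets (completion Q)"
    proof (rule completion.in_sets_AE)
      show "AE u in completion Q. u \<in> cdist c -` B \<inter> space Q \<longleftrightarrow> u \<in> (\<lambda>u. cbreg u c) -` B \<inter> space (completion Q)"
        using ae by eventually_elim auto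
      show "cdist c -` B \<inter> space Q \<in> sets (completion Q)"
        using B by (intro sets_completionI_sets measurable_sets[of "cdist c" Q borel]) auto
    qed auto
  qed simp
  then have "(LINT u|completion Q. cbreg u c) = (LINT u|completion Q. cdist c u)"
    using ae by (intro integral_cong_AE measurable_completion[of "cdist c"]) auto
  then show ?thesis by (simp add: integral_completion)
qed

lemma measure_completion_ball:
  assumes P: "concentrated P"
  shows "measure (completion P) (bregman_ball \<Omega> \<phi> k c r) = measure P {u \<in> space P. sqrt (cdist c u) < r}"
    and "measure (completion P) (bregman_cball \<Omega> \<phi> k c r) = measure P {u \<in> space P. sqrt (cdist c u) \<le> r}"
proof -
  note [simp] = concentratedD(3)[OF P]
  have [measurable]: "cdist c \<in> borel_measurable P"
    using concentratedD(2)[OF P] borel_measurable_cdist by (simp cong: measurable_cong_sets)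
  note ae = AE_completion[OF AE_concentrated[OF P]]
  have main: "measure (completion P) A = measure P B"
    if "AE u in completion P. u \<in> B \<longleftrightarrow> u \<in> A" "B \<in> sets P" for A B
    using measure_eq_AE[OF that(1)] completion.in_sets_AE[OF that(1)] that(2) by (simp add: measure_completion)
  show "measure (completion P) (bregman_ball \<Omega> \<phi> k c r) = measure P {u \<in> space P. sqrt (cdist c u) < r}"
  proof (rule main)
    show "AE u in completion P. u \<in> {u \<in> space P. sqrt (cdist c u) < r} \<longleftrightarrow> u \<in> bregman_ball \<Omega> \<phi> k c r"
      using ae by eventually_elim (use interior_subset in \<open>auto simp: bregman_ball_def cdist_def\<close>)
  qed measurable
  show "measure (completion P) (bregman_cball \<Omega> \<phi> k c r) = measure P {u \<in> space P. sqrt (cdist c u) \<le> r}"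
  proof (rule main)
    show "AE u in completion P. u \<in> {u \<in> space P. sqrt (cdist c u) \<le> r} \<longleftrightarrow> u \<in> bregman_cball \<Omega> \<phi> k c r"
      using ae by eventually_elim (use interior_subset in \<open>auto simp: bregman_cball_def cdist_def\<close>)
  qed measurable
qed

text \<open>Balls are defined through the square root of the divergence, so the trimming level on
  the scale of \<open>cdist\<close> is the squared radius.\<close>

lemma trim_radius_quantile:
  assumes P: "concentrated P" and c: "c \<in> codebooks \<Omega> k"
  defines "r \<equiv> trim_radius \<Omega> \<phi> k P h c"
  shows "0 \<le> r" "measure P {u. cdist c u < r\<^sup>2} \<le> h" "h \<le> measure P {u. cdist c u \<le> r\<^sup>2}"
proof -
  interpret prob_space P using P by (simp add: concentrated_def)
  note [simp] = concentratedD(3)[OF P]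
  have [measurable]: "cdist c \<in> borel_measurable P"
    using concentratedD(2)[OF P] borel_measurable_cdist by (simp cong: measurable_cong_sets)
  have meas: "(\<lambda>u. sqrt (cdist c u)) \<in> borel_measurable P" by measurable
  obtain r' where r': "0 \<le> r'" "prob {u \<in> space P. sqrt (cdist c u) < r'} \<le> h"
      "h \<le> prob {u \<in> space P. sqrt (cdist c u) \<le> r'}"
      "\<And>r''. h \<le> prob {u \<in> space P. sqrt (cdist c u) \<le> r''} \<Longrightarrow> r' \<le> r''"
    by (rule quantile_exists[OF meas _ h]) (use cdist_nonneg[OF c] in auto)
  have "r = r'"
    unfolding r_def trim_radius_def using r'
    by (intro Least_equality) (auto simp: measure_completion_ball[OF P])
  moreover have "sqrt (cdist c u) < r' \<longleftrightarrow> cdist c u < r'\<^sup>2" "sqrt (cdist c u) \<le> r' \<longleftrightarrow> cdist c u \<le> r'\<^sup>2" for u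
    using r'(1) real_sqrt_less_iff[of "cdist c u" "r'\<^sup>2"] real_sqrt_le_iff[of "cdist c u" "r'\<^sup>2"] by simp_all
  ultimately show "0 \<le> r" "measure P {u. cdist c u < r\<^sup>2} \<le> h" "h \<le> measure P {u. cdist c u \<le> r\<^sup>2}"
    using r' by auto
qed

end

section \<open>Dual form of the trimmed distortion\<close>

context trimming
begin

text \<open>The Lagrangian dual function of the linear program that minimises the integral of
  \<open>w u * cdist c u\<close> over weights between 0 and 1 of total mass \<open>h\<close>;
  \<open>s\<close> is the multiplier of the mass constraint.\<close>

definition dual_value :: "'a measure \<Rightarrow> (nat \<Rightarrow> 'a) \<Rightarrow> real \<Rightarrow> real" where
  "dual_value P c s = (LINT u|P. min (cdist c u) s) - s * (1 - h)"

text \<open>Integrating against the density \<open>w\<close> realises the trimming; mass is lost only at the trimming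
  level \<open>s\<close>.\<close>

definition trimming_weight :: "'a measure \<Rightarrow> (nat \<Rightarrow> 'a) \<Rightarrow> real \<Rightarrow> ('a \<Rightarrow> real) \<Rightarrow> bool" where
  "trimming_weight P c s w \<longleftrightarrow> 0 \<le> s \<and> w \<in> borel_measurable borel \<and> (\<forall>u. 0 \<le> w u \<and> w u \<le> 1) \<and>
     (\<forall>u. cdist c u < s \<longrightarrow> w u = 1) \<and> (\<forall>u. s < cdist c u \<longrightarrow> w u = 0) \<and> (LINT u|P. w u) = h"

lemma trimming_weight_exists:
  assumes P: "concentrated P" and c: "c \<in> codebooks \<Omega> k"
  shows "\<exists>w. trimming_weight P c ((trim_radius \<Omega> \<phi> k P h c)\<^sup>2) w"
proof -
  define s where "s = (trim_radius \<Omega> \<phi> k P h c)\<^sup>2"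
  interpret prob_space P using P by (simp add: concentrated_def)
  have [measurable_cong]: "sets P = sets borel" using P by (simp add: concentrated_def)
  note [simp] = concentratedD(3)[OF P]
  define a where "a = prob {u. cdist c u < s}"
  define b where "b = prob {u. cdist c u = s}"
  have a: "a \<le> h" using trim_radius_quantile(2)[OF P c] by (simp add: a_def s_def)
  have "prob {u. cdist c u \<le> s} = a + b"
    unfolding a_def b_def
    by (subst finite_measure_Union[symmetric]) (auto intro!: arg_cong[where f=prob])
  then have ab: "h \<le> a + b" using trim_radius_quantile(3)[OF P c] by (simp add: s_def)
  \<comment> \<open>If the level set is null, then \<open>a = h\<close> and nothing has to be split;
    the value 0 is a default.\<close>
  define l where "l = (if b = 0 then 0 else (h - a) / b)"
  have b0: "0 \<le> b" by (simp add: b_def)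
  have l: "0 \<le> l" "l \<le> 1" "l * b = h - a"
    using a ab b0 by (auto simp: l_def divide_simps)
  define w where "w u = indicator {u. cdist c u < s} u + l * indicator {u. cdist c u = s} u" for u
  have "(LINT u|P. w u) = a + l * b"
    unfolding w_def a_def b_def by (subst Bochner_Integration.integral_add) (auto simp: emeasure_eq_measure)
  moreover have "w \<in> borel_measurable borel" unfolding w_def by measurable
  ultimately have "trimming_weight P c s w"
    using l by (auto simp: trimming_weight_def w_def s_def indicator_def)
  then show ?thesis unfolding s_def by blast
qed

text \<open>Guarantees that the \<open>SOME\<close> in \<open>trimmed_distortion\<close> picks an
  actual trimmed measure.\<close>

lemma trimmed_measures_at_nonempty:
  assumes P: "concentrated P" and c: "c \<in> codebooks \<Omega> k"
  shows "trimmed_measures_at \<Omega> \<phi> k P h c \<noteq> {}"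
proof -
  define r where "r = trim_radius \<Omega> \<phi> k P h c"
  have r: "0 \<le> r" using trim_radius_quantile(1)[OF P c] by (simp add: r_def)
  obtain w where w: "trimming_weight P c (r\<^sup>2) w" using trimming_weight_exists[OF P c] r_def by blast
  interpret prob_space P using P by (simp add: concentrated_def)
  have [measurable_cong]: "sets P = sets borel" using P by (simp add: concentrated_def)
  note [simp] = concentratedD(3)[OF P]
  have [measurable]: "w \<in> borel_measurable borel" and w01: "\<And>u. 0 \<le> w u" "\<And>u. w u \<le> 1"
    using w by (auto simp: trimming_weight_def)
  define Q where "Q = density P (\<lambda>u. ennreal (w u))"
  have sets_Q: "sets Q = sets borel" by (simp add: Q_def \<open>sets P = sets borel\<close>)
  have Q_eq: "emeasure Q A = (\<integral>\<^sup>+u. ennreal (w u) * indicator A u \<partial>P)" if "A \<in> sets borel" for A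
    using that unfolding Q_def by (subst emeasure_density) auto
  have Q_le: "emeasure Q A \<le> emeasure P A" if A: "A \<in> sets borel" for A
  proof -
    have "emeasure Q A \<le> (\<integral>\<^sup>+u. indicator A u \<partial>P)"
      unfolding Q_eq[OF A] using w01 by (intro nn_integral_mono) (auto simp: indicator_def)
    then show ?thesis using A by simp
  qed
  have "emeasure Q UNIV = (\<integral>\<^sup>+u. ennreal (w u) \<partial>P)" by (simp add: Q_eq)
  also have "\<dots> = ennreal h"
    using w w01 by (subst nn_integral_eq_integral)
      (auto simp: trimming_weight_def intro!: integrable_const_bound[where B=1])
  finally have mass: "emeasure Q UNIV = ennreal h" .
  let ?Q = "scale_measure (ennreal (1 / h)) Q"
  have "?Q \<in> trimmed_measures P h"
    unfolding trimmed_measures_def using sets_Q Q_le mass by blast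
  moreover have "emeasure ?Q A = ennreal (1 / h) * emeasure P A"
    if A: "A \<in> sets borel" "A \<subseteq> bregman_ball \<Omega> \<phi> k c r" for A
  proof -
    have "emeasure Q A = (\<integral>\<^sup>+u. indicator A u \<partial>P)"
      unfolding Q_eq[OF A(1)]
    proof (rule nn_integral_cong_AE)
      show "AE u in P. ennreal (w u) * indicator A u = indicator A u"
        using AE_concentrated[OF P]
      proof eventually_elim
        case (elim u)
        have "w u = 1" if "u \<in> A"
        proof -
          have "sqrt (cdist c u) < r" using that A elim by (auto simp: bregman_ball_def cdist_def)
          then have "cdist c u < r\<^sup>2"
            using r by (metis real_sqrt_abs abs_of_nonneg real_sqrt_less_iff)
          then show ?thesis using w by (simp add: trimming_weight_def)
        qed
        then show ?case by (auto simp: indicator_def)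
      qed
    qed
    then show ?thesis using A sets_Q by simp
  qed
  moreover have "measure_support ?Q \<subseteq> bregman_cball \<Omega> \<phi> k c r"
  proof
    fix u assume u: "u \<in> measure_support ?Q"
    have pos: "0 < emeasure Q U" if "open U" "u \<in> U" for U
      using u that by (auto simp: measure_support_def) (metis ennreal_zero_less_mult_iff)
    have "u \<in> measure_support P"
      unfolding measure_support_def using pos Q_le by (force intro: less_le_trans)
    then have uI: "u \<in> interior \<Omega>" using concentratedD(4)[OF P] by auto
    have "cbreg u c \<le> r\<^sup>2"
    proof (rule ccontr)
      assume "\<not> ?thesis"
      \<comment> \<open>\<open>w\<close> vanishes on this open set, so it is \<open>Q\<close>-null
        and cannot meet the support.\<close>
      let ?U = "{v \<in> interior \<Omega>. cbreg v c \<in> {r\<^sup>2<..}}"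
      have "open ?U" by (rule open_cbreg) auto
      then have "0 < emeasure Q ?U" using \<open>\<not> _\<close> uI by (intro pos) auto
      moreover have "emeasure Q ?U = (\<integral>\<^sup>+u. 0 \<partial>P)"
        unfolding Q_eq[OF borel_open[OF \<open>open ?U\<close>]] using w
        by (intro nn_integral_cong) (auto simp: trimming_weight_def indicator_def cdist_def)
      ultimately show False by simp
    qed
    then have "sqrt (cbreg u c) \<le> r" using r by (simp add: real_le_lsqrt real_sqrt_le_iff' sqrt_le_D real_sqrt_le_mono)
    then show "u \<in> bregman_cball \<Omega> \<phi> k c r" using uI interior_subset by (auto simp: bregman_cball_def)
  qed
  ultimately have "?Q \<in> trimmed_measures_at \<Omega> \<phi> k P h c"
    unfolding trimmed_measures_at_def r_def by blast
  then show ?thesis by blast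
qed

text \<open>The measure \<open>Q\<close> is prescribed only on the open ball. The function
  \<open>s - min (cdist c u) s\<close> vanishes outside that ball, so its integral against
  \<open>Q\<close> is determined by \<open>P\<close>; by the support condition, it equals
  \<open>s - cdist c u\<close> almost everywhere under \<open>Q\<close>.\<close>

lemma trimmed_integral:
  assumes P: "concentrated P" and c: "c \<in> codebooks \<Omega> k" and Q: "Q \<in> trimmed_measures_at \<Omega> \<phi> k P h c"
  shows "h * (LINT u|completion Q. cbreg u c) = dual_value P c ((trim_radius \<Omega> \<phi> k P h c)\<^sup>2)"
proof -
  define r where "r = trim_radius \<Omega> \<phi> k P h c"
  have r: "0 \<le> r" using trim_radius_quantile(1)[OF P c] by (simp add: r_def)
  define s where "s = r\<^sup>2"
  interpret P: prob_space P using P by (simp add: concentrated_def)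
  have setsP [measurable_cong]: "sets P = sets borel" using P by (simp add: concentrated_def)
  note [simp] = concentratedD(3)[OF P]
  obtain Q0 where Q0: "Q = scale_measure (ennreal (1 / h)) Q0" "sets Q0 = sets borel"
      "\<And>A. A \<in> sets borel \<Longrightarrow> emeasure Q0 A \<le> emeasure P A" "emeasure Q0 UNIV = ennreal h"
    using Q unfolding trimmed_measures_at_def trimmed_measures_def by blast
  have setsQ [measurable_cong]: "sets Q = sets borel" using Q0 by simp
  have [simp]: "space Q = UNIV" using sets_eq_imp_space_eq[OF setsQ] by simp
  have "emeasure Q UNIV = ennreal (1 / h * h)" using Q0 h by (simp flip: ennreal_mult)
  then interpret Q: prob_space Q using h by (intro prob_spaceI) simp
  have [simp]: "P.prob UNIV = 1" "Q.prob UNIV = 1" using P.prob_space Q.prob_space by simp_all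
  have AE_Q: "AE u in Q. R u" if ae: "AE u in P. R u" for R
  proof -
    obtain N where N: "{u \<in> space P. \<not> R u} \<subseteq> N" "emeasure P N = 0" "N \<in> sets P"
      using ae by (rule AE_E)
    then have "emeasure Q N = 0"
      using Q0(1) Q0(3)[of N] setsP by simp
    then show ?thesis using N setsP setsQ by (intro AE_I[of _ _ N]) auto
  qed
  have QI: "AE u in Q. u \<in> interior \<Omega>" by (rule AE_Q[OF AE_concentrated[OF P]])
  have sup: "AE u in Q. cdist c u \<le> s"
    using AE_measure_support[OF setsQ] QI
  proof eventually_elim
    case (elim u)
    then have "sqrt (cdist c u) \<le> r"
      using Q by (auto simp: trimmed_measures_at_def bregman_cball_def cdist_def r_def)
    then show ?case using r cdist_nonneg[OF c, of u] unfolding s_def by (simp add: sqrt_le_D)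
  qed
  define A where "A = {u \<in> interior \<Omega>. cdist c u < s}"
  have A: "A \<in> sets borel" unfolding A_def by measurable
  have Aball: "A \<subseteq> bregman_ball \<Omega> \<phi> k c r"
  proof
    fix u assume u: "u \<in> A"
    then have "sqrt (cbreg u c) < r"
      using r cdist_nonneg[OF c, of u] by (auto simp: A_def cdist_def s_def intro!: real_less_lsqrt)
    then show "u \<in> bregman_ball \<Omega> \<phi> k c r"
      using u interior_subset by (auto simp: A_def bregman_ball_def)
  qed
  have dens: "density Q (indicator A) = density (scale_measure (ennreal (1 / h)) P) (indicator A)"
  proof (rule measure_eqI)
    fix B assume "B \<in> sets (density Q (indicator A))"
    then have B: "B \<in> sets borel" by (simp add: setsQ)
    have "emeasure Q (A \<inter> B) = ennreal (1 / h) * emeasure P (A \<inter> B)"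
      using Q A B Aball unfolding trimmed_measures_at_def r_def by blast
    then show "emeasure (density Q (indicator A)) B = emeasure (density (scale_measure (ennreal (1 / h)) P) (indicator A)) B"
      using A B setsP setsQ by (simp add: emeasure_restricted)
  qed (simp add: setsP setsQ)
  define f where "f u = s - min (cdist c u) s" for u
  have [measurable]: "f \<in> borel_measurable borel" unfolding f_def by measurable
  have s0: "0 \<le> s" by (simp add: s_def)
  have f: "0 \<le> f u" "f u \<le> s" for u using cdist_nonneg[OF c, of u] s0 by (auto simp: f_def)
  have f_AE: "AE u in P. ennreal (f u) = indicator A u * ennreal (f u)"
    using AE_concentrated[OF P] by eventually_elim (auto simp: f_def A_def indicator_def)
  have [measurable]: "A \<in> sets borel" by fact
  have "(\<integral>\<^sup>+u. ennreal (f u) \<partial>Q) = (\<integral>\<^sup>+u. indicator A u * ennreal (f u) \<partial>Q)"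
    by (intro nn_integral_cong_AE AE_Q f_AE)
  also have "\<dots> = (\<integral>\<^sup>+u. ennreal (f u) \<partial>density Q (indicator A))"
    by (subst nn_integral_density) auto
  also have "\<dots> = (\<integral>\<^sup>+u. indicator A u * ennreal (f u) \<partial>scale_measure (ennreal (1 / h)) P)"
    unfolding dens by (subst nn_integral_density) auto
  also have "\<dots> = ennreal (1 / h) * (\<integral>\<^sup>+u. indicator A u * ennreal (f u) \<partial>P)"
    by (rule nn_integral_scale_measure) auto
  also have "(\<integral>\<^sup>+u. indicator A u * ennreal (f u) \<partial>P) = (\<integral>\<^sup>+u. ennreal (f u) \<partial>P)"
    by (intro nn_integral_cong_AE) (use f_AE in eventually_elim, simp)
  finally have nn: "(\<integral>\<^sup>+u. ennreal (f u) \<partial>Q) = ennreal (1 / h) * (\<integral>\<^sup>+u. ennreal (f u) \<partial>P)" .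
  have intP: "integrable P f" using f by (intro P.integrable_const_bound[where B=s]) auto
  have intQ: "integrable Q f" using f by (intro Q.integrable_const_bound[where B=s]) auto
  have intmin: "integrable P (\<lambda>u. min (cdist c u) s)"
    using cdist_nonneg[OF c] s0 by (intro P.integrable_const_bound[where B=s]) auto
  have "ennreal (LINT u|Q. f u) = ennreal (1 / h * (LINT u|P. f u))"
    using nn f h by (subst ennreal_mult) (simp_all add: nn_integral_eq_integral intP intQ integral_nonneg)
  then have fQ: "h * (LINT u|Q. f u) = (LINT u|P. f u)"
    using f h by (subst (asm) ennreal_inj) (auto intro!: integral_nonneg divide_nonneg_nonneg)
  have "(LINT u|completion Q. cbreg u c) = (LINT u|Q. cdist c u)"
    by (rule integral_completion_cbreg[OF setsQ QI])
  also have "\<dots> = (LINT u|Q. s - f u)"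
    by (intro integral_cong_AE) (use sup in \<open>auto simp: f_def elim: eventually_mono\<close>)
  also have "\<dots> = s - (LINT u|Q. f u)"
    using intQ by (simp add: Q.prob_space)
  finally have "h * (LINT u|completion Q. cbreg u c) = h * s - (LINT u|P. f u)"
    using fQ by (simp add: right_diff_distrib)
  also have "(LINT u|P. f u) = s - (LINT u|P. min (cdist c u) s)"
    unfolding f_def using intmin by (simp add: P.prob_space)
  finally show ?thesis
    by (simp add: dual_value_def s_def r_def algebra_simps)
qed

lemma distortion_eq_dual:
  assumes "concentrated P" "c \<in> codebooks \<Omega> k"
  shows "distortion P c = dual_value P c ((trim_radius \<Omega> \<phi> k P h c)\<^sup>2)"
  unfolding trimmed_distortion_def
  using trimmed_integral[OF assms] trimmed_measures_at_nonempty[OF assms] some_in_eq by blast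

lemma integrable_min_cdist:
  assumes "concentrated P" "c \<in> codebooks \<Omega> k" "0 \<le> s"
  shows "integrable P (\<lambda>u. min (cdist c u) s)"
proof -
  interpret P: prob_space P using assms by (simp add: concentrated_def)
  have [measurable_cong]: "sets P = sets borel" using assms by (simp add: concentrated_def)
  show ?thesis
    using cdist_nonneg[OF assms(2)] assms(3) by (intro P.integrable_const_bound[where B=s]) auto
qed

lemma distortion_weight:
  assumes P: "concentrated P" and c: "c \<in> codebooks \<Omega> k"
  obtains s w where "trimming_weight P c s w" "integrable P (\<lambda>u. w u * cdist c u)"
    "distortion P c = (LINT u|P. w u * cdist c u)"
proof -
  define s where "s = (trim_radius \<Omega> \<phi> k P h c)\<^sup>2"
  obtain w where w: "trimming_weight P c s w" using trimming_weight_exists[OF P c] s_def by blast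
  interpret P: prob_space P using P by (simp add: concentrated_def)
  have setsP [measurable_cong]: "sets P = sets borel" using P by (simp add: concentrated_def)
  have [measurable]: "w \<in> borel_measurable borel" and w01: "\<And>u. 0 \<le> w u" "\<And>u. w u \<le> 1"
    and s: "0 \<le> s"
    using w by (auto simp: trimming_weight_def)
  have iw: "integrable P w" using w01 by (intro P.integrable_const_bound[where B=1]) auto
  have im: "integrable P (\<lambda>u. min (cdist c u) s)" by (rule integrable_min_cdist[OF P c s])
  \<comment> \<open>At \<open>cdist c u = s\<close> the identity holds for every value of
    \<open>w u\<close>, so every splitting of the level set gives the same integral.\<close>
  have eq: "w u * cdist c u = min (cdist c u) s - s + s * w u" for u
  proof (cases "cdist c u" s rule: linorder_cases)
    case equal then show ?thesis by (simp add: mult.commute)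
  qed (use w in \<open>auto simp: trimming_weight_def\<close>)
  have "distortion P c = (LINT u|P. w u * cdist c u)"
    unfolding distortion_eq_dual[OF P c] dual_value_def eq s_def[symmetric]
    using iw im w by (simp add: P.prob_space trimming_weight_def algebra_simps)
  moreover have "integrable P (\<lambda>u. w u * cdist c u)" unfolding eq using iw im by simp
  ultimately show ?thesis using that w by blast
qed

text \<open>Weak duality, pointwise in \<open>u\<close>. Together with
  \<open>distortion_eq_dual\<close> it makes the distortion the maximum of the dual
  function.\<close>

lemma dual_value_le_distortion:
  assumes P: "concentrated P" and c: "c \<in> codebooks \<Omega> k" and t: "0 \<le> t"
  shows "dual_value P c t \<le> distortion P c"
proof -
  obtain s w where w: "trimming_weight P c s w" "integrable P (\<lambda>u. w u * cdist c u)"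
    and d: "distortion P c = (LINT u|P. w u * cdist c u)"
    using distortion_weight[OF P c] .
  interpret P: prob_space P using P by (simp add: concentrated_def)
  have setsP [measurable_cong]: "sets P = sets borel" using P by (simp add: concentrated_def)
  have [measurable]: "w \<in> borel_measurable borel" and w01: "\<And>u. 0 \<le> w u" "\<And>u. w u \<le> 1"
    using w by (auto simp: trimming_weight_def)
  have iw: "integrable P w" using w01 by (intro P.integrable_const_bound[where B=1]) auto
  note im = integrable_min_cdist[OF P c t]
  have "dual_value P c t = (LINT u|P. min (cdist c u) t - t * (1 - w u))"
    using iw im w by (simp add: dual_value_def P.prob_space trimming_weight_def)
  also have "\<dots> \<le> (LINT u|P. w u * cdist c u)"
  proof (rule integral_mono)
    fix u
    have "min (cdist c u) t * (1 - w u) \<le> t * (1 - w u)" using w01[of u] by (intro mult_right_mono) auto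
    moreover have "w u * min (cdist c u) t \<le> w u * cdist c u" using w01[of u] by (intro mult_left_mono) auto
    ultimately show "min (cdist c u) t - t * (1 - w u) \<le> w u * cdist c u" by (simp add: algebra_simps)
  qed (use iw im w in auto)
  finally show ?thesis by (simp add: d)
qed

text \<open>The weight may miss the mass \<open>h\<close>; the defect is charged at the trimming
  level \<open>s\<close>. The mass bound on \<open>s\<close> is exported because it keeps the level
  bounded when the measure varies with the sample.\<close>

lemma distortion_le_weighted:
  assumes P: "concentrated P" and c: "c \<in> codebooks \<Omega> k"
    and w: "w \<in> borel_measurable borel" "\<And>u. 0 \<le> w u" "\<And>u. w u \<le> 1"
    and int: "integrable P (\<lambda>u. w u * cdist c u)"
  obtains s where "0 \<le> s" "measure P {u. cdist c u < s} \<le> h"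
    "distortion P c \<le> (LINT u|P. w u * cdist c u) + s * (h - (LINT u|P. w u))"
proof -
  define s where "s = (trim_radius \<Omega> \<phi> k P h c)\<^sup>2"
  have s: "0 \<le> s" by (simp add: s_def)
  interpret P: prob_space P using P by (simp add: concentrated_def)
  have setsP [measurable_cong]: "sets P = sets borel" using P by (simp add: concentrated_def)
  note [measurable] = w(1)
  have iw: "integrable P w" using w by (intro P.integrable_const_bound[where B=1]) auto
  note im = integrable_min_cdist[OF P c s]
  have "distortion P c - s * (h - (LINT u|P. w u)) = (LINT u|P. min (cdist c u) s - s * (1 - w u))"
    using iw im w distortion_eq_dual[OF P c]
    by (simp add: dual_value_def P.prob_space s_def algebra_simps)
  also have "\<dots> \<le> (LINT u|P. w u * cdist c u)"
  proof (rule integral_mono)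
    fix u
    have "min (cdist c u) s * (1 - w u) \<le> s * (1 - w u)" using w(3)[of u] by (intro mult_right_mono) auto
    moreover have "w u * min (cdist c u) s \<le> w u * cdist c u" using w(2)[of u] by (intro mult_left_mono) auto
    ultimately show "min (cdist c u) s - s * (1 - w u) \<le> w u * cdist c u" by (simp add: algebra_simps)
  qed (use iw im int in auto)
  finally show ?thesis
    using that[of s] s trim_radius_quantile(2)[OF P c] by (simp add: s_def)
qed

lemma distortion_nonneg:
  assumes "concentrated P" "c \<in> codebooks \<Omega> k"
  shows "0 \<le> distortion P c"
  using dual_value_le_distortion[OF assms, of 0] cdist_nonneg[OF assms(2)]
  by (simp add: dual_value_def min_absorb2)

text \<open>One of two equal codepoints is free to move. It goes to a point \<open>u0\<close> around
  which there is kept mass at positive divergence; the old weight remains admissible and its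
  integral drops strictly.\<close>

lemma distortion_add_point:
  assumes P: "concentrated P" "absolutely_continuous lborel P" and c: "c \<in> codebooks \<Omega> k"
    and ij: "i < k" "j < k" "i \<noteq> j" "c i = c j"
  shows "\<exists>c'\<in>codebooks \<Omega> k. distortion P c' < distortion P c"
proof -
  obtain s w where w: "trimming_weight P c s w" "integrable P (\<lambda>u. w u * cdist c u)"
    and d: "distortion P c = (LINT u|P. w u * cdist c u)"
    using distortion_weight[OF P(1) c] .
  interpret P: prob_space P using P by (simp add: concentrated_def)
  have setsP [measurable_cong]: "sets P = sets borel" using P by (simp add: concentrated_def)
  note [simp] = concentratedD(3)[OF P(1)]
  have [measurable]: "w \<in> borel_measurable borel" and w01: "\<And>u. 0 \<le> w u" "\<And>u. w u \<le> 1"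
    using w by (auto simp: trimming_weight_def)
  define E where "E = {u \<in> interior \<Omega>. 0 < w u \<and> 0 < cdist c u}"
  have E: "E \<in> sets borel" unfolding E_def by measurable
  \<comment> \<open>Otherwise the weight would vanish almost everywhere off the finitely many
    codepoints, which are null by absolute continuity, and could not have mass
    \<open>h > 0\<close>.\<close>
  have "emeasure P E \<noteq> 0"
  proof
    assume "emeasure P E = 0"
    then have "AE u in P. u \<notin> E" using E setsP by (intro AE_not_in) (auto simp: null_sets_def)
    moreover have "c ` {..<k} \<in> null_sets P"
      using P(2) unfolding absolutely_continuous_def
      by (rule subsetD) (auto intro!: finite_imp_null_set_lborel)
    then have "AE u in P. u \<notin> c ` {..<k}" by (rule AE_not_in)
    ultimately have "AE u in P. w u = 0"
      using AE_concentrated[OF P(1)]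
    proof eventually_elim
      case (elim u)
      obtain l where l: "l < k" "cbreg u c = breg u (c l)" by (rule cbreg_attained)
      have "0 < breg u (c l)" using elim l c interior_subset
        by (intro bregman_pos) (auto simp: codebooks_def)
      then show ?case using elim l w01(1)[of u] by (auto simp: E_def cdist_def less_le)
    qed
    then have "(LINT u|P. w u) = (LINT u|P. 0)" by (intro integral_cong_AE) auto
    then show False using w h by (simp add: trimming_weight_def)
  qed
  then obtain u0 where u0: "u0 \<in> E" "\<And>V. open V \<Longrightarrow> u0 \<in> V \<Longrightarrow> emeasure P (V \<inter> E) \<noteq> 0"
    using exists_point_positive_measure[OF setsP E] by blast
  define c' where "c' = c(i := u0)"
  have c': "c' \<in> codebooks \<Omega> k"
    using c u0 ij interior_subset by (auto simp: c'_def codebooks_def E_def PiE_iff extensional_def)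
  \<comment> \<open>The copy \<open>c j\<close> stands in for the codepoint that has moved.\<close>
  have le: "cbreg u c' \<le> cbreg u c" for u
  proof -
    obtain l where l: "l < k" "cbreg u c = breg u (c l)" by (rule cbreg_attained)
    show ?thesis
      using cbreg_le[of l u c'] cbreg_le[of j u c'] l ij by (cases "l = i") (auto simp: c'_def)
  qed
  define U where "U = interior \<Omega> \<inter> (\<lambda>u. cbreg u c - breg u u0) -` {0<..}"
  have "open U"
    unfolding U_def
    by (intro continuous_open_preimage continuous_intros continuous_on_subset[OF continuous_on_cbreg]
        continuous_on_subset[OF continuous_on_bregman_fst]) (auto simp: interior_subset)
  have "u0 \<in> U" using u0(1) by (auto simp: U_def E_def cdist_def)
  have UE: "emeasure P (U \<inter> E) \<noteq> 0" by (rule u0(2)) fact+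
  have lt: "cdist c' u < cdist c u" if "u \<in> U" for u
    using that cbreg_le[of i u c'] ij by (auto simp: U_def cdist_def c'_def)
  have le': "cdist c' u \<le> cdist c u" for u using le by (simp add: cdist_def)
  have int': "integrable P (\<lambda>u. w u * cdist c' u)"
  proof (rule Bochner_Integration.integrable_bound[OF w(2)])
    show "AE u in P. norm (w u * cdist c' u) \<le> norm (w u * cdist c u)"
      using le' w01 cdist_nonneg[OF c'] cdist_nonneg[OF c] by (auto simp: abs_mult intro!: mult_left_mono)
  qed measurable
  obtain s' where "distortion P c' \<le> (LINT u|P. w u * cdist c' u) + s' * (h - (LINT u|P. w u))"
    using distortion_le_weighted[OF P(1) c' _ w01 int'] by auto
  then have "distortion P c' \<le> (LINT u|P. w u * cdist c' u)" using w by (simp add: trimming_weight_def)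
  also have "\<dots> < (LINT u|P. w u * cdist c u)"
  proof (rule P.integral_less_AE[OF int' w(2) UE])
    show "U \<inter> E \<in> sets P" using \<open>open U\<close> E setsP by auto
    show "AE u in P. u \<in> U \<inter> E \<longrightarrow> w u * cdist c' u \<noteq> w u * cdist c u"
      using lt by (intro AE_I2) (force simp: E_def)
    show "AE u in P. w u * cdist c' u \<le> w u * cdist c u"
      using le' w01 by (intro AE_I2 mult_left_mono) auto
  qed
  finally show ?thesis using d c' by auto
qed

end

section \<open>Laws of large numbers, null sets and exchangeability\<close>

text \<open>A nondecreasing sum is squeezed between its values at two consecutive squares, whose
  ratio tends to 1.\<close>

lemma averages_tendsto_of_squares:
  fixes S :: "nat \<Rightarrow> real"
  assumes mono: "mono S" and nonneg: "\<And>n. 0 \<le> S n"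
    and lim: "(\<lambda>m. S (m\<^sup>2) / (real m)\<^sup>2) \<longlonglongrightarrow> \<mu>"
  shows "(\<lambda>n. S n / real n) \<longlonglongrightarrow> \<mu>"
proof -
  define q where "q n = nat \<lfloor>sqrt (real n)\<rfloor>" for n :: nat
  have q_le: "(q n)\<^sup>2 \<le> n" and q_less: "n < (Suc (q n))\<^sup>2" for n
  proof -
    have q: "real (q n) \<le> sqrt (real n)" "sqrt (real n) < real (q n) + 1"
      unfolding q_def using of_int_floor_le[of "sqrt (real n)"] floor_correct[of "sqrt (real n)"] by simp_all
    have "(real (q n))\<^sup>2 \<le> real n" using power_mono[OF q(1), of 2] by simp
    then show "(q n)\<^sup>2 \<le> n" by (metis of_nat_le_iff of_nat_power)
    have "real n < (real (q n) + 1)\<^sup>2" using power_strict_mono[OF q(2), of 2] by simp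
    then show "n < (Suc (q n))\<^sup>2" by (metis of_nat_Suc of_nat_less_iff of_nat_power add.commute)
  qed
  have q_lim: "filterlim q at_top sequentially"
    unfolding filterlim_at_top
  proof
    fix Z :: nat
    have "Z \<le> q n" if "n \<ge> Z\<^sup>2" for n
    proof (rule ccontr)
      assume "\<not> Z \<le> q n"
      then have "(Suc (q n))\<^sup>2 \<le> Z\<^sup>2" by (intro power_mono) auto
      with q_less[of n] that show False by linarith
    qed
    then show "\<forall>\<^sub>F n in sequentially. Z \<le> q n" by (auto simp: eventually_sequentially)
  qed
  have r1: "(\<lambda>m. (real m / (real m + 1))\<^sup>2) \<longlonglongrightarrow> 1\<^sup>2"
    using LIMSEQ_n_over_Suc_n[where 'a=real] by (intro tendsto_power) (simp add: add.commute)
  have r2: "(\<lambda>m. ((real m + 1) / real m)\<^sup>2) \<longlonglongrightarrow> 1\<^sup>2"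
    using LIMSEQ_Suc_n_over_n[where 'a=real] by (intro tendsto_power) (simp add: add.commute)
  have lo: "(\<lambda>n. S ((q n)\<^sup>2) / (real (q n))\<^sup>2 * (real (q n) / (real (q n) + 1))\<^sup>2) \<longlonglongrightarrow> \<mu>"
    using filterlim_compose[OF tendsto_mult[OF lim r1] q_lim] by simp
  have hi: "(\<lambda>n. S ((Suc (q n))\<^sup>2) / (real (Suc (q n)))\<^sup>2 * ((real (q n) + 1) / real (q n))\<^sup>2) \<longlonglongrightarrow> \<mu>"
    using filterlim_compose[OF tendsto_mult[OF LIMSEQ_Suc[OF lim] r2] q_lim] by simp
  have q_pos: "\<forall>\<^sub>F n in sequentially. 1 \<le> q n" using q_lim by (simp add: filterlim_at_top)
  show ?thesis
  proof (rule tendsto_sandwich[OF _ _ lo hi])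
    show "\<forall>\<^sub>F n in sequentially. S ((q n)\<^sup>2) / (real (q n))\<^sup>2 * (real (q n) / (real (q n) + 1))\<^sup>2 \<le> S n / real n"
      using q_pos
    proof eventually_elim
      case (elim n)
      have n: "0 < real n" "real n \<le> (real (q n) + 1)\<^sup>2"
        using elim q_le[of n] q_less[of n]
        by (auto intro!: gr0I) (metis add.commute less_imp_le of_nat_Suc of_nat_le_iff of_nat_power)
      have "S ((q n)\<^sup>2) / (real (q n))\<^sup>2 * (real (q n) / (real (q n) + 1))\<^sup>2 = S ((q n)\<^sup>2) / (real (q n) + 1)\<^sup>2"
        using elim by (simp add: power_divide)
      also have "\<dots> \<le> S n / real n"
        using n nonneg monoD[OF mono q_le[of n]] by (intro frac_le) auto
      finally show ?case .
    qed
    show "\<forall>\<^sub>F n in sequentially. S n / real n \<le> S ((Suc (q n))\<^sup>2) / (real (Suc (q n)))\<^sup>2 * ((real (q n) + 1) / real (q n))\<^sup>2"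
      using q_pos
    proof eventually_elim
      case (elim n)
      have n: "(real (q n))\<^sup>2 \<le> real n"
        using q_le[of n] by (metis of_nat_le_iff of_nat_power)
      have "S n / real n \<le> S ((Suc (q n))\<^sup>2) / (real (q n))\<^sup>2"
        using n nonneg elim monoD[OF mono less_imp_le[OF q_less[of n]]] by (intro frac_le) auto
      also have "\<dots> = S ((Suc (q n))\<^sup>2) / (real (Suc (q n)))\<^sup>2 * ((real (q n) + 1) / real (q n))\<^sup>2"
        by (simp add: power_divide add.commute)
      finally show ?case .
    qed
  qed
qed

text \<open>Chebyshev and Borel--Cantelli along the squares; monotonicity of the sums of nonnegative
  variables fills the gaps.\<close>

lemma (in prob_space) strong_law_nonneg_L2:
  fixes Y :: "nat \<Rightarrow> 'a \<Rightarrow> real"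
  assumes indep: "indep_vars (\<lambda>_. borel) Y UNIV"
    and nonneg: "\<And>i \<omega>. 0 \<le> Y i \<omega>"
    and sq: "\<And>i. integrable M (\<lambda>\<omega>. (Y i \<omega>)\<^sup>2)"
    and mean: "\<And>i. expectation (Y i) = \<mu>"
    and second: "\<And>i. expectation (\<lambda>\<omega>. (Y i \<omega>)\<^sup>2) = v"
  shows "AE \<omega> in M. (\<lambda>n. (\<Sum>i<n. Y i \<omega>) / real n) \<longlonglongrightarrow> \<mu>"
proof -
  have [measurable]: "random_variable borel (Y i)" for i
    using indep by (auto simp: indep_vars_def)
  have int: "integrable M (Y i)" for i
    using square_integrable_imp_integrable[OF _ sq[of i]] by simp
  define \<sigma> where "\<sigma> = v - \<mu>\<^sup>2"
  define S where "S n \<omega> = (\<Sum>i<n. Y i \<omega>)" for n \<omega>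
  have [measurable]: "random_variable borel (S n)" for n unfolding S_def by measurable
  have int2: "integrable M (\<lambda>\<omega>. Y i \<omega> * Y j \<omega>)" for i j
  proof (cases "i = j")
    case True then show ?thesis using sq[of i] by (simp add: power2_eq_square)
  next
    case False
    then show ?thesis
      using indep_vars_integrable[OF _ indep_vars_subset[OF indep, of "{i, j}"]] int by simp
  qed
  have prod: "expectation (\<lambda>\<omega>. Y i \<omega> * Y j \<omega>) = \<mu>\<^sup>2 + (if i = j then \<sigma> else 0)" for i j
  proof (cases "i = j")
    case True then show ?thesis using second[of i] by (simp add: power2_eq_square \<sigma>_def)
  next
    case False
    then show ?thesis
      using indep_vars_lebesgue_integral[OF _ indep_vars_subset[OF indep, of "{i, j}"]] int mean
      by (simp add: power2_eq_square)
  qed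
  have S_sq: "(S n \<omega>)\<^sup>2 = (\<Sum>i<n. \<Sum>j<n. Y i \<omega> * Y j \<omega>)" for n \<omega>
    by (simp add: S_def power2_eq_square sum_product)
  have intS2: "integrable M (\<lambda>\<omega>. (S n \<omega>)\<^sup>2)" for n
    unfolding S_sq by (intro Bochner_Integration.integrable_sum int2)
  have meanS: "expectation (S n) = real n * \<mu>" for n
    unfolding S_def using int mean by simp
  have "expectation (\<lambda>\<omega>. (S n \<omega>)\<^sup>2) = (real n * \<mu>)\<^sup>2 + real n * \<sigma>" for n
  proof -
    have "expectation (\<lambda>\<omega>. (S n \<omega>)\<^sup>2) = (\<Sum>i<n. \<Sum>j<n. \<mu>\<^sup>2 + (if i = j then \<sigma> else 0))"
      unfolding S_sq using int2 by (simp add: Bochner_Integration.integral_sum prod)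
    also have "\<dots> = (real n * \<mu>)\<^sup>2 + real n * \<sigma>"
      by (simp add: sum.distrib power2_eq_square algebra_simps)
    finally show ?thesis .
  qed
  then have var: "variance (S n) = real n * \<sigma>" for n
    using intS2 square_integrable_imp_integrable[OF _ intS2] meanS by (subst variance_eq) auto
  have dev: "AE \<omega> in M. \<forall>\<^sub>F m in sequentially. \<bar>S (m\<^sup>2) \<omega> - (real m)\<^sup>2 * \<mu>\<bar> < (real m)\<^sup>2 * \<epsilon>"
    if \<epsilon>: "0 < \<epsilon>" for \<epsilon>
  proof -
    \<comment> \<open>Along squares the Chebyshev bound is of order \<open>1 / m\<^sup>2\<close>,
      hence summable; \<open>Suc m\<close> avoids a threshold equal to 0.\<close>
    define A where "A m = {\<omega> \<in> space M. (real (Suc m))\<^sup>2 * \<epsilon> \<le> \<bar>S ((Suc m)\<^sup>2) \<omega> - (real (Suc m))\<^sup>2 * \<mu>\<bar>}" for m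
    have A: "prob (A m) \<le> \<sigma> / \<epsilon>\<^sup>2 * (1 / (real (Suc m))\<^sup>2)" for m
    proof -
      have "prob (A m) \<le> variance (S ((Suc m)\<^sup>2)) / ((real (Suc m))\<^sup>2 * \<epsilon>)\<^sup>2"
        unfolding A_def
        using Chebyshev_inequality[of "S ((Suc m)\<^sup>2)" "(real (Suc m))\<^sup>2 * \<epsilon>"] \<epsilon> intS2
        by (simp add: meanS)
      also have "\<dots> = \<sigma> / \<epsilon>\<^sup>2 * (1 / (real (Suc m))\<^sup>2)"
      proof -
        have "a\<^sup>2 * \<sigma> / (a\<^sup>2 * \<epsilon>)\<^sup>2 = \<sigma> / \<epsilon>\<^sup>2 * (1 / a\<^sup>2)" if "0 < a" for a :: real
          using \<epsilon> that by (simp add: field_simps power2_eq_square)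
        from this[of "real (Suc m)"] show ?thesis unfolding var by (simp del: of_nat_Suc)
      qed
      finally show ?thesis .
    qed
    have "summable (\<lambda>m. prob (A m))"
    proof (rule summable_comparison_test)
      show "summable (\<lambda>m. \<sigma> / \<epsilon>\<^sup>2 * (1 / (real (Suc m))\<^sup>2))"
      proof (rule summable_mult)
        have "summable (\<lambda>m. 1 / (real m)\<^sup>2)"
          using inverse_power_summable[of 2, where 'a=real] by (simp add: inverse_eq_divide)
        then show "summable (\<lambda>m. 1 / (real (Suc m))\<^sup>2)"
          by (subst (asm) summable_Suc_iff[symmetric])
      qed
    qed (use A in auto)
    then have "AE \<omega> in M. \<forall>\<^sub>F m in sequentially. \<omega> \<in> space M - A m"
      by (intro borel_cantelli_AE1) (auto simp: A_def emeasure_eq_measure)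
    then show ?thesis
    proof eventually_elim
      case (elim \<omega>)
      then have "\<forall>\<^sub>F m in sequentially. \<bar>S ((Suc m)\<^sup>2) \<omega> - (real (Suc m))\<^sup>2 * \<mu>\<bar> < (real (Suc m))\<^sup>2 * \<epsilon>"
        by eventually_elim (auto simp: A_def)
      then show ?case by (subst (asm) eventually_sequentially_Suc)
    qed
  qed
  have "AE \<omega> in M. \<forall>l. \<forall>\<^sub>F m in sequentially. \<bar>S (m\<^sup>2) \<omega> - (real m)\<^sup>2 * \<mu>\<bar> < (real m)\<^sup>2 * (1 / Suc l)"
    by (intro AE_all_countable[THEN iffD2] allI dev) simp
  then show ?thesis
  proof eventually_elim
    case (elim \<omega>)
    have "(\<lambda>m. S (m\<^sup>2) \<omega> / (real m)\<^sup>2) \<longlonglongrightarrow> \<mu>"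
      unfolding tendsto_iff
    proof (intro allI impI)
      fix e :: real assume "0 < e"
      then obtain l where l: "1 / real (Suc l) < e" using nat_approx_posE by blast
      have "\<forall>\<^sub>F m in sequentially. (0::nat) < m" by (rule eventually_gt_at_top)
      with elim[rule_format, of l] show "\<forall>\<^sub>F m in sequentially. dist (S (m\<^sup>2) \<omega> / (real m)\<^sup>2) \<mu> < e"
      proof eventually_elim
        case (elim m)
        have "\<bar>S (m\<^sup>2) \<omega> / (real m)\<^sup>2 - \<mu>\<bar> = \<bar>S (m\<^sup>2) \<omega> - (real m)\<^sup>2 * \<mu>\<bar> / (real m)\<^sup>2"
          using elim by (simp add: field_simps abs_divide)
        also have "\<dots> < 1 / real (Suc l)" using elim by (simp add: divide_less_eq mult.commute)
        finally show ?case using l by (simp add: dist_real_def)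
      qed
    qed
    then have "(\<lambda>n. S n \<omega> / real n) \<longlonglongrightarrow> \<mu>"
      by (intro averages_tendsto_of_squares)
        (auto simp: S_def nonneg sum_nonneg intro!: monoI sum_mono2)
    then show ?case by (simp add: S_def)
  qed
qed

section \<open>Null sets of Lebesgue measure and of product measures, by slices\<close>

text \<open>Averaging over the translates by \<open>t *\<^sub>R b\<close>, with \<open>t\<close> in
  the unit interval, leaves Lebesgue measure unchanged; after exchanging the integrals, each line
  contributes a countable set. Translates avoid a choice of coordinates along
  \<open>b\<close>.\<close>

lemma emeasure_lborel_eq_0_lines:
  fixes N :: "'a::euclidean_space set"
  assumes N [measurable]: "N \<in> sets borel" and lines: "\<And>y. countable {t. y + t *\<^sub>R b \<in> N}"
  shows "emeasure lborel N = 0"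
proof -
  have shift: "(\<integral>\<^sup>+y. indicator N (t *\<^sub>R b + y) \<partial>lborel) = emeasure lborel N" for t
  proof -
    have "emeasure lborel N = (\<integral>\<^sup>+y. indicator N y \<partial>distr lborel borel ((+) (t *\<^sub>R b)))"
      by (simp add: lborel_distr_plus del: nn_integral_indicator) simp
    also have "\<dots> = (\<integral>\<^sup>+y. indicator N (t *\<^sub>R b + y) \<partial>lborel)"
      by (rule nn_integral_distr) measurable
    finally show ?thesis by simp
  qed
  then have "emeasure lborel N = (\<integral>\<^sup>+t. indicator {0..1::real} t * (\<integral>\<^sup>+y. indicator N (t *\<^sub>R b + y) \<partial>lborel) \<partial>lborel)"
    unfolding shift by (simp add: nn_integral_multc)
  also have "\<dots> = (\<integral>\<^sup>+t. \<integral>\<^sup>+y. indicator {0..1::real} t * indicator N (t *\<^sub>R b + y) \<partial>lborel \<partial>lborel)"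
    by (intro nn_integral_cong nn_integral_cmult[symmetric]) measurable
  also have "\<dots> = (\<integral>\<^sup>+y. \<integral>\<^sup>+t. indicator {0..1::real} t * indicator N (t *\<^sub>R b + y) \<partial>lborel \<partial>lborel)"
    by (rule lborel_pair.Fubini') measurable
  also have "\<dots> = (\<integral>\<^sup>+(y::'a). 0 \<partial>lborel)"
  proof (rule nn_integral_cong)
    fix y :: 'a
    have "AE t in lborel. t \<notin> {t. y + t *\<^sub>R b \<in> N}"
      by (intro AE_not_in countable_imp_null_set_lborel lines)
    then have "(\<integral>\<^sup>+t. indicator {0..1::real} t * indicator N (t *\<^sub>R b + y) \<partial>lborel) = (\<integral>\<^sup>+(t::real). 0 \<partial>lborel)"
      by (intro nn_integral_cong_AE) (auto elim!: eventually_mono simp: add.commute indicator_def)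
    then show "(\<integral>\<^sup>+t. indicator {0..1::real} t * indicator N (t *\<^sub>R b + y) \<partial>lborel) = 0" by simp
  qed
  finally show ?thesis by simp
qed

text \<open>Resampling coordinate \<open>i\<close> independently preserves the product law, so the
  slices in that coordinate can be integrated first.\<close>

lemma null_PiM_slices:
  fixes P :: "'a measure" and i :: nat
  assumes P: "prob_space P" "space P = UNIV"
    and T: "T \<in> sets (PiM UNIV (\<lambda>_::nat. P))"
    and slices: "\<And>x. emeasure P {y. x(i := y) \<in> T} = 0"
  shows "emeasure (PiM UNIV (\<lambda>_::nat. P)) T = 0"
proof -
  let ?S = "PiM UNIV (\<lambda>_::nat. P)"
  interpret P: prob_space P by fact
  interpret S: prob_space ?S by (intro prob_space_PiM P)
  interpret pair_sigma_finite P ?S ..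
  have [measurable]: "(\<lambda>(y, x). x(i := y)) \<in> P \<Otimes>\<^sub>M ?S \<rightarrow>\<^sub>M ?S"
    unfolding case_prod_unfold by (rule measurable_fun_upd[where J=UNIV]) auto
  have eq: "distr (P \<Otimes>\<^sub>M ?S) ?S (\<lambda>(y, x). x(i := y)) = ?S"
    using distr_pair_PiM_eq_PiM[of UNIV "\<lambda>_. P" i] P by simp
  have "emeasure ?S T = emeasure (P \<Otimes>\<^sub>M ?S) ((\<lambda>(y, x). x(i := y)) -` T \<inter> space (P \<Otimes>\<^sub>M ?S))"
    using T by (subst eq[symmetric]) (simp add: emeasure_distr)
  also have "\<dots> = (\<integral>\<^sup>+x. emeasure P ((\<lambda>y. (y, x)) -` ((\<lambda>(y, x). x(i := y)) -` T \<inter> space (P \<Otimes>\<^sub>M ?S))) \<partial>?S)"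
    using T by (intro emeasure_pair_measure_alt2 measurable_sets) measurable
  also have "\<dots> = (\<integral>\<^sup>+x. 0 \<partial>?S)"
    by (intro nn_integral_cong) (use slices P in \<open>auto simp: space_pair_measure space_PiM vimage_def\<close>)
  finally show ?thesis by simp
qed


text \<open>A zero with nonzero derivative is isolated. Zeros isolated by more than
  \<open>1 / Suc n\<close> have distinct values under the rounding map below, hence form a countable
  set.\<close>

lemma countable_simple_zeros:
  fixes f :: "real \<Rightarrow> real"
  shows "countable {t. f t = 0 \<and> (\<exists>D. D \<noteq> 0 \<and> (f has_real_derivative D) (at t))}" (is "countable ?Z")
proof -
  have "\<exists>d>0. \<forall>s. s \<noteq> z \<and> \<bar>s - z\<bar> < d \<longrightarrow> f s \<noteq> 0" if z: "z \<in> ?Z" for z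
  proof -
    obtain D where "D \<noteq> 0" "((\<lambda>s. (f s - f z) / (s - z)) \<longlongrightarrow> D) (at z)"
      using z unfolding has_field_derivative_iff by blast
    then have "\<forall>\<^sub>F s in at z. (f s - f z) / (s - z) \<noteq> 0"
      by (rule tendsto_imp_eventually_ne[rotated])
    then obtain d where "0 < d" "\<And>s. s \<noteq> z \<Longrightarrow> \<bar>s - z\<bar> < d \<Longrightarrow> (f s - f z) / (s - z) \<noteq> 0"
      unfolding eventually_at dist_real_def by blast
    moreover have "f z = 0" using z by blast
    ultimately show ?thesis by (intro exI[of _ d]) auto
  qed
  then have "\<forall>z\<in>?Z. \<exists>d>0. \<forall>s. s \<noteq> z \<and> \<bar>s - z\<bar> < d \<longrightarrow> f s \<noteq> 0" by (rule ballI)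
  then obtain d where d': "\<forall>z\<in>?Z. 0 < d z \<and> (\<forall>s. s \<noteq> z \<and> \<bar>s - z\<bar> < d z \<longrightarrow> f s \<noteq> 0)"
    by (rule bchoice[THEN exE])
  have d: "0 < d z" "s \<noteq> z \<Longrightarrow> \<bar>s - z\<bar> < d z \<Longrightarrow> f s \<noteq> 0" if "z \<in> ?Z" for z s
    using bspec[OF d' that] by blast+
  have "countable {z \<in> ?Z. 1 / real (Suc n) < d z}" for n
  proof (rule countableI')
    show "inj_on (\<lambda>z. \<lfloor>z * real (Suc n)\<rfloor>) {z \<in> ?Z. 1 / real (Suc n) < d z}"
    proof (rule inj_onI, rule ccontr)
      fix y z assume y: "y \<in> {z \<in> ?Z. 1 / real (Suc n) < d z}" and z: "z \<in> {z \<in> ?Z. 1 / real (Suc n) < d z}"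
        and eq: "\<lfloor>y * real (Suc n)\<rfloor> = \<lfloor>z * real (Suc n)\<rfloor>" and "y \<noteq> z"
      have "\<bar>y * real (Suc n) - z * real (Suc n)\<bar> < 1"
        using eq by linarith
      then have "\<bar>y - z\<bar> * real (Suc n) < 1" by (simp add: abs_mult flip: left_diff_distrib)
      then have "\<bar>y - z\<bar> < 1 / real (Suc n)" by (simp add: less_divide_eq)
      moreover have "z \<in> ?Z" "1 / real (Suc n) < d z" "f y = 0" using y z by blast+
      ultimately show False using d(2)[of z y] \<open>y \<noteq> z\<close> by linarith
    qed
  qed
  then have "countable (\<Union>n. {z \<in> ?Z. 1 / real (Suc n) < d z})" by blast
  moreover have "?Z \<subseteq> (\<Union>n. {z \<in> ?Z. 1 / real (Suc n) < d z})"
  proof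
    fix z assume z: "z \<in> ?Z"
    then obtain n where "1 / real (Suc n) < d z" using nat_approx_posE[OF d(1)[OF z]] by blast
    with z show "z \<in> (\<Union>n. {z \<in> ?Z. 1 / real (Suc n) < d z})" by blast
  qed
  ultimately show ?thesis by (rule countable_subset[rotated])
qed

section \<open>Approximation by cylinders and the Hewitt--Savage zero-one law\<close>

definition cylinder :: "nat \<Rightarrow> (nat \<Rightarrow> 'a) set \<Rightarrow> bool" where
  "cylinder n A \<longleftrightarrow> (\<forall>x y. (\<forall>i<n. x i = y i) \<longrightarrow> x \<in> A \<longrightarrow> y \<in> A)"

lemma cylinder_mono: "cylinder m A \<Longrightarrow> m \<le> n \<Longrightarrow> cylinder n A"
  unfolding cylinder_def by (meson order_less_le_trans)

lemma cylinderD: "cylinder n A \<Longrightarrow> (\<And>i. i < n \<Longrightarrow> x i = y i) \<Longrightarrow> x \<in> A \<longleftrightarrow> y \<in> A"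
  unfolding cylinder_def by metis

text \<open>The sets that cylinders approximate in measure contain the coordinate preimages and are
  closed under complements and countable unions.\<close>

lemma cylinder_approximation:
  fixes P :: "'a measure" and T :: "(nat \<Rightarrow> 'a) set"
  assumes P: "prob_space P" "space P = UNIV" and T: "T \<in> sets (PiM UNIV (\<lambda>_::nat. P))" and "0 < \<epsilon>"
  shows "\<exists>n A. A \<in> sets (PiM UNIV (\<lambda>_::nat. P)) \<and> cylinder n A \<and>
    measure (PiM UNIV (\<lambda>_::nat. P)) ((T - A) \<union> (A - T)) < \<epsilon>"
proof -
  let ?S = "PiM UNIV (\<lambda>_::nat. P)"
  interpret S: prob_space ?S by (intro prob_space_PiM P)
  have space_S: "space ?S = UNIV" using P(2) by (auto simp: space_PiM)
  have "T \<in> sigma_sets (\<Pi>\<^sub>E i\<in>UNIV. space P) {{f \<in> \<Pi>\<^sub>E i\<in>UNIV. space P. f i \<in> A} |(i::nat) A. i \<in> UNIV \<and> A \<in> sets P}"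
    using T by (simp add: sets_PiM_single)
  then show ?thesis
    using \<open>0 < \<epsilon>\<close>
  proof (induction arbitrary: \<epsilon> rule: sigma_sets.induct)
    case (Basic B)
    then obtain i :: nat and A where A: "A \<in> sets P" "B = {f. f i \<in> A}"
      using P by (auto simp: PiE_UNIV_domain)
    have "(\<lambda>f. f i) -` A \<inter> space ?S \<in> sets ?S"
      using A(1) by (intro measurable_sets[OF measurable_component_singleton]) auto
    then have "B \<in> sets ?S" using A(2) by (simp add: space_S vimage_def)
    then show ?case using A Basic by (intro exI[of _ "Suc i"] exI[of _ B]) (simp add: cylinder_def)
  next
    case Empty
    then show ?case by (intro exI[of _ 0] exI[of _ "{}"]) (auto simp: cylinder_def)
  next
    case (Compl a)
    then obtain n A where A: "A \<in> sets ?S" "cylinder n A" "measure ?S ((a - A) \<union> (A - a)) < \<epsilon>" by blast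
    have "((\<Pi>\<^sub>E i\<in>UNIV. space P) - a - (- A)) \<union> (- A - ((\<Pi>\<^sub>E i\<in>UNIV. space P) - a)) = (a - A) \<union> (A - a)"
      using P by auto
    moreover have "- A \<in> sets ?S" using sets.compl_sets[OF A(1)] by (simp add: space_S Compl_eq_Diff_UNIV)
    moreover have "cylinder n (- A)" using A(2) unfolding cylinder_def by (metis ComplD ComplI)
    ultimately show ?case using A(3) by metis
  next
    case (Union a)
    have a: "a i \<in> sets ?S" for i using Union.hyps by (simp add: sets_PiM_single)
    have "(\<lambda>n. measure ?S (\<Union>i<n. a i)) \<longlonglongrightarrow> measure ?S (\<Union>n. \<Union>i<n. a i)"
      using a by (intro S.finite_Lim_measure_incseq) (auto simp: incseq_def intro: less_le_trans)
    also have "(\<Union>n. \<Union>i<n. a i) = (\<Union>i. a i)" by auto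
    finally have "\<forall>\<^sub>F n in sequentially. measure ?S (\<Union>i. a i) - \<epsilon> / 2 < measure ?S (\<Union>i<n. a i)"
      using Union.prems by (intro order_tendstoD) auto
    then obtain N where N: "measure ?S (\<Union>i. a i) - \<epsilon> / 2 < measure ?S (\<Union>i<N. a i)"
      by (auto simp: eventually_sequentially)
    \<comment> \<open>Half of \<open>\<epsilon>\<close> pays for truncating the union, the other
      half is shared by the \<open>N\<close> approximations; \<open>+ 1\<close> covers
      \<open>N = 0\<close>.\<close>
    define \<delta> where "\<delta> = \<epsilon> / (2 * (real N + 1))"
    have \<delta>: "0 < \<delta>" using Union.prems by (simp add: \<delta>_def)
    obtain n A where A: "\<And>i. A i \<in> sets ?S" "\<And>i. cylinder (n i) (A i)"
        "\<And>i. measure ?S ((a i - A i) \<union> (A i - a i)) < \<delta>"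
      using Union.IH[OF \<delta>] by metis
    let ?A = "\<Union>i<N. A i"
    have [simp]: "?A \<in> sets ?S" "(\<Union>i. a i) \<in> sets ?S" "(\<Union>i<N. a i) \<in> sets ?S" using A a by auto
    have "cylinder (Max (n ` {..<N})) ?A"
      unfolding cylinder_def
    proof (intro allI impI)
      fix x y assume xy: "\<forall>i<Max (n ` {..<N}). x i = y i" and "x \<in> ?A"
      then obtain i where i: "i < N" "x \<in> A i" by auto
      then have "cylinder (Max (n ` {..<N})) (A i)" by (intro cylinder_mono[OF A(2)]) auto
      then have "y \<in> A i" using xy i unfolding cylinder_def by blast
      then show "y \<in> ?A" using i by auto
    qed
    moreover have "measure ?S (((\<Union>i. a i) - ?A) \<union> (?A - (\<Union>i. a i))) < \<epsilon>"
    proof -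
      have "measure ?S (((\<Union>i. a i) - ?A) \<union> (?A - (\<Union>i. a i))) \<le>
          measure ?S (((\<Union>i. a i) - (\<Union>i<N. a i)) \<union> (\<Union>i<N. (a i - A i) \<union> (A i - a i)))"
        using A a by (intro S.finite_measure_mono) (auto intro!: sets.Un sets.Diff sets.finite_UN)
      also have "\<dots> \<le> measure ?S ((\<Union>i. a i) - (\<Union>i<N. a i)) + measure ?S (\<Union>i<N. (a i - A i) \<union> (A i - a i))"
        using A a by (intro measure_Un_le) auto
      finally have "measure ?S (((\<Union>i. a i) - ?A) \<union> (?A - (\<Union>i. a i))) \<le>
        measure ?S ((\<Union>i. a i) - (\<Union>i<N. a i)) + measure ?S (\<Union>i<N. (a i - A i) \<union> (A i - a i))" .
      moreover have "measure ?S ((\<Union>i. a i) - (\<Union>i<N. a i)) = measure ?S (\<Union>i. a i) - measure ?S (\<Union>i<N. a i)"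
        by (rule S.finite_measure_Diff) auto
      moreover have "measure ?S (\<Union>i<N. (a i - A i) \<union> (A i - a i)) \<le> (\<Sum>i<N. measure ?S ((a i - A i) \<union> (A i - a i)))"
        using A a by (intro S.finite_measure_subadditive_finite) auto
      moreover have "(\<Sum>i<N. measure ?S ((a i - A i) \<union> (A i - a i))) \<le> (\<Sum>i<N. \<delta>)"
        by (intro sum_mono less_imp_le A)
      moreover have "(\<Sum>i<N. \<delta>) \<le> \<epsilon> / 2"
        using Union.prems by (simp add: \<delta>_def field_simps)
      ultimately show ?thesis using N by linarith
    qed
    ultimately show ?case using \<open>?A \<in> sets ?S\<close> by (intro exI conjI)
  qed
qed

text \<open>Carries a cylinder over the first block to one over a disjoint block, hence to an
  independent event.\<close>

definition block_swap :: "nat \<Rightarrow> nat \<Rightarrow> nat" where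
  "block_swap n i = (if i < n then i + n else if i < 2 * n then i - n else i)"

lemma inj_block_swap: "inj (block_swap n)"
  by (rule injI) (auto simp: block_swap_def split: if_splits)

text \<open>The event \<open>T\<close> is close to a cylinder \<open>A\<close> and, by symmetry,
  equally close to the swapped cylinder \<open>A'\<close>. As \<open>A\<close> and \<open>A'\<close>
  are independent with equal probability, the probability \<open>p\<close> of \<open>T\<close>
  satisfies \<open>p = p\<^sup>2\<close> up to a multiple of \<open>\<epsilon>\<close>.\<close>

theorem hewitt_savage:
  fixes P :: "'a measure"
  assumes prob: "prob_space P" "space P = UNIV" and T: "T \<in> sets (PiM UNIV (\<lambda>_::nat. P))"
    and sym: "\<And>n x. (\<lambda>i. x (block_swap n i)) \<in> T \<longleftrightarrow> x \<in> T"
  shows "measure (PiM UNIV (\<lambda>_::nat. P)) T = 0 \<or> measure (PiM UNIV (\<lambda>_::nat. P)) T = 1"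
proof -
  let ?S = "PiM UNIV (\<lambda>_::nat. P)"
  interpret P: prob_space P by (rule prob(1))
  interpret S: prob_space ?S by (intro prob_space_PiM prob)
  interpret product_prob_space "\<lambda>_::nat. P" UNIV ..
  interpret seq: sequence_space P ..
  interpret SS: pair_prob_space ?S ?S ..
  have space_S: "space ?S = UNIV" using prob(2) by (auto simp: space_PiM)
  \<comment> \<open>\<open>2 * \<epsilon>\<close> comes from replacing \<open>T\<close> by
    \<open>A \<inter> A'\<close>, and \<open>2 * \<epsilon>\<close> from comparing the squared
    probabilities of \<open>A\<close> and \<open>T\<close>.\<close>
  have "\<bar>S.prob T - (S.prob T)\<^sup>2\<bar> \<le> 4 * \<epsilon>" if \<epsilon>: "0 < \<epsilon>" for \<epsilon>
  proof -
    obtain n A where A: "A \<in> sets ?S" "cylinder n A" and err: "S.prob ((T - A) \<union> (A - T)) < \<epsilon>"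
      using cylinder_approximation[OF prob T \<epsilon>] by blast
    define g :: "(nat \<Rightarrow> 'a) \<Rightarrow> nat \<Rightarrow> 'a" where "g = (\<lambda>x i. x (block_swap n i))"
    have g_meas [measurable]: "g \<in> ?S \<rightarrow>\<^sub>M ?S"
      unfolding g_def by (rule measurable_PiM_single') (auto simp: space_PiM prob(2))
    have g_distr: "distr ?S ?S g = ?S"
      using distr_PiM_reindex[of UNIV "\<lambda>_. P" "block_swap n" UNIV] prob(1) inj_block_swap[of n]
      by (simp add: g_def restrict_UNIV)
    define A' where "A' = g -` A"
    have A': "A' \<in> sets ?S" using measurable_sets[OF g_meas A(1)] by (simp add: A'_def space_S)
    have "S.prob ((T - A) \<union> (A - T)) = measure (distr ?S ?S g) ((T - A) \<union> (A - T))" by (simp add: g_distr)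
    also have "\<dots> = S.prob (g -` ((T - A) \<union> (A - T)))"
      using A T by (subst measure_distr) (auto simp: space_S)
    also have "g -` ((T - A) \<union> (A - T)) = (T - A') \<union> (A' - T)"
      using sym by (auto simp: A'_def g_def)
    finally have err': "S.prob ((T - A') \<union> (A' - T)) < \<epsilon>" using err by simp
    \<comment> \<open>\<open>comb_seq n x y\<close> takes its first \<open>n\<close> entries from
      \<open>x\<close> and continues with \<open>y\<close>, and it has the product law:
      \<open>A\<close> sees only \<open>x\<close>, and \<open>A'\<close> only
      \<open>y\<close>.\<close>
    have "emeasure ?S (A \<inter> A') = emeasure (distr (?S \<Otimes>\<^sub>M ?S) ?S (\<lambda>(x, y). comb_seq n x y)) (A \<inter> A')"
      by (simp add: seq.PiM_comb_seq)
    also have "\<dots> = emeasure (?S \<Otimes>\<^sub>M ?S) ((\<lambda>(x, y). comb_seq n x y) -` (A \<inter> A') \<inter> space (?S \<Otimes>\<^sub>M ?S))"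
      using A A' by (intro emeasure_distr measurable_comb_seq) auto
    also have "(\<lambda>(x, y). comb_seq n x y) -` (A \<inter> A') \<inter> space (?S \<Otimes>\<^sub>M ?S) = A \<times> A"
    proof -
      have "comb_seq n x y \<in> A \<longleftrightarrow> x \<in> A" for x y
        by (rule cylinderD[OF A(2)]) (simp add: comb_seq_less)
      moreover have "g (comb_seq n x y) \<in> A \<longleftrightarrow> y \<in> A" for x y
        by (rule cylinderD[OF A(2)]) (simp add: g_def block_swap_def comb_seq_add)
      ultimately show ?thesis by (auto simp: A'_def space_pair_measure space_S)
    qed
    also have "emeasure (?S \<Otimes>\<^sub>M ?S) (A \<times> A) = emeasure ?S A * emeasure ?S A"
      by (rule S.emeasure_pair_measure_Times[OF A(1) A(1)])
    finally have sq: "S.prob (A \<inter> A') = (S.prob A)\<^sup>2"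
      by (simp add: S.emeasure_eq_measure power2_eq_square flip: ennreal_mult)
    have diff: "\<bar>S.prob T - S.prob B\<bar> \<le> S.prob ((T - B) \<union> (B - T))" if B: "B \<in> sets ?S" for B
    proof -
      have "S.prob T \<le> S.prob (B \<union> ((T - B) \<union> (B - T)))" "S.prob B \<le> S.prob (T \<union> ((T - B) \<union> (B - T)))"
        using B T by (auto intro!: S.finite_measure_mono)
      moreover have "S.prob (B \<union> ((T - B) \<union> (B - T))) \<le> S.prob B + S.prob ((T - B) \<union> (B - T))"
        "S.prob (T \<union> ((T - B) \<union> (B - T))) \<le> S.prob T + S.prob ((T - B) \<union> (B - T))"
        using B T by (auto intro!: measure_Un_le)
      ultimately show ?thesis by linarith
    qed
    have "\<bar>S.prob T - S.prob (A \<inter> A')\<bar> \<le> S.prob ((T - (A \<inter> A')) \<union> ((A \<inter> A') - T))"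
      using A A' by (intro diff) auto
    also have "\<dots> \<le> S.prob (((T - A) \<union> (A - T)) \<union> ((T - A') \<union> (A' - T)))"
      using A A' T by (intro S.finite_measure_mono) auto
    also have "\<dots> \<le> S.prob ((T - A) \<union> (A - T)) + S.prob ((T - A') \<union> (A' - T))"
      using A A' T by (intro measure_Un_le) auto
    finally have 1: "\<bar>S.prob T - (S.prob A)\<^sup>2\<bar> \<le> 2 * \<epsilon>" using err err' sq by simp
    have "\<bar>S.prob A - S.prob T\<bar> \<le> \<epsilon>" using diff[OF A(1)] err by simp
    then have "\<bar>S.prob A - S.prob T\<bar> * \<bar>S.prob A + S.prob T\<bar> \<le> \<epsilon> * 2"
    proof (rule mult_mono)
      show "\<bar>S.prob A + S.prob T\<bar> \<le> 2"
        using S.prob_le_1[of A] S.prob_le_1[of T] measure_nonneg[of ?S A] measure_nonneg[of ?S T] by linarith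
    qed (use \<epsilon> in auto)
    then have 2: "\<bar>(S.prob A)\<^sup>2 - (S.prob T)\<^sup>2\<bar> \<le> 2 * \<epsilon>"
      unfolding abs_mult[symmetric] by (simp add: power2_eq_square algebra_simps)
    show ?thesis using 1 2 by linarith
  qed
  then have "\<bar>S.prob T - (S.prob T)\<^sup>2\<bar> \<le> 0 + \<epsilon>" if "0 < \<epsilon>" for \<epsilon>
    using that[THEN half_gt_zero, THEN half_gt_zero] by fastforce
  then have "\<bar>S.prob T - (S.prob T)\<^sup>2\<bar> \<le> 0" by (rule field_le_epsilon)
  then have "S.prob T * (1 - S.prob T) = 0" by (simp add: power2_eq_square algebra_simps)
  then show ?thesis by simp
qed

section \<open>Empirical trimmed distortion\<close>

text \<open>The sample is the sequence \<open>x\<close> itself, so statements about it live on one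
  sequence space, whatever probability space carries the variables.\<close>

abbreviation emp :: "nat \<Rightarrow> (nat \<Rightarrow> 'a::euclidean_space) \<Rightarrow> 'a measure" where
  "emp n x \<equiv> empirical_measure (\<lambda>i x. x i) n x"

lemma empirical_measure_eq_emp: "empirical_measure X n \<omega> = emp n (\<lambda>i. X i \<omega>)"
  by (simp add: empirical_measure_def)

lemma sets_emp [simp, measurable_cong]: "sets (emp n x) = sets borel"
  by (simp add: empirical_measure_def)

lemma measurable_uniform_count_measure [measurable]: "f \<in> uniform_count_measure A \<rightarrow>\<^sub>M borel"
  by (simp add: measurable_def uniform_count_measure_def space_point_measure sets_point_measure Pi_def)

lemma prob_space_emp: "1 \<le> n \<Longrightarrow> prob_space (emp n x)"
  unfolding empirical_measure_def
  by (intro prob_space.prob_space_distr prob_space_uniform_count_measure) (auto simp: lessThan_empty_iff)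

lemma integral_emp:
  fixes f :: "'a::euclidean_space \<Rightarrow> real"
  assumes [measurable]: "f \<in> borel_measurable borel"
  shows "(LINT u|emp n x. f u) = (\<Sum>i<n. f (x i)) / real n"
  unfolding empirical_measure_def
  by (subst integral_distr) (auto simp: integral_uniform_count_measure)

lemma measure_emp:
  assumes "1 \<le> n" "A \<in> sets borel"
  shows "measure (emp n x) A = card {i. i < n \<and> x i \<in> A} / real n"
proof -
  interpret prob_space "emp n x" using assms(1) by (rule prob_space_emp)
  have sp: "space (emp n x) = UNIV" using sets_eq_imp_space_eq[OF sets_emp] by simp
  have "measure (emp n x) A = (LINT u|emp n x. indicator A u)"
    using assms by (simp add: sp)
  also have "\<dots> = (\<Sum>i<n. indicator A (x i)) / real n"
    using assms by (intro integral_emp) auto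
  also have "(\<Sum>i<n. indicator A (x i) :: real) = card {i. i < n \<and> x i \<in> A}"
    by (simp add: indicator_def sum.If_cases Int_def)
  finally show ?thesis .
qed

lemma measure_support_emp:
  assumes "1 \<le> n"
  shows "measure_support (emp n x) \<subseteq> x ` {..<n}"
proof
  fix u assume u: "u \<in> measure_support (emp n x)"
  show "u \<in> x ` {..<n}"
  proof (rule ccontr)
    assume "u \<notin> x ` {..<n}"
    moreover have "open (- x ` {..<n})"
      by (simp add: finite_imp_closed open_Compl)
    ultimately have "0 < emeasure (emp n x) (- x ` {..<n})"
      using u by (auto simp: measure_support_def)
    moreover interpret prob_space "emp n x" using assms by (rule prob_space_emp)
    have "measure (emp n x) (- x ` {..<n}) = 0"
      using \<open>open (- x ` {..<n})\<close> assms by (subst measure_emp) (auto intro!: card_eq_0_iff[THEN iffD2])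
    ultimately show False by (simp add: emeasure_eq_measure)
  qed
qed

context trimming
begin

lemma concentrated_emp:
  assumes "1 \<le> n" "\<forall>i<n. x i \<in> interior \<Omega>"
  shows "concentrated (emp n x)"
  using measure_support_emp[OF assms(1), of x] assms by (force simp: concentrated_def prob_space_emp)

lemma dual_value_emp:
  assumes "1 \<le> n" "\<forall>i<n. x i \<in> interior \<Omega>"
  shows "real n * dual_value (emp n x) c s = (\<Sum>i<n. min (cbreg (x i) c) s) - s * (real n - real n * h)"
proof -
  have "(LINT u|emp n x. min (cdist c u) s) = (\<Sum>i<n. min (cdist c (x i)) s) / real n"
    by (rule integral_emp) measurable
  also have "(\<Sum>i<n. min (cdist c (x i)) s) = (\<Sum>i<n. min (cbreg (x i) c) s)"
    using assms by (intro sum.cong) (auto simp: cdist_def)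
  finally show ?thesis using assms by (simp add: dual_value_def field_simps)
qed

text \<open>Weights are attached to indices rather than to points, so coinciding sample points may
  be weighted differently.\<close>

lemma emp_distortion_le_weighted:
  assumes n: "1 \<le> n" and x: "\<forall>i<n. x i \<in> interior \<Omega>" and c: "c \<in> codebooks \<Omega> k"
    and w: "\<forall>i<n. 0 \<le> w i \<and> w i \<le> 1" and W: "(\<Sum>i<n. w i) = real n * h"
  shows "real n * distortion (emp n x) c \<le> (\<Sum>i<n. w i * cbreg (x i) c)"
proof -
  note P = concentrated_emp[OF n x]
  define s where "s = (trim_radius \<Omega> \<phi> k (emp n x) h c)\<^sup>2"
  have "real n * distortion (emp n x) c = (\<Sum>i<n. min (cbreg (x i) c) s) - s * (real n - real n * h)"
    using dual_value_emp[OF n x] distortion_eq_dual[OF P c] by (simp add: s_def)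
  also have "\<dots> = (\<Sum>i<n. min (cbreg (x i) c) s - s * (1 - w i))"
    using W by (simp add: sum_subtractf right_diff_distrib sum_distrib_left[symmetric])
  also have "\<dots> \<le> (\<Sum>i<n. w i * cbreg (x i) c)"
  proof (rule sum_mono)
    fix i assume i: "i \<in> {..<n}"
    have "min (cbreg (x i) c) s * (1 - w i) \<le> s * (1 - w i)" using w i by (intro mult_right_mono) auto
    moreover have "w i * min (cbreg (x i) c) s \<le> w i * cbreg (x i) c" using w i by (intro mult_left_mono) auto
    ultimately show "min (cbreg (x i) c) s - s * (1 - w i) \<le> w i * cbreg (x i) c" by (simp add: algebra_simps)
  qed
  finally show ?thesis .
qed

text \<open>A configuration consists of trimming weights and an assignment of sample points to cells. It
  suffices to consider weights at the vertices of the polytope of admissible ones, so there are finitely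
  many configurations for each \<open>n\<close>.\<close>

definition confs :: "nat \<Rightarrow> ((nat \<Rightarrow> real) \<times> (nat \<Rightarrow> nat)) set" where
  "confs n = {(w, a). w \<in> {..<n} \<rightarrow>\<^sub>E {0, frac (real n * h), 1} \<and> a \<in> {..<n} \<rightarrow>\<^sub>E {..<k} \<and>
     (\<Sum>i<n. w i) = real n * h \<and> (\<exists>i0. \<forall>i<n. i \<noteq> i0 \<longrightarrow> w i = 0 \<or> w i = 1)}"

lemma finite_confs: "finite (confs n)"
proof (rule finite_subset)
  show "confs n \<subseteq> ({..<n} \<rightarrow>\<^sub>E {0, frac (real n * h), 1}) \<times> ({..<n} \<rightarrow>\<^sub>E {..<k})"
    by (auto simp: confs_def)
qed (intro finite_cartesian_product finite_PiE; simp)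

lemma confsD:
  assumes "(w, a) \<in> confs n"
  shows "\<forall>i<n. 0 \<le> w i \<and> w i \<le> 1" "\<forall>i<n. a i < k" "(\<Sum>i<n. w i) = real n * h"
    "\<exists>i0. \<forall>i<n. i \<noteq> i0 \<longrightarrow> w i = 0 \<or> w i = 1"
proof -
  have "w i \<in> {0, frac (real n * h), 1}" if "i < n" for i
    using assms that by (auto simp: confs_def PiE_iff)
  moreover have "0 \<le> frac (real n * h)" "frac (real n * h) \<le> 1"
    using frac_lt_1[of "real n * h"] by auto
  ultimately show "\<forall>i<n. 0 \<le> w i \<and> w i \<le> 1" by fastforce
qed (use assms in \<open>auto simp: confs_def\<close>)

text \<open>Points below the trimming level get full weight; on the level set, \<open>m\<close>
  further full weights and one fractional weight make up the mass exactly. The value is that of the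
  dual form because all divergences on the level set equal \<open>s\<close>.\<close>

lemma confs_exist:
  assumes n: "1 \<le> n" and x: "\<forall>i<n. x i \<in> interior \<Omega>" and c: "c \<in> codebooks \<Omega> k"
  obtains w a where "(w, a) \<in> confs n"
    "(\<Sum>i<n. w i * breg (x i) (c (a i))) = real n * distortion (emp n x) c"
proof -
  note P = concentrated_emp[OF n x]
  define s where "s = (trim_radius \<Omega> \<phi> k (emp n x) h c)\<^sup>2"
  define \<theta> where "\<theta> = frac (real n * h)"
  have \<theta>: "0 \<le> \<theta>" "\<theta> < 1" by (simp_all add: \<theta>_def frac_lt_1)
  define A where "A = {i. i < n \<and> cbreg (x i) c < s}"
  define B where "B = {i. i < n \<and> cbreg (x i) c = s}"
  have fin: "finite A" "finite B" by (simp_all add: A_def B_def)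
  have AB: "A \<inter> B = {}" "A \<union> B = {i. i < n \<and> cbreg (x i) c \<le> s}" by (auto simp: A_def B_def)
  have "measure (emp n x) {u. cdist c u < s} = card A / real n"
  proof -
    have "{i. i < n \<and> x i \<in> {u. cdist c u < s}} = A" using x by (auto simp: A_def cdist_def)
    then show ?thesis using n by (subst measure_emp) auto
  qed
  then have cA: "real (card A) \<le> real n * h"
    using mult_left_mono[OF trim_radius_quantile(2)[OF P c], of "real n"] n by (simp add: s_def)
  have "measure (emp n x) {u. cdist c u \<le> s} = card (A \<union> B) / real n"
  proof -
    have "{i. i < n \<and> x i \<in> {u. cdist c u \<le> s}} = A \<union> B" using x by (auto simp: AB cdist_def)
    then show ?thesis using n by (subst measure_emp) auto
  qed
  then have "real n * h \<le> real (card (A \<union> B))"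
    using mult_left_mono[OF trim_radius_quantile(3)[OF P c], of "real n"] n by (simp add: s_def)
  then have cAB: "real n * h \<le> real (card A) + real (card B)"
    using card_Un_disjoint[OF fin AB(1)] by simp
  \<comment> \<open>Truncated subtraction is exact here, by \<open>le_fl\<close>.\<close>
  define m where "m = nat \<lfloor>real n * h\<rfloor> - card A"
  have fl: "real (nat \<lfloor>real n * h\<rfloor>) = real n * h - \<theta>"
    using h by (simp add: \<theta>_def frac_def)
  have le_fl: "card A \<le> nat \<lfloor>real n * h\<rfloor>" using cA by linarith
  then have m: "real (card A) + real m + \<theta> = real n * h" using fl by (simp add: m_def)
  then have "m \<le> card B" using cAB \<theta> by linarith
  then obtain C where C: "C \<subseteq> B" "card C = m" "finite C"
    using obtain_subset_with_card_n fin by (metis finite_subset)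
  \<comment> \<open>An index for the fractional weight has to exist only if the fractional part is
    nonzero; otherwise \<open>b\<close> is arbitrary.\<close>
  have "\<exists>b. \<theta> \<noteq> 0 \<longrightarrow> b \<in> B - C"
  proof (cases "\<theta> = 0")
    case False
    then have "m < card B" using m cAB \<theta> by linarith
    then have "C \<noteq> B" using C by auto
    then show ?thesis using C by auto
  qed auto
  then obtain b where b: "\<theta> \<noteq> 0 \<Longrightarrow> b \<in> B - C" by blast
  define w where "w = restrict (\<lambda>i. (if i \<in> A \<union> C then 1 else 0) + (if i = b then \<theta> else 0)) {..<n}"
  define a where "a = restrict (\<lambda>i. SOME j. j < k \<and> cbreg (x i) c = breg (x i) (c j)) {..<n}"
  have a: "a i < k" "cbreg (x i) c = breg (x i) (c (a i))" if "i < n" for i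
  proof -
    have "\<exists>j. j < k \<and> cbreg (x i) c = breg (x i) (c j)" by (metis cbreg_attained)
    from someI_ex[OF this] that show "a i < k" "cbreg (x i) c = breg (x i) (c (a i))" by (auto simp: a_def)
  qed
  have subs: "A \<subseteq> {..<n}" "C \<subseteq> {..<n}" using C by (auto simp: A_def B_def)
  have bA: "\<theta> \<noteq> 0 \<Longrightarrow> b \<notin> A \<union> C" "\<theta> \<noteq> 0 \<Longrightarrow> b < n" "\<theta> \<noteq> 0 \<Longrightarrow> cbreg (x b) c = s"
    using b by (auto simp: A_def B_def)
  have W: "(\<Sum>i<n. w i) = real n * h"
  proof -
    have "(\<Sum>i<n. w i) = (\<Sum>i<n. (if i \<in> A \<union> C then 1 else 0)) + (\<Sum>i<n. (if i = b then \<theta> else 0))"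
      by (simp add: w_def sum.distrib)
    also have "(\<Sum>i<n. (if i = b then \<theta> else 0)) = \<theta>" using bA by (cases "\<theta> = 0") auto
    also have "(\<Sum>i<n. (if i \<in> A \<union> C then 1 else 0 :: real)) = card (A \<union> C)"
      using subs by (simp add: sum.If_cases) (intro arg_cong[where f=card]; auto)
    also have "card (A \<union> C) = card A + m" using C fin AB by (subst card_Un_disjoint) auto
    finally show ?thesis using m by simp
  qed
  have w_conf: "(w, a) \<in> confs n"
    unfolding confs_def
  proof (simp add: W, intro conjI exI[of _ b])
    show "w \<in> {..<n} \<rightarrow>\<^sub>E {0, frac (real n * h), 1}"
      using bA by (cases "\<theta> = 0") (auto simp: w_def \<theta>_def)
    show "a \<in> {..<n} \<rightarrow>\<^sub>E {..<k}" 
    proof -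
      have "a \<in> extensional {..<n}" by (simp add: a_def)
      then show ?thesis using a(1) by (simp add: PiE_iff)
    qed
    show "\<forall>i<n. i \<noteq> b \<longrightarrow> w i = 0 \<or> w i = 1" by (auto simp: w_def)
  qed
  have "(\<Sum>i<n. w i * breg (x i) (c (a i))) = (\<Sum>i<n. min (cbreg (x i) c) s - s * (1 - w i))"
  proof (intro sum.cong refl)
    fix i assume i: "i \<in> {..<n}"
    consider "i \<in> A" | "i \<in> B" | "s < cbreg (x i) c" using i by (fastforce simp: A_def B_def)
    then show "w i * breg (x i) (c (a i)) = min (cbreg (x i) c) s - s * (1 - w i)"
    proof cases
      case 1
      then have "w i = 1" using bA subs by (cases "\<theta> = 0") (auto simp: w_def)
      then show ?thesis using 1 i by (simp add: A_def a(2)[symmetric])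
    next
      case 2
      then show ?thesis using i by (simp add: B_def a(2)[symmetric] algebra_simps)
    next
      case 3
      then have "i \<notin> A \<union> C" "\<theta> \<noteq> 0 \<Longrightarrow> i \<noteq> b" using C bA by (auto simp: A_def B_def)
      then have "w i = 0" using i by (cases "\<theta> = 0") (auto simp: w_def)
      then show ?thesis using 3 by simp
    qed
  qed
  also have "\<dots> = (\<Sum>i<n. min (cbreg (x i) c) s) - s * (real n - real n * h)"
    using W by (simp add: sum_subtractf right_diff_distrib sum_distrib_left[symmetric])
  also have "\<dots> = real n * distortion (emp n x) c"
    using dual_value_emp[OF n x] distortion_eq_dual[OF P c] by (simp add: s_def)
  finally show ?thesis using that w_conf by blast
qed

section \<open>Masses and centroids of cells, and the cost of a configuration\<close>

definition mass :: "nat \<Rightarrow> (nat \<Rightarrow> real) \<Rightarrow> (nat \<Rightarrow> nat) \<Rightarrow> nat \<Rightarrow> real" where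
  "mass n w a j = (\<Sum>i\<in>{i\<in>{..<n}. a i = j}. w i)"

text \<open>For a cell of mass 0 this is 0, by division by 0; in \<open>cost\<close> it is
  multiplied by that mass.\<close>

definition cent :: "nat \<Rightarrow> (nat \<Rightarrow> 'a) \<Rightarrow> (nat \<Rightarrow> real) \<Rightarrow> (nat \<Rightarrow> nat) \<Rightarrow> nat \<Rightarrow> 'a" where
  "cent n x w a j = (1 / mass n w a j) *\<^sub>R (\<Sum>i\<in>{i\<in>{..<n}. a i = j}. w i *\<^sub>R x i)"

definition phiI :: "'a \<Rightarrow> real" where "phiI u = (if u \<in> interior \<Omega> then \<phi> u else 0)"

text \<open>For sample points in the interior, the least weighted sum of divergences over all
  codebooks when weights and cells are fixed, attained at the centroids. No codebook occurs, so it
  is a measurable function of the sample, differentiable in each sample point.\<close>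

definition cost :: "nat \<Rightarrow> (nat \<Rightarrow> 'a) \<Rightarrow> (nat \<Rightarrow> real) \<Rightarrow> (nat \<Rightarrow> nat) \<Rightarrow> real" where
  "cost n x w a = (\<Sum>i<n. w i * phiI (x i)) - (\<Sum>j<k. mass n w a j * phiI (cent n x w a j))"

text \<open>Cells of mass 0 keep the codepoint of \<open>c\<close>, because their
  \<open>cent\<close> need not lie in \<open>\<Omega>\<close>.\<close>

definition recenter :: "nat \<Rightarrow> (nat \<Rightarrow> 'a) \<Rightarrow> (nat \<Rightarrow> real) \<Rightarrow> (nat \<Rightarrow> nat) \<Rightarrow> (nat \<Rightarrow> 'a) \<Rightarrow> nat \<Rightarrow> 'a" where
  "recenter n x w a c = restrict (\<lambda>j. if 0 < mass n w a j then cent n x w a j else c j) {..<k}"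

lemma mass_nonneg: "\<forall>i<n. 0 \<le> w i \<Longrightarrow> 0 \<le> mass n w a j"
  unfolding mass_def by (intro sum_nonneg) auto

lemma sum_mass: "\<forall>i<n. a i < k \<Longrightarrow> (\<Sum>j<k. mass n w a j) = (\<Sum>i<n. w i)"
  unfolding mass_def by (intro sum.group) auto

lemma cent_in:
  assumes "convex C" "\<forall>i<n. x i \<in> C" "\<forall>i<n. 0 \<le> w i" "0 < mass n w a j"
  shows "cent n x w a j \<in> C"
proof -
  have "cent n x w a j = (\<Sum>i\<in>{i\<in>{..<n}. a i = j}. (w i / mass n w a j) *\<^sub>R x i)"
    by (simp add: cent_def scaleR_sum_right)
  also have "\<dots> \<in> C"
    using assms by (intro convex_sum) (auto simp: mass_def simp flip: sum_divide_distrib)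
  finally show ?thesis .
qed

lemma recenter_codebook:
  assumes "\<forall>i<n. x i \<in> interior \<Omega>" "\<forall>i<n. 0 \<le> w i" "c \<in> codebooks \<Omega> k"
  shows "recenter n x w a c \<in> codebooks \<Omega> k"
  using cent_in[OF convex_interior_domain assms(1,2)] interior_subset assms(3)
  by (fastforce simp: recenter_def codebooks_def PiE_iff)

text \<open>The bias-variance identity in each cell; the second claim is the first one at the
  centroids, where the excess over \<open>cost\<close> vanishes.\<close>

lemma cost_decomposition:
  assumes x: "\<forall>i<n. x i \<in> interior \<Omega>" and w: "\<forall>i<n. 0 \<le> w i" and a: "\<forall>i<n. a i < k"
  shows "(\<Sum>i<n. w i * breg (x i) (c (a i))) =
      cost n x w a + (\<Sum>j<k. mass n w a j * breg (recenter n x w a c j) (c j))"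
    and "(\<Sum>i<n. w i * breg (x i) (recenter n x w a c (a i))) = cost n x w a"
proof -
  let ?cell = "\<lambda>j. {i\<in>{..<n}. a i = j}"
  let ?m = "recenter n x w a c"
  have group: "(\<Sum>i<n. f i) = (\<Sum>j<k. \<Sum>i\<in>?cell j. f i)" for f :: "nat \<Rightarrow> real"
    using a by (intro sum.group[symmetric]) auto
  have cell: "(\<Sum>i\<in>?cell j. w i *\<^sub>R x i) = mass n w a j *\<^sub>R ?m j" if "j < k" for j
  proof (cases "0 < mass n w a j")
    case True then show ?thesis using that by (simp add: recenter_def cent_def)
  next
    case False
    then have "mass n w a j = 0" using mass_nonneg[of n w a j] w by fastforce
    \<comment> \<open>In a cell of mass 0 all weights vanish, so any point can serve as its
      mean.\<close>
    then have "\<forall>i\<in>?cell j. w i = 0"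
      unfolding mass_def using w by (subst (asm) sum_nonneg_eq_0_iff) auto
    then show ?thesis using \<open>mass n w a j = 0\<close> by simp
  qed
  have phi: "mass n w a j * \<phi> (?m j) = mass n w a j * phiI (cent n x w a j)" if "j < k" for j
  proof (cases "0 < mass n w a j")
    case True
    then show ?thesis
      using that cent_in[OF convex_interior_domain x w True] by (simp add: recenter_def phiI_def)
  next
    case False
    then have "mass n w a j = 0" using mass_nonneg[of n w a j] w by fastforce
    then show ?thesis by simp
  qed
  have dec: "(\<Sum>i\<in>?cell j. w i * breg (x i) y) =
      (\<Sum>i\<in>?cell j. w i * phiI (x i)) - mass n w a j * phiI (cent n x w a j) + mass n w a j * breg (?m j) y"
    if "j < k" for j y
  proof -
    have "(\<Sum>i\<in>?cell j. w i * \<phi> (x i)) = (\<Sum>i\<in>?cell j. w i * phiI (x i))"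
      using x by (intro sum.cong) (auto simp: phiI_def)
    then show ?thesis
      using bregman_mean_decomposition(1)[of "?cell j" "mass n w a j" w x "?m j" y]
        bregman_mean_decomposition(2)[of "?cell j" "mass n w a j" w x "?m j"] cell[OF that] phi[OF that]
      by (simp add: mass_def)
  qed
  have main: "(\<Sum>i<n. w i * breg (x i) (c' (a i))) = cost n x w a + (\<Sum>j<k. mass n w a j * breg (?m j) (c' j))"
    for c'
  proof -
    have "(\<Sum>i<n. w i * breg (x i) (c' (a i))) = (\<Sum>j<k. \<Sum>i\<in>?cell j. w i * breg (x i) (c' j))"
      unfolding group by (intro sum.cong) auto
    also have "\<dots> = (\<Sum>j<k. (\<Sum>i\<in>?cell j. w i * phiI (x i)) - mass n w a j * phiI (cent n x w a j) + mass n w a j * breg (?m j) (c' j))"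
      by (intro sum.cong refl dec) auto
    also have "\<dots> = cost n x w a + (\<Sum>j<k. mass n w a j * breg (?m j) (c' j))"
      unfolding cost_def group by (simp add: sum.distrib sum_subtractf)
    finally show ?thesis .
  qed
  show "(\<Sum>i<n. w i * breg (x i) (c (a i))) = cost n x w a + (\<Sum>j<k. mass n w a j * breg (?m j) (c j))"
    by (rule main)
  show "(\<Sum>i<n. w i * breg (x i) (?m (a i))) = cost n x w a"
    using main[of ?m] by simp
qed

text \<open>Expresses both that \<open>c\<close> is an empirical optimum and that \<open>w\<close>
  and \<open>a\<close> realise its value: the weighted sum is also an upper bound for
  \<open>n\<close> times the distortion of \<open>c\<close>, so minimality forces equality.\<close>

definition opt_triple :: "nat \<Rightarrow> (nat \<Rightarrow> 'a) \<Rightarrow> (nat \<Rightarrow> 'a) \<Rightarrow> (nat \<Rightarrow> real) \<Rightarrow> (nat \<Rightarrow> nat) \<Rightarrow> bool" where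
  "opt_triple n x c w a \<longleftrightarrow> c \<in> codebooks \<Omega> k \<and> (\<forall>i<n. 0 \<le> w i \<and> w i \<le> 1 \<and> a i < k) \<and>
     (\<Sum>i<n. w i) = real n * h \<and>
     (\<forall>c'\<in>codebooks \<Omega> k. (\<Sum>i<n. w i * breg (x i) (c (a i))) \<le> real n * distortion (emp n x) c')"

lemma emp_distortion_le_assignment:
  assumes n: "1 \<le> n" and x: "\<forall>i<n. x i \<in> interior \<Omega>" and c: "c \<in> codebooks \<Omega> k"
    and w: "\<forall>i<n. 0 \<le> w i \<and> w i \<le> 1" and W: "(\<Sum>i<n. w i) = real n * h" and a: "\<forall>i<n. a i < k"
  shows "real n * distortion (emp n x) c \<le> (\<Sum>i<n. w i * breg (x i) (c (a i)))"
proof -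
  have "(\<Sum>i<n. w i * cbreg (x i) c) \<le> (\<Sum>i<n. w i * breg (x i) (c (a i)))"
    using w a by (intro sum_mono mult_left_mono cbreg_le) auto
  then show ?thesis using emp_distortion_le_weighted[OF n x c w W] by simp
qed

lemma opt_triple_value:
  assumes n: "1 \<le> n" and x: "\<forall>i<n. x i \<in> interior \<Omega>" and opt: "opt_triple n x c w a"
  shows "(\<Sum>i<n. w i * breg (x i) (c (a i))) = real n * distortion (emp n x) c"
  using emp_distortion_le_assignment[OF n x, of c w a] opt unfolding opt_triple_def
  by (intro antisym) auto

text \<open>Moving every codepoint to its centroid would lower the value by a weighted sum of
  divergences. Optimality makes this sum vanish, and positive mass then forces equality.\<close>

lemma opt_triple_mean:
  assumes n: "1 \<le> n" and x: "\<forall>i<n. x i \<in> interior \<Omega>" and opt: "opt_triple n x c w a"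
  shows "\<And>j. j < k \<Longrightarrow> 0 < mass n w a j \<Longrightarrow> c j = cent n x w a j"
    and "(\<Sum>i<n. w i * breg (x i) (c (a i))) = cost n x w a"
proof -
  have c: "c \<in> codebooks \<Omega> k" and w: "\<forall>i<n. 0 \<le> w i \<and> w i \<le> 1" and a: "\<forall>i<n. a i < k"
    and W: "(\<Sum>i<n. w i) = real n * h"
    and le: "\<And>c'. c' \<in> codebooks \<Omega> k \<Longrightarrow> (\<Sum>i<n. w i * breg (x i) (c (a i))) \<le> real n * distortion (emp n x) c'"
    using opt by (auto simp: opt_triple_def)
  define m where "m = recenter n x w a c"
  have w0: "\<forall>i<n. 0 \<le> w i" using w by blast
  have m: "m \<in> codebooks \<Omega> k" unfolding m_def by (rule recenter_codebook[OF x w0 c])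
  have nonneg: "0 \<le> mass n w a j * breg (m j) (c j)" if "j < k" for j
    using that m c mass_nonneg[of n w a j] w by (intro mult_nonneg_nonneg bregman_nonneg) (auto simp: codebooks_def)
  note dec = cost_decomposition[OF x w0 a, of c, folded m_def]
  have "(\<Sum>i<n. w i * breg (x i) (c (a i))) \<le> cost n x w a"
    using le[OF m] emp_distortion_le_assignment[OF n x m w W a] dec(2) by simp
  then have "(\<Sum>j<k. mass n w a j * breg (m j) (c j)) \<le> 0" using dec(1) by simp
  then have sum0: "(\<Sum>j<k. mass n w a j * breg (m j) (c j)) = 0"
    using nonneg by (intro antisym sum_nonneg) auto
  then show "(\<Sum>i<n. w i * breg (x i) (c (a i))) = cost n x w a" using dec(1) by simp
  fix j assume j: "j < k" "0 < mass n w a j"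
  have "\<forall>j\<in>{..<k}. mass n w a j * breg (m j) (c j) = 0"
    using sum0 by (subst (asm) sum_nonneg_eq_0_iff) (use nonneg in auto)
  then have "mass n w a j * breg (m j) (c j) = 0" using j by blast
  then have "m j = c j"
    using j m c bregman_eq_0_iff[of "m j" "c j"] by (auto simp: codebooks_def)
  then show "c j = cent n x w a j" using j by (simp add: m_def recenter_def)
qed

text \<open>Optimality expressed by the sample alone, as a minimum over finitely many explicit
  functions; in this form it is measurable and compatible with permutations.\<close>

definition min_conf :: "nat \<Rightarrow> (nat \<Rightarrow> 'a) \<Rightarrow> (nat \<Rightarrow> real) \<Rightarrow> (nat \<Rightarrow> nat) \<Rightarrow> bool" where
  "min_conf n x w a \<longleftrightarrow> (w, a) \<in> confs n \<and> (\<forall>(w', a')\<in>confs n. cost n x w a \<le> cost n x w' a')"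

text \<open>Each codebook induces a configuration whose cost is at most \<open>n\<close> times its
  distortion, so the best configuration beats every codebook. The codebook \<open>c\<close> only
  fills cells without mass.\<close>

lemma min_conf_opt_triple:
  assumes n: "1 \<le> n" and x: "\<forall>i<n. x i \<in> interior \<Omega>" and min: "min_conf n x w a"
    and c: "c \<in> codebooks \<Omega> k"
  shows "opt_triple n x (recenter n x w a c) w a"
  unfolding opt_triple_def
proof (intro conjI ballI)
  have conf: "(w, a) \<in> confs n" using min by (simp add: min_conf_def)
  note wa = confsD[OF conf]
  show "recenter n x w a c \<in> codebooks \<Omega> k" using wa(1) by (intro recenter_codebook x c) auto
  show "\<forall>i<n. 0 \<le> w i \<and> w i \<le> 1 \<and> a i < k" using wa by auto
  show "(\<Sum>i<n. w i) = real n * h" by (rule wa(3))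
  fix c' assume c': "c' \<in> codebooks \<Omega> k"
  obtain w' a' where wa': "(w', a') \<in> confs n"
    "(\<Sum>i<n. w' i * breg (x i) (c' (a' i))) = real n * distortion (emp n x) c'"
    using confs_exist[OF n x c'] by blast
  have w': "\<forall>i<n. 0 \<le> w' i" and a': "\<forall>i<n. a' i < k" using confsD[OF wa'(1)] by auto
  have "0 \<le> (\<Sum>j<k. mass n w' a' j * breg (recenter n x w' a' c' j) (c' j))"
    using recenter_codebook[OF x w' c', of a'] c' mass_nonneg[of n w' a'] w'
    by (intro sum_nonneg mult_nonneg_nonneg bregman_nonneg) (auto simp: codebooks_def)
  then have "cost n x w' a' \<le> real n * distortion (emp n x) c'"
    using cost_decomposition(1)[OF x w' a', of c'] wa'(2) by simp
  moreover have "cost n x w a \<le> cost n x w' a'" using min wa'(1) by (auto simp: min_conf_def)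
  moreover have "(\<Sum>i<n. w i * breg (x i) (recenter n x w a c (a i))) = cost n x w a"
    using wa by (intro cost_decomposition(2) x) auto
  ultimately show "(\<Sum>i<n. w i * breg (x i) (recenter n x w a c (a i))) \<le> real n * distortion (emp n x) c'"
    by simp
qed

text \<open>Each configuration has the cost of some codebook with admissible weights, hence cannot
  beat the optimal risk.\<close>

lemma opt_triple_min_conf:
  assumes n: "1 \<le> n" and x: "\<forall>i<n. x i \<in> interior \<Omega>" and opt: "opt_triple n x c w a"
    and conf: "(w, a) \<in> confs n"
  shows "min_conf n x w a"
  unfolding min_conf_def
proof (intro conjI conf ballI, clarify)
  fix w' a' assume wa': "(w', a') \<in> confs n"
  note wa = confsD[OF wa']
  have w': "\<forall>i<n. 0 \<le> w' i" and a': "\<forall>i<n. a' i < k" using wa by auto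
  have c: "c \<in> codebooks \<Omega> k" using opt by (simp add: opt_triple_def)
  define m where "m = recenter n x w' a' c"
  have m: "m \<in> codebooks \<Omega> k" unfolding m_def by (rule recenter_codebook[OF x w' c])
  have "cost n x w a = (\<Sum>i<n. w i * breg (x i) (c (a i)))" using opt_triple_mean(2)[OF n x opt] by simp
  also have "\<dots> \<le> real n * distortion (emp n x) m" using opt m by (simp add: opt_triple_def)
  also have "\<dots> \<le> (\<Sum>i<n. w' i * breg (x i) (m (a' i)))"
    by (rule emp_distortion_le_assignment[OF n x m wa(1) wa(3) wa(2)])
  also have "\<dots> = cost n x w' a'" unfolding m_def by (rule cost_decomposition(2)[OF x w' a'])
  finally show "cost n x w a \<le> cost n x w' a'" .
qed

lemma optimal_opt_triple:
  assumes n: "1 \<le> n" and x: "\<forall>i<n. x i \<in> interior \<Omega>" and opt: "optimal_codebook \<Omega> \<phi> k (emp n x) h c"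
  obtains w a where "(w, a) \<in> confs n" "opt_triple n x c w a"
proof -
  have c: "c \<in> codebooks \<Omega> k" and le: "\<And>c'. c' \<in> codebooks \<Omega> k \<Longrightarrow> distortion (emp n x) c \<le> distortion (emp n x) c'"
    using opt by (auto simp: optimal_codebook_def is_arg_min_linorder)
  obtain w a where wa: "(w, a) \<in> confs n"
      "(\<Sum>i<n. w i * breg (x i) (c (a i))) = real n * distortion (emp n x) c"
    using confs_exist[OF n x c] by blast
  have "opt_triple n x c w a"
    unfolding opt_triple_def using confsD[OF wa(1)] wa(2) c le by (auto intro!: mult_left_mono)
  then show ?thesis using that wa by blast
qed

end

section \<open>Compactness of empirical optima\<close>

lemma bounded_family_convergent_subsequence:
  fixes f :: "nat \<Rightarrow> nat \<Rightarrow> 'b::heine_borel"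
  assumes "\<And>j. j < k \<Longrightarrow> bounded (range (\<lambda>m. f m j))"
  obtains \<rho> L where "strict_mono (\<rho> :: nat \<Rightarrow> nat)" "\<And>j. j < k \<Longrightarrow> (\<lambda>m. f (\<rho> m) j) \<longlonglongrightarrow> L j"
proof -
  have "\<exists>\<rho> L. strict_mono (\<rho> :: nat \<Rightarrow> nat) \<and> (\<forall>j<k. (\<lambda>m. f (\<rho> m) j) \<longlonglongrightarrow> L j)"
    using assms
  proof (induction k)
    case 0
    then show ?case by (intro exI[of _ id]) (auto simp: strict_mono_id)
  next
    case (Suc k)
    then obtain \<rho> L where \<rho>: "strict_mono (\<rho> :: nat \<Rightarrow> nat)" "\<forall>j<k. (\<lambda>m. f (\<rho> m) j) \<longlonglongrightarrow> L j"
      by (metis less_Suc_eq)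
    have "bounded (range (\<lambda>m. f (\<rho> m) k))"
      using Suc.prems[of k] by (rule bounded_subset) auto
    then obtain l \<sigma> where \<sigma>: "strict_mono (\<sigma> :: nat \<Rightarrow> nat)" "((\<lambda>m. f (\<rho> m) k) \<circ> \<sigma>) \<longlonglongrightarrow> l"
      using bounded_imp_convergent_subsequence by blast
    have "(\<lambda>m. f ((\<rho> \<circ> \<sigma>) m) j) \<longlonglongrightarrow> (L(k := l)) j" if "j < Suc k" for j
    proof (cases "j = k")
      case True then show ?thesis using \<sigma>(2) by (simp add: comp_def)
    next
      case False
      then show ?thesis
        using LIMSEQ_subseq_LIMSEQ[OF _ \<sigma>(1), of "\<lambda>m. f (\<rho> m) j" "L j"] \<rho>(2) that by (simp add: comp_def)
    qed
    moreover have "strict_mono (\<rho> \<circ> \<sigma>)" using \<rho>(1) \<sigma>(1) by (rule strict_mono_o)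
    ultimately show ?case by blast
  qed
  then show ?thesis using that by blast
qed

lemma abs_min_diff_le: "\<bar>min a s - min b (t::real)\<bar> \<le> \<bar>a - b\<bar> + \<bar>s - t\<bar>"
  by (auto simp: min_def abs_if)

locale sampling = trimming +
  fixes P :: "'a measure"
  assumes prob_P: "prob_space P" and sets_P: "sets P = sets borel"
    and hull_interior: "closure (convex hull (measure_support P)) \<subseteq> interior \<Omega>"
    and ac: "absolutely_continuous lborel P"
    and int_norm2: "integrable P (\<lambda>u. (norm u)\<^sup>2)"
begin

lemma int_norm: "integrable P norm"
proof -
  interpret prob_space P by (rule prob_P)
  show ?thesis
  proof (rule square_integrable_imp_integrable)
    show "norm \<in> borel_measurable P" using sets_P by (simp cong: measurable_cong_sets)
  qed (rule int_norm2)
qed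

abbreviation "hullP \<equiv> closure (convex hull (measure_support P))"

lemma hullP: "closed hullP" "convex hullP" "measure_support P \<subseteq> hullP" "hullP \<subseteq> interior \<Omega>" "hullP \<subseteq> \<Omega>"
  using hull_interior interior_subset[of \<Omega>] hull_subset[of "measure_support P" convex]
    closure_subset[of "convex hull (measure_support P)"]
  by (auto intro: convex_closure convex_convex_hull)

lemma concP: "concentrated P"
  using hullP by (auto simp: concentrated_def prob_P sets_P)

text \<open>Countable, so that the law of large numbers holds almost surely for all codebooks over
  it simultaneously.\<close>

definition dense_points :: "'a set" where
  "dense_points = (SOME T. countable T \<and> T \<subseteq> hullP \<and> hullP \<subseteq> closure T)"

lemma dense_points: "countable dense_points" "dense_points \<subseteq> hullP" "hullP \<subseteq> closure dense_points"
proof -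
  have "\<exists>T. countable T \<and> T \<subseteq> hullP \<and> hullP \<subseteq> closure T"
    using separable[of hullP] by metis
  from someI_ex[OF this]
  show "countable dense_points" "dense_points \<subseteq> hullP" "hullP \<subseteq> closure dense_points"
    unfolding dense_points_def by blast+
qed

definition opt_value :: real where "opt_value = Inf (distortion P ` codebooks \<Omega> k)"

lemma codebooks_nonempty: "codebooks \<Omega> k \<noteq> {}"
  using interior_nonempty interior_subset unfolding codebooks_def by (auto simp: PiE_eq_empty_iff)

lemma opt_value_le: "c \<in> codebooks \<Omega> k \<Longrightarrow> opt_value \<le> distortion P c"
  unfolding opt_value_def
  by (intro cINF_lower bdd_belowI2[of _ 0]) (auto intro: distortion_nonneg[OF concP])

lemma optimal_codebook_iff:
  "optimal_codebook \<Omega> \<phi> k P h c \<longleftrightarrow> c \<in> codebooks \<Omega> k \<and> distortion P c \<le> opt_value"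
proof
  assume "optimal_codebook \<Omega> \<phi> k P h c"
  then show "c \<in> codebooks \<Omega> k \<and> distortion P c \<le> opt_value"
    unfolding optimal_codebook_def is_arg_min_linorder opt_value_def
    using codebooks_nonempty by (auto intro!: cINF_greatest)
next
  assume "c \<in> codebooks \<Omega> k \<and> distortion P c \<le> opt_value"
  then show "optimal_codebook \<Omega> \<phi> k P h c"
    unfolding optimal_codebook_def is_arg_min_linorder using opt_value_le by force
qed

lemma optimal_codebook_inj:
  assumes "optimal_codebook \<Omega> \<phi> k P h c"
  shows "inj_on c {..<k}"
proof (rule inj_onI, rule ccontr)
  fix i j assume "i \<in> {..<k}" "j \<in> {..<k}" "c i = c j" "i \<noteq> j"
  then obtain c' where "c' \<in> codebooks \<Omega> k" "distortion P c' < distortion P c"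
    using distortion_add_point[OF concP ac, of c i j] assms by (auto simp: optimal_codebook_iff)
  then show False using opt_value_le[of c'] assms by (simp add: optimal_codebook_iff)
qed

text \<open>The almost sure properties of a sample on which the deterministic compactness argument relies.\<close>

definition good :: "(nat \<Rightarrow> 'a) \<Rightarrow> bool" where
  "good x \<longleftrightarrow> (\<forall>i. x i \<in> measure_support P) \<and>
     (\<exists>B. \<forall>n. (\<Sum>i<n. norm (x i)) \<le> B * real n) \<and>
     (\<forall>c\<in>{..<k} \<rightarrow>\<^sub>E dense_points. \<forall>s\<in>\<rat>. 0 \<le> s \<longrightarrow>
        (\<lambda>n. (\<Sum>i<n. min (cdist c (x i)) s) / real n) \<longlonglongrightarrow> (LINT u|P. min (cdist c u) s)) \<and>
     (\<forall>\<epsilon>>0. \<forall>\<^sub>F n in sequentially. \<exists>c\<in>codebooks \<Omega> k. distortion (emp n x) c \<le> opt_value + \<epsilon>)"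

text \<open>Uniform continuity of the divergence on compact sets, for each codepoint separately. The
  bound \<open>K\<close> on the norm supplies compactness in \<open>u\<close>.\<close>

lemma cbreg_equicontinuous:
  assumes c: "\<forall>j<k. c j \<in> hullP" and "0 < \<eta>"
  obtains \<delta> where "0 < \<delta>"
    "\<And>c' u. \<forall>j<k. c' j \<in> hullP \<and> dist (c' j) (c j) < \<delta> \<Longrightarrow> u \<in> hullP \<Longrightarrow> norm u \<le> K \<Longrightarrow>
      \<bar>cbreg u c' - cbreg u c\<bar> \<le> \<eta>"
proof -
  have "\<exists>d>0. \<forall>u y. u \<in> hullP \<longrightarrow> norm u \<le> K \<longrightarrow> y \<in> hullP \<longrightarrow> dist y (c j) < d \<longrightarrow>
      \<bar>breg u y - breg u (c j)\<bar> < \<eta>" if j: "j < k" for j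
  proof -
    let ?S = "(hullP \<inter> cball 0 K) \<times> (hullP \<inter> cball (c j) 1)"
    have "compact ?S" using hullP(1) by (intro compact_Times closed_Int_compact) auto
    moreover have "continuous_on ?S (\<lambda>(u, y). breg u y)"
      by (rule continuous_on_subset[OF continuous_on_bregman]) (use hullP(5) in auto)
    ultimately have "uniformly_continuous_on ?S (\<lambda>(u, y). breg u y)"
      by (rule compact_uniformly_continuous[rotated])
    then obtain d where d: "0 < d" "\<And>p q. p \<in> ?S \<Longrightarrow> q \<in> ?S \<Longrightarrow> dist q p < d \<Longrightarrow>
        dist ((\<lambda>(u, y). breg u y) q) ((\<lambda>(u, y). breg u y) p) < \<eta>"
      using \<open>0 < \<eta>\<close> unfolding uniformly_continuous_on_def by blast
    have "\<bar>breg u y - breg u (c j)\<bar> < \<eta>"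
      if "u \<in> hullP" "norm u \<le> K" "y \<in> hullP" "dist y (c j) < min d 1" for u y
      using d(2)[of "(u, c j)" "(u, y)"] that c j by (auto simp: dist_Pair_Pair dist_real_def dist_commute)
    then show ?thesis using d(1) by (intro exI[of _ "min d 1"]) auto
  qed
  then obtain d where d: "\<And>j. j < k \<Longrightarrow> 0 < d j"
    "\<And>j u y. j < k \<Longrightarrow> u \<in> hullP \<Longrightarrow> norm u \<le> K \<Longrightarrow> y \<in> hullP \<Longrightarrow> dist y (c j) < d j \<Longrightarrow>
      \<bar>breg u y - breg u (c j)\<bar> < \<eta>"
    by metis
  define \<delta> where "\<delta> = Min (d ` {..<k})"
  have "0 < \<delta>" unfolding \<delta>_def using d(1) k by (subst Min_gr_iff) (auto simp: lessThan_empty_iff)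
  moreover have "\<bar>cbreg u c' - cbreg u c\<bar> \<le> \<eta>"
    if c': "\<forall>j<k. c' j \<in> hullP \<and> dist (c' j) (c j) < \<delta>" and u: "u \<in> hullP" "norm u \<le> K" for c' u
  proof -
    have close: "\<bar>breg u (c' j) - breg u (c j)\<bar> < \<eta>" if "j < k" for j
    proof -
      have "\<delta> \<le> d j" unfolding \<delta>_def using that by (intro Min_le) auto
      then show ?thesis using c' that u by (intro d(2)) auto
    qed
    obtain i where i: "i < k" "cbreg u c = breg u (c i)" by (rule cbreg_attained)
    obtain j where j: "j < k" "cbreg u c' = breg u (c' j)" by (rule cbreg_attained)
    show ?thesis
      using cbreg_le[OF i(1), of u c'] cbreg_le[OF j(1), of u c] close[OF i(1)] close[OF j(1)] i(2) j(2) by linarith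
  qed
  ultimately show ?thesis by (rule that)
qed

lemma codebook_hullP: "\<forall>j<k. c j \<in> hullP \<Longrightarrow> restrict c {..<k} \<in> codebooks \<Omega> k"
  using hullP(5) by (auto simp: codebooks_def)

lemma cbreg_nonneg_hullP: "\<forall>j<k. c j \<in> hullP \<Longrightarrow> u \<in> hullP \<Longrightarrow> 0 \<le> cbreg u c"
  by (rule cbreg_attained[of u c]) (use hullP(5) in \<open>auto intro!: bregman_nonneg\<close>)

text \<open>The empirical averages and the integral are compared with those of a codebook
  \<open>c0\<close> over \<open>dense_points\<close> and a rational level \<open>q\<close>, for
  which convergence is part of \<open>good\<close>. Outside the ball of radius \<open>K\<close> the
  truncated divergence is bounded, and a Markov bound with the first moment makes its contribution
  small.\<close>

lemma average_cdist_tendsto: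
  assumes x: "good x" and r: "filterlim r at_top (sequentially :: nat filter)"
    and c: "\<forall>j<k. c j \<in> hullP" and c': "\<forall>\<^sub>F m in sequentially. \<forall>j<k. c' m j \<in> hullP"
    and lim: "\<And>j. j < k \<Longrightarrow> (\<lambda>m. c' m j) \<longlonglongrightarrow> c j" and s: "0 \<le> s"
  shows "(\<lambda>m. (\<Sum>i<r m. min (cbreg (x i) (c' m)) s) / real (r m)) \<longlonglongrightarrow> (LINT u|P. min (cdist c u) s)"
proof (rule tendstoI)
  fix e :: real assume "0 < e"
  \<comment> \<open>\<open>4 * \<epsilon>\<close> for the empirical averages,
    \<open>4 * \<epsilon>\<close> for the integrals and \<open>\<epsilon>\<close> for the
    convergence at \<open>c0\<close>.\<close>
  define \<epsilon> where "\<epsilon> = e / 9"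
  have \<epsilon>: "0 < \<epsilon>" using \<open>0 < e\<close> by (simp add: \<epsilon>_def)
  interpret P: prob_space P by (rule prob_P)
  note [measurable_cong] = sets_P
  obtain B0 where B0: "\<And>n. (\<Sum>i<n. norm (x i)) \<le> B0 * real n" using x by (auto simp: good_def)
  define B where "B = max B0 (max 1 (LINT u|P. norm u))"
  have B: "0 < B" "(LINT u|P. norm u) \<le> B" by (auto simp: B_def)
  have Bx: "(\<Sum>i<n. norm (x i)) \<le> B * real n" for n
    using B0[of n] mult_right_mono[of B0 B "real n"] by (auto simp: B_def)
  \<comment> \<open>Chosen for \<open>s / K * B \<le> \<epsilon>\<close>; \<open>s + 1\<close> keeps
    it positive for \<open>s = 0\<close>.\<close>
  define K where "K = (s + 1) * B / \<epsilon>"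
  have K: "0 < K" using s B(1) \<epsilon> by (simp add: K_def add_nonneg_pos)
  have "s / K * B = \<epsilon> * (s / (s + 1))" using s B(1) \<epsilon> by (simp add: K_def)
  also have "\<dots> \<le> \<epsilon> * 1" using s \<epsilon> by (intro mult_left_mono) auto
  finally have K2: "s / K * B \<le> \<epsilon>" by simp
  obtain q where q: "q \<in> \<rat>" "s < q" "q < s + \<epsilon>" using Rats_dense_in_real[of s "s + \<epsilon>"] \<epsilon> by auto
  obtain \<delta> where \<delta>: "0 < \<delta>"
    "\<And>c' u. \<forall>j<k. c' j \<in> hullP \<and> dist (c' j) (c j) < \<delta> \<Longrightarrow> u \<in> hullP \<Longrightarrow> norm u \<le> K \<Longrightarrow>
      \<bar>cbreg u c' - cbreg u c\<bar> \<le> \<epsilon>"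
    using cbreg_equicontinuous[OF c \<epsilon>] by blast
  have "\<exists>y\<in>dense_points. dist y (c j) < \<delta>" if "j < k" for j
    using c that dense_points(3) \<delta>(1) closure_approachable by blast
  then obtain y where y: "\<And>j. j < k \<Longrightarrow> y j \<in> dense_points \<and> dist (y j) (c j) < \<delta>" by metis
  define c0 where "c0 = restrict y {..<k}"
  have c0: "c0 \<in> {..<k} \<rightarrow>\<^sub>E dense_points" using y by (auto simp: c0_def)
  have c0': "\<forall>j<k. c0 j \<in> hullP \<and> dist (c0 j) (c j) < \<delta>" using y dense_points(2) by (auto simp: c0_def)
  have bound: "\<bar>min (cbreg u b) s - min (cbreg u c0) q\<bar> \<le> 3 * \<epsilon> + s / K * norm u"
    if b: "\<forall>j<k. b j \<in> hullP \<and> dist (b j) (c j) < \<delta>" and u: "u \<in> hullP" for b u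
  proof (cases "norm u \<le> K")
    case True
    have "\<bar>cbreg u b - cbreg u c0\<bar> \<le> 2 * \<epsilon>"
      using \<delta>(2)[OF b u True] \<delta>(2)[OF c0' u True] by linarith
    then have "\<bar>min (cbreg u b) s - min (cbreg u c0) q\<bar> \<le> 3 * \<epsilon>"
      using abs_min_diff_le[of "cbreg u b" s "cbreg u c0" q] q by linarith
    moreover have "0 \<le> s / K * norm u" using s K by simp
    ultimately show ?thesis by linarith
  next
    case False
    have "0 \<le> cbreg u b" "0 \<le> cbreg u c0" using b c0' u by (auto intro!: cbreg_nonneg_hullP)
    then have "\<bar>min (cbreg u b) s - min (cbreg u c0) q\<bar> \<le> q" using s q by (auto simp: min_def abs_if)
    moreover have "s * 1 \<le> s * (norm u / K)" using False s K by (intro mult_left_mono) auto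
    ultimately show ?thesis using q \<epsilon> by simp
  qed
  define I0 where "I0 = (LINT u|P. min (cdist c0 u) q)"
  have c0_cb: "c0 \<in> codebooks \<Omega> k" using c0' hullP(5) by (auto simp: c0_def codebooks_def)
  have cdist_restrict: "cdist (restrict c {..<k}) = cdist c"
    by (simp add: cdist_def bregman_codebook_def fun_eq_iff)
  have int1: "integrable P (\<lambda>u. min (cdist c u) s)"
    using integrable_min_cdist[OF concP codebook_hullP[OF c] s] by (simp add: cdist_restrict)
  have int2: "integrable P (\<lambda>u. min (cdist c0 u) q)"
    using integrable_min_cdist[OF concP c0_cb] q s by auto
  have I: "\<bar>(LINT u|P. min (cdist c u) s) - I0\<bar> \<le> 4 * \<epsilon>"
  proof -
    have "\<bar>(LINT u|P. min (cdist c u) s) - I0\<bar> = \<bar>LINT u|P. min (cdist c u) s - min (cdist c0 u) q\<bar>"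
      using int1 int2 by (simp add: I0_def)
    also have "\<dots> \<le> (LINT u|P. \<bar>min (cdist c u) s - min (cdist c0 u) q\<bar>)"
      by (rule integral_abs_bound)
    also have "\<dots> \<le> (LINT u|P. 3 * \<epsilon> + s / K * norm u)"
    proof (rule integral_mono_AE)
      show "AE u in P. \<bar>min (cdist c u) s - min (cdist c0 u) q\<bar> \<le> 3 * \<epsilon> + s / K * norm u"
        using AE_measure_support[OF sets_P]
      proof eventually_elim
        case (elim u)
        then have "u \<in> hullP" "u \<in> interior \<Omega>" using hullP by auto
        then show ?case using bound[of c u] c \<delta>(1) by (simp add: cdist_def)
      qed
    qed (use int1 int2 int_norm in auto)
    also have "\<dots> = 3 * \<epsilon> + s / K * (LINT u|P. norm u)"
      using int_norm P.prob_space by simp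
    also have "\<dots> \<le> 3 * \<epsilon> + s / K * B" using s K B by (intro add_left_mono mult_left_mono) auto
    finally show ?thesis using K2 by linarith
  qed
  have "(\<lambda>n. (\<Sum>i<n. min (cdist c0 (x i)) q) / real n) \<longlonglongrightarrow> I0"
    using x c0 q s unfolding good_def I0_def by (meson less_imp_le order_trans)
  then have "(\<lambda>m. (\<Sum>i<r m. min (cdist c0 (x i)) q) / real (r m)) \<longlonglongrightarrow> I0"
    by (rule filterlim_compose[OF _ r])
  then have e1: "\<forall>\<^sub>F m in sequentially. dist ((\<Sum>i<r m. min (cdist c0 (x i)) q) / real (r m)) I0 < \<epsilon>"
    using \<epsilon> by (rule tendstoD)
  have "\<forall>\<^sub>F m in sequentially. \<forall>j\<in>{..<k}. dist (c' m j) (c j) < \<delta>"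
    using lim \<delta>(1) by (intro eventually_ball_finite) (auto dest: tendstoD)
  moreover have "\<forall>\<^sub>F m in sequentially. 1 \<le> r m" using r by (simp add: filterlim_at_top)
  ultimately show "\<forall>\<^sub>F m in sequentially.
    dist ((\<Sum>i<r m. min (cbreg (x i) (c' m)) s) / real (r m)) (LINT u|P. min (cdist c u) s) < e"
    using e1 c'
  proof eventually_elim
    case (elim m)
    have xh: "x i \<in> hullP" "x i \<in> interior \<Omega>" for i using x hullP by (auto simp: good_def)
    have "\<bar>(\<Sum>i<r m. min (cbreg (x i) (c' m)) s) - (\<Sum>i<r m. min (cdist c0 (x i)) q)\<bar> \<le>
        (\<Sum>i<r m. \<bar>min (cbreg (x i) (c' m)) s - min (cbreg (x i) c0) q\<bar>)"
      using xh by (simp add: cdist_def flip: sum_subtractf)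
    also have "\<dots> \<le> (\<Sum>i<r m. 3 * \<epsilon> + s / K * norm (x i))"
      using elim xh by (intro sum_mono bound) auto
    also have "\<dots> = 3 * \<epsilon> * real (r m) + s / K * (\<Sum>i<r m. norm (x i))"
      by (simp add: sum.distrib sum_distrib_left)
    also have "\<dots> \<le> 3 * \<epsilon> * real (r m) + s / K * (B * real (r m))"
      using s K Bx by (intro add_left_mono mult_left_mono) auto
    also have "\<dots> = (3 * \<epsilon> + s / K * B) * real (r m)" by (simp add: algebra_simps)
    also have "\<dots> \<le> 4 * \<epsilon> * real (r m)" using K2 by (intro mult_right_mono) auto
    finally have "\<bar>(\<Sum>i<r m. min (cbreg (x i) (c' m)) s) / real (r m) - (\<Sum>i<r m. min (cdist c0 (x i)) q) / real (r m)\<bar> \<le> 4 * \<epsilon>"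
      using elim by (simp add: divide_le_eq flip: diff_divide_distrib)
    moreover have "e = 9 * \<epsilon>" by (simp add: \<epsilon>_def)
    ultimately show ?case using I elim(3) unfolding dist_real_def by linarith
  qed
qed


text \<open>Codepoints whose cells keep positive limiting mass are bounded; the others may escape to
  infinity. Replacing the latter by copies of a surviving codepoint \<open>j0\<close> still gives an
  optimal limit, and \<open>optimal_codebook_inj\<close> forbids copies, so no cell was
  lost.\<close>

lemma compactness:
  assumes x: "good x" and r: "strict_mono r" "\<And>l. 1 \<le> r l"
    and opt: "\<And>l. opt_triple (r l) x (c l) (w l) (a l)"
  obtains \<rho> cs \<delta> where "strict_mono (\<rho> :: nat \<Rightarrow> nat)" "optimal_codebook \<Omega> \<phi> k P h cs"
    "\<forall>j<k. (\<lambda>m. c (\<rho> m) j) \<longlonglongrightarrow> cs j" "0 < \<delta>"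
    "\<forall>j<k. \<forall>\<^sub>F m in sequentially. \<delta> * real (r (\<rho> m)) \<le> mass (r (\<rho> m)) (w (\<rho> m)) (a (\<rho> m)) j"
    "(\<lambda>m. distortion (emp (r (\<rho> m)) x) (c (\<rho> m))) \<longlonglongrightarrow> opt_value"
proof -
  have xS: "x i \<in> measure_support P" for i using x by (simp add: good_def)
  have xI: "\<forall>i<n. x i \<in> interior \<Omega>" for n using xS hullP by auto
  have xH: "\<forall>i<n. x i \<in> hullP" for n using xS hullP by auto
  obtain B where B: "\<And>n. (\<Sum>i<n. norm (x i)) \<le> B * real n" using x by (auto simp: good_def)
  have ca: "c l \<in> codebooks \<Omega> k" and wa: "\<forall>i<r l. 0 \<le> w l i \<and> w l i \<le> 1" "\<forall>i<r l. 0 \<le> w l i" "\<forall>i<r l. a l i < k"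
    and W: "(\<Sum>i<r l. w l i) = real (r l) * h" for l
    using opt[of l] by (auto simp: opt_triple_def)
  have r0: "0 < real (r l)" for l using r(2)[of l] by simp
  define \<mu> where "\<mu> l j = mass (r l) (w l) (a l) j / real (r l)" for l j
  have \<mu>0: "0 \<le> \<mu> l j" for l j unfolding \<mu>_def using mass_nonneg[OF wa(2)] by simp
  have \<mu>_sum: "(\<Sum>j<k. \<mu> l j) = h" for l
    unfolding \<mu>_def sum_divide_distrib[symmetric] using sum_mass[OF wa(3)] W r0[of l] by simp
  have \<mu>1: "\<mu> l j \<le> h" if "j < k" for l j
    unfolding \<mu>_sum[symmetric, of l] using that \<mu>0 by (intro member_le_sum) auto
  have "bounded (range (\<lambda>l. \<mu> l j))" if "j < k" for j
    using \<mu>0 \<mu>1[OF that] by (intro boundedI[of _ h]) auto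
  then obtain \<rho>1 \<mu>' where \<rho>1: "strict_mono (\<rho>1 :: nat \<Rightarrow> nat)" "\<And>j. j < k \<Longrightarrow> (\<lambda>m. \<mu> (\<rho>1 m) j) \<longlonglongrightarrow> \<mu>' j"
    using bounded_family_convergent_subsequence[of k \<mu>] by metis
  define J where "J = {j. j < k \<and> 0 < \<mu>' j}"
  have finJ: "finite J" by (simp add: J_def)
  have \<mu>'_nonneg: "0 \<le> \<mu>' j" if "j < k" for j using \<rho>1(2)[OF that] \<mu>0 by (intro LIMSEQ_le_const) auto
  have "(\<lambda>m. \<Sum>j<k. \<mu> (\<rho>1 m) j) \<longlonglongrightarrow> (\<Sum>j<k. \<mu>' j)" by (intro tendsto_sum \<rho>1(2)) auto
  then have sum_\<mu>: "(\<Sum>j<k. \<mu>' j) = h" using LIMSEQ_unique[OF _ tendsto_const] by (simp add: \<mu>_sum) 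
  have "J \<noteq> {}"
  proof
    assume "J = {}"
    then have "\<mu>' j \<le> 0" if "j < k" for j
      using that by (intro leI notI) (auto simp: J_def)
    then have "(\<Sum>j<k. \<mu>' j) \<le> 0" by (intro sum_nonpos) simp
    then show False using sum_\<mu> h by simp
  qed
  then obtain j0 where j0: "j0 \<in> J" by auto
  \<comment> \<open>Half of the smallest positive limiting mass, so that the masses of surviving
    cells eventually exceed it.\<close>
  define \<delta> where "\<delta> = Min (\<mu>' ` J) / 2"
  have \<delta>: "0 < \<delta>" unfolding \<delta>_def using finJ \<open>J \<noteq> {}\<close> by (auto simp: J_def)
  have \<delta>_less: "\<delta> < \<mu>' j" if "j \<in> J" for j
  proof -
    have "Min (\<mu>' ` J) \<le> \<mu>' j" using finJ that by (intro Min_le) auto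
    then show ?thesis using \<delta> by (simp add: \<delta>_def)
  qed
  \<comment> \<open>The value 0 fills the indices at which the cell has relative mass below
    \<open>\<delta>\<close>, so that the whole sequence is bounded.\<close>
  define y where "y m j = (if \<delta> \<le> \<mu> (\<rho>1 m) j then c (\<rho>1 m) j else 0)" for m j
  have c_cent: "c l j = cent (r l) x (w l) (a l) j \<and> 0 < mass (r l) (w l) (a l) j" if "j < k" "\<delta> \<le> \<mu> l j" for l j
  proof -
    have "0 < mass (r l) (w l) (a l) j" using that(2) \<delta> r0[of l] by (auto simp: \<mu>_def zero_less_divide_iff dest: less_le_trans)
    then show ?thesis using opt_triple_mean(1)[OF r(2) xI opt that(1)] by simp
  qed
  \<comment> \<open>With \<open>n\<close> sample points, the centroid divides a sum of norm at most
    \<open>B * n\<close> by a mass of at least \<open>\<delta> * n\<close>.\<close>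
  have bnd: "norm (y m j) \<le> B / \<delta>" if j: "j < k" for m j
  proof (cases "\<delta> \<le> \<mu> (\<rho>1 m) j")
    case True
    let ?l = "\<rho>1 m" let ?W = "mass (r ?l) (w ?l) (a ?l) j"
    have W0: "0 < ?W" using c_cent[OF j True] by simp
    have "norm (\<Sum>i\<in>{i\<in>{..<r ?l}. a ?l i = j}. w ?l i *\<^sub>R x i) \<le> (\<Sum>i\<in>{i\<in>{..<r ?l}. a ?l i = j}. norm (x i))"
      using wa(1)[of ?l] by (intro sum_norm_le) (auto intro: mult_left_le_one_le)
    also have "\<dots> \<le> (\<Sum>i<r ?l. norm (x i))" by (intro sum_mono2) auto
    also have "\<dots> \<le> B * real (r ?l)" by (rule B)
    finally have 1: "norm (\<Sum>i\<in>{i\<in>{..<r ?l}. a ?l i = j}. w ?l i *\<^sub>R x i) \<le> B * real (r ?l)" .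
    have 2: "\<delta> * real (r ?l) \<le> ?W" using True r0[of ?l] by (simp add: \<mu>_def le_divide_eq)
    have "norm (y m j) = norm (\<Sum>i\<in>{i\<in>{..<r ?l}. a ?l i = j}. w ?l i *\<^sub>R x i) / ?W"
      using True c_cent[OF j True] W0 by (simp add: y_def cent_def)
    also have "\<dots> \<le> (B * real (r ?l)) / (\<delta> * real (r ?l))"
      using 1 2 \<delta> r0[of ?l] by (intro frac_le) (auto intro: order_trans[OF norm_ge_zero 1])
    finally show ?thesis using r0[of ?l] by simp
  next
    case False
    have "norm (x 0) \<le> B" using B[of 1] by simp
    then have "0 \<le> B" by (rule order_trans[OF norm_ge_zero])
    then show ?thesis using False \<delta> by (simp add: y_def)
  qed
  then have "bounded (range (\<lambda>m. y m j))" if "j < k" for j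
    using that by (intro boundedI[of _ "B / \<delta>"]) auto
  then obtain \<rho>2 Y where \<rho>2: "strict_mono (\<rho>2 :: nat \<Rightarrow> nat)" "\<And>j. j < k \<Longrightarrow> (\<lambda>m. y (\<rho>2 m) j) \<longlonglongrightarrow> Y j"
    using bounded_family_convergent_subsequence[of k y] by metis
  define \<rho> where "\<rho> m = \<rho>1 (\<rho>2 m)" for m
  have \<rho>: "strict_mono \<rho>" unfolding \<rho>_def using strict_mono_o[OF \<rho>1(1) \<rho>2(1)] by (simp add: comp_def)
  have r\<rho>: "filterlim (\<lambda>m. r (\<rho> m)) at_top sequentially"
    using strict_mono_o[OF r(1) \<rho>] by (intro filterlim_subseq) (simp add: comp_def)
  have \<mu>\<rho>: "(\<lambda>m. \<mu> (\<rho> m) j) \<longlonglongrightarrow> \<mu>' j" if "j < k" for j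
    using LIMSEQ_subseq_LIMSEQ[OF \<rho>1(2)[OF that] \<rho>2(1)] by (simp add: \<rho>_def comp_def)
  have ev\<mu>: "\<forall>\<^sub>F m in sequentially. \<delta> \<le> \<mu> (\<rho> m) j" if "j \<in> J" for j
    using order_tendstoD(1)[OF \<mu>\<rho> \<delta>_less[OF that]] that by (auto simp: J_def elim: eventually_mono)
  have evJ: "\<forall>\<^sub>F m in sequentially. \<forall>j\<in>J. \<delta> \<le> \<mu> (\<rho> m) j"
    using ev\<mu> by (intro eventually_ball_finite finJ) auto
  have limJ: "(\<lambda>m. c (\<rho> m) j) \<longlonglongrightarrow> Y j" if "j \<in> J" for j
  proof (rule Lim_transform_eventually)
    show "(\<lambda>m. y (\<rho>2 m) j) \<longlonglongrightarrow> Y j" using that by (intro \<rho>2(2)) (simp add: J_def)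
    show "\<forall>\<^sub>F m in sequentially. y (\<rho>2 m) j = c (\<rho> m) j"
      using ev\<mu>[OF that] by eventually_elim (simp add: y_def \<rho>_def)
  qed
  have c_hull: "c l j \<in> hullP" if "j < k" "\<delta> \<le> \<mu> l j" for l j
    using c_cent[OF that] cent_in[OF hullP(2) xH wa(2)[of l], of "a l" j] by simp
  have Y_hull: "Y j \<in> hullP" if "j \<in> J" for j
    by (rule Lim_in_closed_set[OF hullP(1) _ _ limJ[OF that]])
      (use ev\<mu>[OF that] in \<open>auto elim!: eventually_mono intro!: c_hull\<close>, use that in \<open>simp add: J_def\<close>)
  define p where "p j = (if j \<in> J then j else j0)" for j
  have pJ: "p j \<in> J" "p j < k" for j using j0 by (auto simp: p_def J_def)
  define cs where "cs = restrict (\<lambda>j. Y (p j)) {..<k}"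
  define c' where "c' m = restrict (\<lambda>j. c (\<rho> m) (p j)) {..<k}" for m
  have cs_hull: "\<forall>j<k. cs j \<in> hullP" using Y_hull pJ by (simp add: cs_def)
  have "cs \<in> extensional {..<k}" by (simp add: cs_def)
  then have cs: "cs \<in> codebooks \<Omega> k" using cs_hull hullP(5) by (auto simp: codebooks_def PiE_iff)
  have c'_hull: "\<forall>\<^sub>F m in sequentially. \<forall>j<k. c' m j \<in> hullP"
    using evJ by eventually_elim (use pJ in \<open>auto simp: c'_def intro!: c_hull\<close>)
  have c'_lim: "(\<lambda>m. c' m j) \<longlonglongrightarrow> cs j" if "j < k" for j
    using limJ[OF pJ(1)[of j]] that by (simp add: c'_def cs_def)
  define v where "v m = distortion (emp (r (\<rho> m)) x) (c (\<rho> m))" for m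
  define lost where "lost m = (\<Sum>j\<in>{..<k} - J. \<mu> (\<rho> m) j)" for m
  have "(\<lambda>m. lost m) \<longlonglongrightarrow> (\<Sum>j\<in>{..<k} - J. \<mu>' j)" unfolding lost_def by (intro tendsto_sum \<mu>\<rho>) auto
  moreover have "(\<Sum>j\<in>{..<k} - J. \<mu>' j) = 0" using \<mu>'_nonneg by (intro sum.neutral) (force simp: J_def)
  ultimately have lost: "lost \<longlonglongrightarrow> 0" by simp
  text \<open>Cells of vanishing mass are dropped; their sample points count as trimmed at level \<open>s\<close>.\<close>
  have lower: "(\<Sum>i<r (\<rho> m). min (cbreg (x i) (c' m)) s) / real (r (\<rho> m)) - s * (1 - h + lost m) \<le> v m"
    if s: "0 \<le> s" for s m
  proof -
    let ?l = "\<rho> m" let ?n = "r (\<rho> m)"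
    have "(\<Sum>i<?n. min (cbreg (x i) (c' m)) s - s * (1 - w ?l i) - s * (if a ?l i \<in> J then 0 else w ?l i)) \<le>
        (\<Sum>i<?n. w ?l i * breg (x i) (c ?l (a ?l i)))"
    proof (rule sum_mono)
      fix i assume "i \<in> {..<?n}"
      then have i: "i < ?n" "0 \<le> w ?l i" "w ?l i \<le> 1" "a ?l i < k" using wa by auto
      have xi: "x i \<in> \<Omega>" using xI[of ?n] i interior_subset by auto
      have ge: "0 \<le> breg (x i) (c ?l (a ?l i))" using xi ca[of ?l] i by (intro bregman_nonneg) (auto simp: codebooks_def)
      show "min (cbreg (x i) (c' m)) s - s * (1 - w ?l i) - s * (if a ?l i \<in> J then 0 else w ?l i) \<le>
          w ?l i * breg (x i) (c ?l (a ?l i))"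
      proof (cases "a ?l i \<in> J")
        case True
        have "cbreg (x i) (c' m) \<le> breg (x i) (c ?l (a ?l i))"
          using cbreg_le[OF i(4), of "x i" "c' m"] i True by (simp add: c'_def p_def)
        then have "w ?l i * min (cbreg (x i) (c' m)) s \<le> w ?l i * breg (x i) (c ?l (a ?l i))"
          using i by (intro mult_left_mono) auto
        moreover have "(1 - w ?l i) * min (cbreg (x i) (c' m)) s \<le> (1 - w ?l i) * s"
          using i by (intro mult_left_mono) auto
        ultimately show ?thesis using True by (simp add: algebra_simps)
      next
        case False
        then have "min (cbreg (x i) (c' m)) s - s * (1 - w ?l i) - s * w ?l i \<le> 0" by (simp add: algebra_simps)
        moreover have "0 \<le> w ?l i * breg (x i) (c ?l (a ?l i))" using i ge by simp
        ultimately show ?thesis using False by simp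
      qed
    qed
    also have "\<dots> = real ?n * v m" unfolding v_def by (rule opt_triple_value[OF r(2) xI opt])
    also have "(\<Sum>i<?n. min (cbreg (x i) (c' m)) s - s * (1 - w ?l i) - s * (if a ?l i \<in> J then 0 else w ?l i)) =
        (\<Sum>i<?n. min (cbreg (x i) (c' m)) s) - s * (real ?n - real ?n * h) - s * (\<Sum>i<?n. if a ?l i \<in> J then 0 else w ?l i)"
      using W[of ?l] by (simp add: sum_subtractf sum_distrib_left[symmetric] right_diff_distrib)
    also have "(\<Sum>i<?n. if a ?l i \<in> J then 0 else w ?l i) = real ?n * lost m"
    proof -
      have "(\<Sum>i<?n. if a ?l i \<in> J then 0 else w ?l i) =
          (\<Sum>j<k. \<Sum>i\<in>{i\<in>{..<?n}. a ?l i = j}. if a ?l i \<in> J then 0 else w ?l i)"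
        using wa(3)[of ?l] by (intro sum.group[symmetric]) auto
      also have "\<dots> = (\<Sum>j<k. if j \<in> J then 0 else mass ?n (w ?l) (a ?l) j)"
        by (intro sum.cong refl) (auto simp: mass_def intro!: sum.cong)
      also have "\<dots> = (\<Sum>j\<in>{..<k} - J. mass ?n (w ?l) (a ?l) j)"
        by (intro sum.mono_neutral_cong_right) auto
      also have "\<dots> = real ?n * lost m"
        using r0[of ?l] by (simp add: lost_def \<mu>_def flip: sum_divide_distrib)
      finally show ?thesis .
    qed
    finally show ?thesis using r0[of ?l] by (simp add: field_simps)
  qed
  have lower_lim: "(\<lambda>m. (\<Sum>i<r (\<rho> m). min (cbreg (x i) (c' m)) s) / real (r (\<rho> m)) - s * (1 - h + lost m))
      \<longlonglongrightarrow> dual_value P cs s" if s: "0 \<le> s" for s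
  proof -
    have "(\<lambda>m. (\<Sum>i<r (\<rho> m). min (cbreg (x i) (c' m)) s) / real (r (\<rho> m))) \<longlonglongrightarrow> (LINT u|P. min (cdist cs u) s)"
      by (rule average_cdist_tendsto[OF x r\<rho> cs_hull c'_hull c'_lim s])
    then have "(\<lambda>m. (\<Sum>i<r (\<rho> m). min (cbreg (x i) (c' m)) s) / real (r (\<rho> m)) - s * (1 - h + lost m))
        \<longlonglongrightarrow> (LINT u|P. min (cdist cs u) s) - s * (1 - h + 0)"
      by (intro tendsto_intros lost)
    then show ?thesis by (simp add: dual_value_def)
  qed
  have upper: "\<forall>\<^sub>F m in sequentially. v m \<le> opt_value + \<epsilon>" if \<epsilon>: "0 < \<epsilon>" for \<epsilon>
  proof -
    have "\<forall>\<^sub>F n in sequentially. \<exists>c\<in>codebooks \<Omega> k. distortion (emp n x) c \<le> opt_value + \<epsilon>"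
      using x \<epsilon> by (auto simp: good_def)
    then have "\<forall>\<^sub>F m in sequentially. \<exists>c\<in>codebooks \<Omega> k. distortion (emp (r (\<rho> m)) x) c \<le> opt_value + \<epsilon>"
      by (rule eventually_compose_filterlim[OF _ r\<rho>])
    then show ?thesis
    proof eventually_elim
      case (elim m)
      then obtain b where b: "b \<in> codebooks \<Omega> k" "distortion (emp (r (\<rho> m)) x) b \<le> opt_value + \<epsilon>" by blast
      have "real (r (\<rho> m)) * v m \<le> real (r (\<rho> m)) * distortion (emp (r (\<rho> m)) x) b"
        using opt[of "\<rho> m"] b opt_triple_value[OF r(2) xI opt, of "\<rho> m"] by (auto simp: opt_triple_def v_def)
      then show ?case using b r0[of "\<rho> m"] by simp
    qed
  qed
  have dual_le: "dual_value P cs s \<le> opt_value" if s: "0 \<le> s" for s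
  proof (rule field_le_epsilon)
    fix \<epsilon> :: real assume "0 < \<epsilon>"
    from upper[OF this] have "\<forall>\<^sub>F m in sequentially.
      (\<Sum>i<r (\<rho> m). min (cbreg (x i) (c' m)) s) / real (r (\<rho> m)) - s * (1 - h + lost m) \<le> opt_value + \<epsilon>"
      by eventually_elim (use lower[OF s] in \<open>blast intro: order_trans\<close>)
    then show "dual_value P cs s \<le> opt_value + \<epsilon>"
      by (intro tendsto_upperbound[OF lower_lim[OF s]]) auto
  qed
  have cs_opt: "optimal_codebook \<Omega> \<phi> k P h cs"
    using cs dual_le distortion_eq_dual[OF concP cs] by (simp add: optimal_codebook_iff)
  have J: "j \<in> J" if "j < k" for j
  proof (rule ccontr)
    assume "j \<notin> J"
    then have "cs j = cs j0" using that j0 by (simp add: cs_def p_def J_def)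
    then have "j = j0" using optimal_codebook_inj[OF cs_opt] that j0 by (auto simp: inj_on_def J_def)
    then show False using j0 \<open>j \<notin> J\<close> by simp
  qed
  show thesis
  proof (rule that[OF \<rho> cs_opt _ \<delta>])
    show "\<forall>j<k. (\<lambda>m. c (\<rho> m) j) \<longlonglongrightarrow> cs j"
      using limJ J by (simp add: cs_def p_def)
    show "\<forall>j<k. \<forall>\<^sub>F m in sequentially. \<delta> * real (r (\<rho> m)) \<le> mass (r (\<rho> m)) (w (\<rho> m)) (a (\<rho> m)) j"
    proof (intro allI impI)
      fix j assume "j < k"
      from ev\<mu>[OF J[OF this]]
      show "\<forall>\<^sub>F m in sequentially. \<delta> * real (r (\<rho> m)) \<le> mass (r (\<rho> m)) (w (\<rho> m)) (a (\<rho> m)) j"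
        by eventually_elim (use r0 in \<open>simp add: \<mu>_def le_divide_eq\<close>)
    qed
    define s where "s = (trim_radius \<Omega> \<phi> k P h cs)\<^sup>2"
    have s: "0 \<le> s" by (simp add: s_def)
    have "distortion P cs = opt_value"
      using cs_opt opt_value_le[OF cs] by (simp add: optimal_codebook_iff)
    then have ds: "dual_value P cs s = opt_value" using distortion_eq_dual[OF concP cs] by (simp add: s_def)
    \<comment> \<open>The lower bound at the trimming level of \<open>cs\<close> meets the upper
      bound from near-optimal competitors.\<close>
    have "v \<longlonglongrightarrow> opt_value"
    proof (rule order_tendstoI)
      fix e assume "e < opt_value"
      then have "\<forall>\<^sub>F m in sequentially. e < (\<Sum>i<r (\<rho> m). min (cbreg (x i) (c' m)) s) / real (r (\<rho> m)) - s * (1 - h + lost m)"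
        using order_tendstoD(1)[OF lower_lim[OF s]] ds by simp
      then show "\<forall>\<^sub>F m in sequentially. e < v m"
        by eventually_elim (use lower[OF s] in \<open>blast intro: less_le_trans\<close>)
    next
      fix e assume "opt_value < e"
      then have "\<forall>\<^sub>F m in sequentially. v m \<le> opt_value + (e - opt_value) / 2" by (intro upper) simp
      then show "\<forall>\<^sub>F m in sequentially. v m < e" 
        by eventually_elim (use \<open>opt_value < e\<close> in \<open>simp add: field_simps\<close>)
    qed
    then show "(\<lambda>m. distortion (emp (r (\<rho> m)) x) (c (\<rho> m))) \<longlonglongrightarrow> opt_value" by (simp add: v_def[abs_def])
  qed
qed

end

section \<open>Almost sure properties of a sample\<close>

context sampling
begin

text \<open>The canonical sequence space, on which one coordinate can be varied and exchangeability
  makes sense; \<open>AE_iid_sequence\<close> transfers almost sure statements to the given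
  variables.\<close>

abbreviation "samples \<equiv> PiM UNIV (\<lambda>_::nat. P)"

lemma space_P: "space P = UNIV"
  using concentratedD(3)[OF concP] .

lemma space_samples: "space samples = UNIV"
  by (auto simp: space_PiM space_P)

lemma prob_space_samples: "prob_space samples"
  by (intro prob_space_PiM prob_P)

lemma measurable_coordinate [measurable]: "(\<lambda>x. x i) \<in> borel_measurable samples"
  using measurable_component_singleton[of i UNIV "\<lambda>_. P"] sets_P by (simp cong: measurable_cong_sets)

lemma indep_coordinates: "prob_space.indep_vars samples (\<lambda>_. P) (\<lambda>i x. x i) UNIV"
proof -
  interpret prob_space samples by (rule prob_space_samples)
  have "distr samples P (\<lambda>x. x i) = P" for i
    using distr_PiM_component[of UNIV "\<lambda>_. P" i] prob_P by simp
  then show ?thesis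
    by (subst indep_vars_iff_distr_eq_PiM') (auto simp: restrict_UNIV distr_id2)
qed

lemma averages_converge:
  fixes f :: "'a \<Rightarrow> real"
  assumes f: "f \<in> borel_measurable borel" "\<And>u. 0 \<le> f u" "integrable P (\<lambda>u. (f u)\<^sup>2)"
  shows "AE x in samples. (\<lambda>n. (\<Sum>i<n. f (x i)) / real n) \<longlonglongrightarrow> (LINT u|P. f u)"
proof -
  interpret prob_space samples by (rule prob_space_samples)
  have fP [measurable]: "f \<in> borel_measurable P" using f(1) sets_P by (simp cong: measurable_cong_sets)
  have comp: "distr samples P (\<lambda>x. x i) = P" for i
    using distr_PiM_component[of UNIV "\<lambda>_. P" i] prob_P by simp
  have int: "(LINT x|samples. g (x i)) = (LINT u|P. g u)" "integrable P g \<Longrightarrow> integrable samples (\<lambda>x. g (x i))"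
    if "g \<in> borel_measurable P" for g :: "'a \<Rightarrow> real" and i
    using that integral_distr[of "\<lambda>x. x i" samples P g] integrable_distr_eq[of "\<lambda>x. x i" samples P g] comp[of i] by simp_all
  show ?thesis
  proof (rule strong_law_nonneg_L2)
    show "indep_vars (\<lambda>_. borel) (\<lambda>i x. f (x i)) UNIV"
      by (rule indep_vars_compose2[OF indep_coordinates]) (rule fP)
    show "expectation (\<lambda>x. f (x i)) = (LINT u|P. f u)" for i by (rule int(1)[OF fP])
    show "integrable samples (\<lambda>x. (f (x i))\<^sup>2)" for i
      by (rule int(2)[OF _ f(3)]) measurable
    show "expectation (\<lambda>x. (f (x i))\<^sup>2) = (LINT u|P. (f u)\<^sup>2)" for i
      by (rule int(1)) measurable
  qed (rule f(2))
qed

lemma averages_converge_bounded: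
  fixes f :: "'a \<Rightarrow> real"
  assumes f: "f \<in> borel_measurable borel" "\<And>u. 0 \<le> f u" "\<And>u. f u \<le> b"
  shows "AE x in samples. (\<lambda>n. (\<Sum>i<n. f (x i)) / real n) \<longlonglongrightarrow> (LINT u|P. f u)"
proof (rule averages_converge[OF f(1,2)])
  interpret P: prob_space P by (rule prob_P)
  have [measurable]: "f \<in> borel_measurable P" using f(1) sets_P by (simp cong: measurable_cong_sets)
  show "integrable P (\<lambda>u. (f u)\<^sup>2)"
    using f by (intro P.integrable_const_bound[where B="b\<^sup>2"]) (auto intro: power_mono)
qed

lemma AE_support: "AE x in samples. \<forall>i. x i \<in> measure_support P"
proof -
  have "AE x in samples. x i \<in> measure_support P" for i
    using AE_PiM_component[of UNIV "\<lambda>_. P" i] prob_P AE_measure_support[OF sets_P] by simp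
  then show ?thesis by (simp add: AE_all_countable)
qed

text \<open>The minimising trimming weight for \<open>P\<close> is a competitor for the empirical measure, up to a
  correction of its mass that is controlled because the empirical trimming level stays bounded.\<close>

lemma AE_distortion_le:
  assumes c: "c \<in> codebooks \<Omega> k"
  shows "AE x in samples. \<forall>\<epsilon>>0. \<forall>\<^sub>F n in sequentially. distortion (emp n x) c \<le> distortion P c + \<epsilon>"
proof -
  interpret P: prob_space P by (rule prob_P)
  obtain s w where w: "trimming_weight P c s w" "integrable P (\<lambda>u. w u * cdist c u)"
    and R: "distortion P c = (LINT u|P. w u * cdist c u)"
    using distortion_weight[OF concP c] .
  have wm [measurable]: "w \<in> borel_measurable borel" and w01: "\<And>u. 0 \<le> w u" "\<And>u. w u \<le> 1" and s: "0 \<le> s"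
    using w by (auto simp: trimming_weight_def)
  have wg: "w u * cdist c u \<le> s" for u
  proof (cases "s < cdist c u")
    case True then show ?thesis using w s by (simp add: trimming_weight_def)
  next
    case False
    then have "w u * cdist c u \<le> 1 * s" using w01[of u] cdist_nonneg[OF c, of u] by (intro mult_mono) auto
    then show ?thesis by simp
  qed
  have "(\<lambda>n::nat. P.prob {u. cdist c u < real n}) \<longlonglongrightarrow> P.prob (\<Union>n::nat. {u. cdist c u < real n})"
  proof (rule P.finite_Lim_measure_incseq)
    have "{u. cdist c u < real n} \<in> sets borel" for n :: nat by measurable
    then show "range (\<lambda>n::nat. {u. cdist c u < real n}) \<subseteq> sets P" using sets_P by blast
    show "incseq (\<lambda>n::nat. {u. cdist c u < real n})"
      by (rule incseq_SucI) auto
  qed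
  also have "(\<Union>n::nat. {u. cdist c u < real n}) = space P"
    unfolding space_P using reals_Archimedean2 by blast
  finally have "\<forall>\<^sub>F n in sequentially. h < P.prob {u. cdist c u < real n}"
    using h by (intro order_tendstoD) (auto simp: P.prob_space)
  \<comment> \<open>By the law of large numbers \<open>T\<close> eventually has empirical mass above
    \<open>h\<close>, while the mass strictly below the empirical level \<open>s'\<close> is at most
    \<open>h\<close>; hence \<open>s'\<close> is at most \<open>t\<close>.\<close>
  then obtain t :: nat where t: "h < P.prob {u. cdist c u < real t}" by (auto simp: eventually_sequentially)
  define T where "T = {u. cdist c u < real t}"
  have T [measurable]: "T \<in> sets borel" unfolding T_def by measurable
  have intT: "(LINT u|P. indicator T u) = P.prob T" using T sets_P by simp
  have Rw: "(LINT u|P. w u) = h" using w by (simp add: trimming_weight_def)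
  have a1: "AE x in samples. (\<lambda>n. (\<Sum>i<n. w (x i)) / real n) \<longlonglongrightarrow> h"
    using averages_converge_bounded[of w 1] w01 Rw by simp
  have a2: "AE x in samples. (\<lambda>n. (\<Sum>i<n. w (x i) * cdist c (x i)) / real n) \<longlonglongrightarrow> distortion P c"
    using averages_converge_bounded[of "\<lambda>u. w u * cdist c u" s] w01 cdist_nonneg[OF c] wg R by simp
  have a3: "AE x in samples. (\<lambda>n. (\<Sum>i<n. indicator T (x i)) / real n) \<longlonglongrightarrow> P.prob T"
    using averages_converge_bounded[of "indicator T" 1] T intT by (simp add: indicator_le_1)
  show ?thesis
    using a1 a2 a3 AE_support
  proof eventually_elim
    case (elim x)
    have xI: "\<forall>i<n. x i \<in> interior \<Omega>" for n using elim(4) hullP by auto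
    show ?case
    proof (intro allI impI)
      fix \<epsilon> :: real assume "0 < \<epsilon>"
      have e3: "\<forall>\<^sub>F n in sequentially. h < (\<Sum>i<n. indicator T (x i)) / real n"
        using order_tendstoD(1)[OF elim(3)] t by (simp add: T_def)
      have "(\<lambda>n. (\<Sum>i<n. w (x i) * cdist c (x i)) / real n + real t * \<bar>h - (\<Sum>i<n. w (x i)) / real n\<bar>)
          \<longlonglongrightarrow> distortion P c + real t * \<bar>h - h\<bar>"
        by (intro tendsto_intros elim)
      then have "\<forall>\<^sub>F n in sequentially.
          (\<Sum>i<n. w (x i) * cdist c (x i)) / real n + real t * \<bar>h - (\<Sum>i<n. w (x i)) / real n\<bar> < distortion P c + \<epsilon>"
        using \<open>0 < \<epsilon>\<close> by (intro order_tendstoD) auto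
      moreover have "\<forall>\<^sub>F n in sequentially. 1 \<le> n" by (rule eventually_ge_at_top)
      ultimately show "\<forall>\<^sub>F n in sequentially. distortion (emp n x) c \<le> distortion P c + \<epsilon>"
        using e3
      proof eventually_elim
        case (elim n)
        note conc = concentrated_emp[OF elim(2) xI]
        interpret E: prob_space "emp n x" using elim(2) by (rule prob_space_emp)
        have wgm: "(\<lambda>u. w u * cdist c u) \<in> borel_measurable borel" by measurable
        then have "(\<lambda>u. w u * cdist c u) \<in> borel_measurable (emp n x)"
          by (simp cong: measurable_cong_sets)
        then have "integrable (emp n x) (\<lambda>u. w u * cdist c u)"
          using w01 cdist_nonneg[OF c] wg by (intro E.integrable_const_bound[where B=s]) auto
        then obtain s' where s': "0 \<le> s'" "measure (emp n x) {u. cdist c u < s'} \<le> h"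
          "distortion (emp n x) c \<le> (LINT u|emp n x. w u * cdist c u) + s' * (h - (LINT u|emp n x. w u))"
          using distortion_le_weighted[OF conc c wm w01] by blast
        have "s' \<le> real t"
        proof (rule ccontr)
          assume "\<not> s' \<le> real t"
          then have "measure (emp n x) T \<le> measure (emp n x) {u. cdist c u < s'}"
            unfolding T_def by (intro E.finite_measure_mono) auto
          moreover have "measure (emp n x) T = (\<Sum>i<n. indicator T (x i)) / real n"
            using elim(2) T by (subst integral_emp[symmetric])
              (auto simp: sets_eq_imp_space_eq[OF sets_emp])
          ultimately show False using s'(2) elim(3) by simp
        qed
        then have "s' * \<bar>h - (LINT u|emp n x. w u)\<bar> \<le> real t * \<bar>h - (LINT u|emp n x. w u)\<bar>"
          by (rule mult_right_mono) simp
        with mult_left_mono[OF abs_ge_self s'(1)]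
        have "s' * (h - (LINT u|emp n x. w u)) \<le> real t * \<bar>h - (LINT u|emp n x. w u)\<bar>"
          by (rule order_trans)
        from order_trans[OF s'(3) add_left_mono[OF this]] elim(1) show ?case
          unfolding integral_emp[OF wm] integral_emp[OF wgm] by (rule less_imp_le[OF le_less_trans])
      qed
    qed
  qed
qed

lemma AE_good: "AE x in samples. good x"
proof -
  interpret P: prob_space P by (rule prob_P)
  \<comment> \<open>Near-optimal codebooks, since no optimum is available yet; countably many of
    them suffice for all \<open>\<epsilon>\<close>.\<close>
  have "\<exists>c. c \<in> codebooks \<Omega> k \<and> distortion P c < opt_value + 1 / real (Suc l)" for l
  proof -
    have "\<exists>r\<in>distortion P ` codebooks \<Omega> k. r < opt_value + 1 / real (Suc l)"
      unfolding opt_value_def using codebooks_nonempty by (intro cInf_lessD) auto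
    then show ?thesis by blast
  qed
  then obtain b where b: "\<And>l. b l \<in> codebooks \<Omega> k" "\<And>l. distortion P (b l) < opt_value + 1 / real (Suc l)"
    by metis
  have 1: "AE x in samples. (\<lambda>n. (\<Sum>i<n. norm (x i)) / real n) \<longlonglongrightarrow> (LINT u|P. norm u)"
    by (rule averages_converge) (auto intro: int_norm2)
  have 2: "AE x in samples. \<forall>c\<in>{..<k} \<rightarrow>\<^sub>E dense_points. \<forall>s\<in>\<rat> \<inter> {0..}.
      (\<lambda>n. (\<Sum>i<n. min (cdist c (x i)) s) / real n) \<longlonglongrightarrow> (LINT u|P. min (cdist c u) s)"
  proof (intro AE_ball_countable[THEN iffD2] ballI)
    show "countable ({..<k} \<rightarrow>\<^sub>E dense_points)" by (intro countable_PiE dense_points) auto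
    show "countable (\<rat> \<inter> {0..} :: real set)" by (intro countable_Int1 countable_rat)
    fix c and s :: real assume c: "c \<in> {..<k} \<rightarrow>\<^sub>E dense_points" and s: "s \<in> \<rat> \<inter> {0..}"
    have "c \<in> codebooks \<Omega> k" using c dense_points(2) hullP(5) by (fastforce simp: codebooks_def PiE_iff)
    then show "AE x in samples. (\<lambda>n. (\<Sum>i<n. min (cdist c (x i)) s) / real n) \<longlonglongrightarrow> (LINT u|P. min (cdist c u) s)"
      using s cdist_nonneg by (intro averages_converge_bounded[where b=s]) auto
  qed
  have 3: "AE x in samples. \<forall>l. \<forall>\<epsilon>>0. \<forall>\<^sub>F n in sequentially. distortion (emp n x) (b l) \<le> distortion P (b l) + \<epsilon>"
    unfolding AE_all_countable using AE_distortion_le[OF b(1)] by blast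
  show ?thesis
    using 1 2 3 AE_support
  proof eventually_elim
    case (elim x)
    have "\<exists>B. \<forall>n. (\<Sum>i<n. norm (x i)) \<le> B * real n"
    proof -
      obtain B where B: "\<And>n. \<bar>(\<Sum>i<n. norm (x i)) / real n\<bar> \<le> B"
        using convergent_imp_Bseq[OF convergentI[OF elim(1)]] by (auto simp: Bseq_def)
      have "(\<Sum>i<n. norm (x i)) \<le> B * real n" for n
        using B[of n] by (cases "n = 0") (auto simp: divide_le_eq abs_le_iff)
      then show ?thesis by blast
    qed
    moreover have "\<forall>\<^sub>F n in sequentially. \<exists>c\<in>codebooks \<Omega> k. distortion (emp n x) c \<le> opt_value + \<epsilon>"
      if pos: "0 < \<epsilon>" for \<epsilon>
    proof -
      obtain l where "1 / real (Suc l) < \<epsilon> / 2" using nat_approx_posE[OF half_gt_zero[OF pos]] by blast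
      then have "distortion P (b l) + \<epsilon> / 2 \<le> opt_value + \<epsilon>" using b(2)[of l] by linarith
      moreover have "\<forall>\<^sub>F n in sequentially. distortion (emp n x) (b l) \<le> distortion P (b l) + \<epsilon> / 2"
        using elim(3) half_gt_zero[OF pos] by blast
      ultimately show ?thesis using b(1)[of l] by (auto elim!: eventually_mono intro!: bexI[of _ "b l"])
    qed
    ultimately show ?case
      unfolding good_def using elim(2,4) by auto
  qed
qed

end

section \<open>Ties between configurations\<close>

context sampling
begin

definition gradI :: "'a \<Rightarrow> 'a" where "gradI u = (if u \<in> interior \<Omega> then grad u else 0)"

lemma borel_measurable_phiI [measurable]: "phiI \<in> borel_measurable borel"
  unfolding phiI_def
  by (intro borel_measurable_continuous_on_if continuous_on_subset[OF continuous_on_phi] interior_subset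
      continuous_intros) auto

lemma borel_measurable_gradI [measurable]: "gradI \<in> borel_measurable borel"
  unfolding gradI_def
  by (intro borel_measurable_continuous_on_if continuous_on_subset[OF continuous_on_grad] interior_subset
      continuous_intros) auto

lemma phiI_has_derivative:
  assumes "z \<in> interior \<Omega>"
  shows "(phiI has_derivative (\<lambda>v. gradI z \<bullet> v)) (at z)"
proof (rule has_derivative_transform_within_open)
  show "(\<phi> has_derivative (\<lambda>v. gradI z \<bullet> v)) (at z)"
    using has_derivative_grad_interior[OF assms] assms by (simp add: gradI_def)
qed (use assms in \<open>auto simp: phiI_def\<close>)

text \<open>The gradient of \<open>cost\<close> in the sample point \<open>x i\<close>. The centroid
  moves with \<open>x i\<close> at rate \<open>w i / mass n w a (a i)\<close>, and the denominator
  cancels against the mass in \<open>cost\<close>.\<close>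

definition score :: "nat \<Rightarrow> (nat \<Rightarrow> 'a) \<Rightarrow> (nat \<Rightarrow> real) \<Rightarrow> (nat \<Rightarrow> nat) \<Rightarrow> nat \<Rightarrow> 'a" where
  "score n x w a i = w i *\<^sub>R (gradI (x i) - gradI (cent n x w a (a i)))"

text \<open>By injectivity of the gradient, the second clause keeps the score of a weighted point in
  a shared cell from being 0, so that it can be told apart from a trimmed point.\<close>

definition tie_free :: "(nat \<Rightarrow> 'a) \<Rightarrow> bool" where
  "tie_free x \<longleftrightarrow>
     (\<forall>n. \<forall>(w, a)\<in>confs n. \<forall>(w', a')\<in>confs n. cost n x w a = cost n x w' a' \<longrightarrow>
        (\<forall>i<n. score n x w a i = score n x w' a' i)) \<and>
     (\<forall>n. \<forall>(w, a)\<in>confs n. \<forall>i<n. \<forall>l<n. i \<noteq> l \<longrightarrow> 0 < w i \<longrightarrow> 0 < w l \<longrightarrow> a i = a l \<longrightarrow>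
        x i \<noteq> cent n x w a (a i))"

lemma sum_fun_upd_add:
  fixes x :: "nat \<Rightarrow> 'a"
  assumes "i < n"
  shows "(\<Sum>l\<in>{l\<in>{..<n}. a l = j}. w l *\<^sub>R (x(i := x i + v)) l) =
    (\<Sum>l\<in>{l\<in>{..<n}. a l = j}. w l *\<^sub>R x l) + (if a i = j then w i *\<^sub>R v else 0)"
proof -
  have "(\<Sum>l\<in>{l\<in>{..<n}. a l = j}. w l *\<^sub>R (x(i := x i + v)) l) =
      (\<Sum>l\<in>{l\<in>{..<n}. a l = j}. w l *\<^sub>R x l + (if l = i then w l *\<^sub>R v else 0))"
    by (intro sum.cong) (auto simp: algebra_simps)
  also have "\<dots> = (\<Sum>l\<in>{l\<in>{..<n}. a l = j}. w l *\<^sub>R x l) + (if a i = j then w i *\<^sub>R v else 0)"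
    using assms by (simp add: sum.distrib)
  finally show ?thesis .
qed

lemma cent_fun_upd_add:
  assumes "i < n"
  shows "cent n (x(i := x i + v)) w a j = cent n x w a j + (if a i = j then (w i / mass n w a j) *\<^sub>R v else 0)"
  unfolding cent_def sum_fun_upd_add[OF assms] by (simp add: scaleR_add_right)

lemma cost_has_derivative:
  assumes x: "\<forall>l<n. x l \<in> interior \<Omega>" and i: "i < n" and w: "\<forall>l<n. 0 \<le> w l" and a: "\<forall>l<n. a l < k"
  shows "((\<lambda>t. cost n (x(i := x i + t *\<^sub>R b)) w a) has_real_derivative score n x w a i \<bullet> b) (at 0)"
proof -
  have comp: "((\<lambda>t. phiI (z + t *\<^sub>R v)) has_real_derivative gradI z \<bullet> v) (at 0)" if "z \<in> interior \<Omega>" for z v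
  proof -
    have "((\<lambda>t. z + t *\<^sub>R v) has_derivative (\<lambda>t. t *\<^sub>R v)) (at 0)"
      by (auto intro!: derivative_eq_intros)
    moreover have "(phiI has_derivative (\<lambda>v. gradI z \<bullet> v)) (at (z + 0 *\<^sub>R v))"
      using phiI_has_derivative[OF that] by simp
    ultimately have "((\<lambda>t. phiI (z + t *\<^sub>R v)) has_derivative (\<lambda>t. gradI z \<bullet> (t *\<^sub>R v))) (at 0)"
      by (rule has_derivative_compose)
    moreover have "(\<lambda>t. gradI z \<bullet> (t *\<^sub>R v)) = (*) (gradI z \<bullet> v)" by (simp add: fun_eq_iff)
    ultimately show ?thesis by (simp add: has_field_derivative_def)
  qed
  have d1: "((\<lambda>t. w l * phiI ((x(i := x i + t *\<^sub>R b)) l)) has_real_derivative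
      (if l = i then w i * (gradI (x i) \<bullet> b) else 0)) (at 0)" if "l < n" for l
    using DERIV_cmult[OF comp[of "x i" b], of "w i"] x i by (cases "l = i") auto
  have d2: "((\<lambda>t. mass n w a j * phiI (cent n (x(i := x i + t *\<^sub>R b)) w a j)) has_real_derivative
      (if a i = j then w i * (gradI (cent n x w a j) \<bullet> b) else 0)) (at 0)" for j
  proof (cases "0 < mass n w a j")
    case True
    have "((\<lambda>t. mass n w a j * phiI (cent n x w a j + t *\<^sub>R (if a i = j then (w i / mass n w a j) *\<^sub>R b else 0)))
        has_real_derivative mass n w a j * (gradI (cent n x w a j) \<bullet> (if a i = j then (w i / mass n w a j) *\<^sub>R b else 0))) (at 0)"
      by (intro DERIV_cmult comp cent_in[OF convex_interior_domain x w True])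
    moreover have "cent n (x(i := x i + t *\<^sub>R b)) w a j =
        cent n x w a j + t *\<^sub>R (if a i = j then (w i / mass n w a j) *\<^sub>R b else 0)" for t
      by (simp add: cent_fun_upd_add[OF i] mult.commute)
    moreover have "mass n w a j * (gradI (cent n x w a j) \<bullet> (if a i = j then (w i / mass n w a j) *\<^sub>R b else 0)) =
        (if a i = j then w i * (gradI (cent n x w a j) \<bullet> b) else 0)"
      using True by simp
    ultimately show ?thesis by simp
  next
    case False
    then have m0: "mass n w a j = 0" using mass_nonneg[OF w, of a j] by simp
    \<comment> \<open>If the cell of \<open>i\<close> has mass 0, both its term in the cost and the
      claimed derivative vanish.\<close>
    then have "w i = 0" if "a i = j"
      using that i w unfolding mass_def by (subst (asm) sum_nonneg_eq_0_iff) auto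
    then show ?thesis using m0 by auto
  qed
  have "((\<lambda>t. cost n (x(i := x i + t *\<^sub>R b)) w a) has_real_derivative
      (\<Sum>l<n. if l = i then w i * (gradI (x i) \<bullet> b) else 0) -
      (\<Sum>j<k. if a i = j then w i * (gradI (cent n x w a j) \<bullet> b) else 0)) (at 0)"
    unfolding cost_def by (intro DERIV_diff DERIV_sum d1 d2) auto
  moreover have "(\<Sum>l<n. if l = i then w i * (gradI (x i) \<bullet> b) else 0) = w i * (gradI (x i) \<bullet> b)"
    using i by simp
  moreover have "(\<Sum>j<k. if a i = j then w i * (gradI (cent n x w a j) \<bullet> b) else 0) = w i * (gradI (cent n x w a (a i)) \<bullet> b)"
    using a i by simp
  ultimately show ?thesis by (simp add: score_def inner_diff_left right_diff_distrib)
qed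


lemma borel_measurable_cent [measurable]: "(\<lambda>x. cent n x w a j) \<in> borel_measurable samples"
  unfolding cent_def by measurable

lemma borel_measurable_cost [measurable]: "(\<lambda>x. cost n x w a) \<in> borel_measurable samples"
  unfolding cost_def by measurable

lemma borel_measurable_score [measurable]: "(\<lambda>x. score n x w a i) \<in> borel_measurable samples"
  unfolding score_def by measurable

lemma AE_not_in_slices:
  assumes "T \<in> sets samples" "\<And>x. emeasure P {y. x(i := y) \<in> T} = 0"
  shows "AE x in samples. x \<notin> T"
  using null_PiM_slices[OF prob_P space_P assms] assms(1) by (intro AE_not_in) (simp add: null_sets_def)

lemma slice_borel:
  assumes "T \<in> sets samples"
  shows "{y. x(i := y) \<in> T} \<in> sets borel"
proof -
  have "(\<lambda>y. x(i := y)) \<in> P \<rightarrow>\<^sub>M samples"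
    by (rule measurable_fun_upd[where J=UNIV]) (auto simp: space_samples)
  from measurable_sets[OF this assms] show ?thesis
    by (simp add: space_P sets_P vimage_def)
qed

lemma emeasure_P_eq_0:
  assumes "emeasure lborel N = 0" "N \<in> sets borel"
  shows "emeasure P N = 0"
proof -
  have "N \<in> null_sets lborel" using assms by (intro null_setsI) auto
  then have "N \<in> null_sets P" using ac unfolding absolutely_continuous_def by blast
  then show ?thesis by (rule null_setsD1)
qed

text \<open>Along a line in direction \<open>b\<close>, the difference of the two costs has only simple zeros at the exceptional
  points, so there are countably many of them.\<close>

lemma AE_no_transversal_tie:
  assumes conf: "(w, a) \<in> confs n" "(w', a') \<in> confs n" and i: "i < n"
  shows "AE x in samples. (\<forall>l<n. x l \<in> interior \<Omega>) \<longrightarrow> cost n x w a = cost n x w' a' \<longrightarrow>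
    (score n x w a i - score n x w' a' i) \<bullet> b = 0"
proof -
  define T where "T = {x \<in> space samples. (\<forall>l<n. x l \<in> interior \<Omega>) \<and> cost n x w a = cost n x w' a' \<and>
    (score n x w a i - score n x w' a' i) \<bullet> b \<noteq> 0}"
  have "(\<lambda>x. (score n x w a i - score n x w' a' i) \<bullet> b) \<in> borel_measurable samples"
    by (intro borel_measurable_inner borel_measurable_diff borel_measurable_score borel_measurable_const)
  then have "{x \<in> space samples. (score n x w a i - score n x w' a' i) \<bullet> b \<noteq> 0} \<in> sets samples"
    by (rule borel_measurable_neq) simp
  moreover have "{x \<in> space samples. cost n x w a = cost n x w' a'} \<in> sets samples"
    by (rule borel_measurable_eq) (rule borel_measurable_cost)+
  moreover have "{x \<in> space samples. \<forall>l\<in>{..<n}. x l \<in> interior \<Omega>} \<in> sets samples"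
  proof (intro sets.sets_Collect_finite_All finite_lessThan)
    fix l
    show "{x \<in> space samples. x l \<in> interior \<Omega>} \<in> sets samples"
      using measurable_sets[OF measurable_coordinate[of l], of "interior \<Omega>"]
      by (simp add: space_samples vimage_def)
  qed
  ultimately have "{x \<in> space samples. \<forall>l\<in>{..<n}. x l \<in> interior \<Omega>} \<inter>
      ({x \<in> space samples. cost n x w a = cost n x w' a'} \<inter>
      {x \<in> space samples. (score n x w a i - score n x w' a' i) \<bullet> b \<noteq> 0}) \<in> sets samples" (is "?A \<in> _")
    by (intro sets.Int)
  moreover have "?A = T" by (auto simp: T_def)
  ultimately have T: "T \<in> sets samples" by simp
  have "emeasure P {y. x(i := y) \<in> T} = 0" for x
  proof (intro emeasure_P_eq_0 emeasure_lborel_eq_0_lines[where b=b] slice_borel T)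
    fix y
    define \<psi> where "\<psi> t = cost n (x(i := y + t *\<^sub>R b)) w a - cost n (x(i := y + t *\<^sub>R b)) w' a'" for t
    have "\<psi> t = 0 \<and> (\<exists>D. D \<noteq> 0 \<and> (\<psi> has_real_derivative D) (at t))" if "x(i := y + t *\<^sub>R b) \<in> T" for t
    proof
      let ?z = "x(i := y + t *\<^sub>R b)"
      have zI: "\<forall>l<n. ?z l \<in> interior \<Omega>" and tr: "(score n ?z w a i - score n ?z w' a' i) \<bullet> b \<noteq> 0"
        using that by (auto simp: T_def)
      show "\<psi> t = 0" using that by (simp add: T_def \<psi>_def)
      have "((\<lambda>s. cost n (?z(i := ?z i + s *\<^sub>R b)) w a - cost n (?z(i := ?z i + s *\<^sub>R b)) w' a')
          has_real_derivative score n ?z w a i \<bullet> b - score n ?z w' a' i \<bullet> b) (at 0)"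
        using confsD[OF conf(1)] confsD[OF conf(2)] by (intro DERIV_diff cost_has_derivative zI i) auto
      moreover have "?z(i := ?z i + s *\<^sub>R b) = x(i := y + (s + t) *\<^sub>R b)" for s
        by (simp add: algebra_simps)
      ultimately have "((\<lambda>s. \<psi> (s + t)) has_real_derivative (score n ?z w a i - score n ?z w' a' i) \<bullet> b) (at 0)"
        by (simp add: \<psi>_def inner_diff_left)
      then have "(\<psi> has_real_derivative (score n ?z w a i - score n ?z w' a' i) \<bullet> b) (at t)"
        by (subst (asm) DERIV_shift[symmetric]) simp
      with tr show "\<exists>D. D \<noteq> 0 \<and> (\<psi> has_real_derivative D) (at t)" by blast
    qed
    then have "{t. y + t *\<^sub>R b \<in> {y. x(i := y) \<in> T}} \<subseteq>
        {t. \<psi> t = 0 \<and> (\<exists>D. D \<noteq> 0 \<and> (\<psi> has_real_derivative D) (at t))}"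
      by blast
    then show "countable {t. y + t *\<^sub>R b \<in> {y. x(i := y) \<in> T}}"
      by (rule countable_subset[OF _ countable_simple_zeros])
  qed
  from AE_not_in_slices[OF T this] show ?thesis
    by eventually_elim (auto simp: T_def space_samples)
qed

text \<open>With another weighted point in the cell, \<open>x i\<close> has a share
  \<open>q < 1\<close> in its centroid, so equality determines \<open>x i\<close> from the other
  points.\<close>

lemma AE_not_cent:
  assumes conf: "(w, a) \<in> confs n" and i: "i < n" and l: "l < n" "i \<noteq> l" "0 < w i" "0 < w l" "a i = a l"
  shows "AE x in samples. x i \<noteq> cent n x w a (a i)"
proof -
  define T where "T = {x \<in> space samples. x i = cent n x w a (a i)}"
  have T: "T \<in> sets samples"
    unfolding T_def by (rule measurable_equality_set[OF measurable_coordinate borel_measurable_cent])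
  have w: "\<forall>l<n. 0 \<le> w l" using confsD[OF conf] by auto
  have "w i + w l = (\<Sum>q\<in>{i, l}. w q)" using l by simp
  also have "\<dots> \<le> mass n w a (a i)"
    unfolding mass_def using i l w by (intro sum_mono2) auto
  finally have m: "w i < mass n w a (a i)" using l by simp
  have "emeasure P {y. x(i := y) \<in> T} = 0" for x
  proof (intro emeasure_P_eq_0 slice_borel T)
    define q where "q = w i / mass n w a (a i)"
    have q: "q < 1" using m l by (simp add: q_def)
    have cent: "cent n (x(i := y)) w a (a i) = cent n (x(i := 0)) w a (a i) + q *\<^sub>R y" for y
      using cent_fun_upd_add[OF i, of "x(i := 0)" y w a "a i"] by (simp add: q_def)
    have "{y. x(i := y) \<in> T} \<subseteq> {(1 / (1 - q)) *\<^sub>R cent n (x(i := 0)) w a (a i)}"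
    proof
      fix y assume "y \<in> {y. x(i := y) \<in> T}"
      then have "y = cent n (x(i := 0)) w a (a i) + q *\<^sub>R y" using cent[of y] by (simp add: T_def)
      then have "(1 - q) *\<^sub>R y = cent n (x(i := 0)) w a (a i)" by (simp add: algebra_simps)
      then have "(1 / (1 - q)) *\<^sub>R ((1 - q) *\<^sub>R y) = (1 / (1 - q)) *\<^sub>R cent n (x(i := 0)) w a (a i)" by simp
      then show "y \<in> {(1 / (1 - q)) *\<^sub>R cent n (x(i := 0)) w a (a i)}" using q by simp
    qed
    then have "finite {y. x(i := y) \<in> T}" by (rule finite_subset) simp
    then show "emeasure lborel {y. x(i := y) \<in> T} = 0"
      by (rule emeasure_lborel_countable[OF countable_finite])
  qed
  from AE_not_in_slices[OF T this] show ?thesis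
    by eventually_elim (auto simp: T_def space_samples)
qed

lemma AE_tie_free: "AE x in samples. tie_free x"
proof -
  have "AE x in samples. \<forall>n. \<forall>p\<in>confs n. \<forall>p'\<in>confs n. \<forall>i\<in>{..<n}. \<forall>b\<in>Basis.
      (\<forall>l<n. x l \<in> interior \<Omega>) \<longrightarrow> cost n x (fst p) (snd p) = cost n x (fst p') (snd p') \<longrightarrow>
      (score n x (fst p) (snd p) i - score n x (fst p') (snd p') i) \<bullet> b = 0"
    unfolding AE_all_countable
    by (intro allI AE_finite_allI finite_confs finite_lessThan finite_Basis AE_no_transversal_tie) auto
  moreover have "AE x in samples. \<forall>n. \<forall>p\<in>confs n. \<forall>i\<in>{..<n}. \<forall>l\<in>{..<n}.
      i \<noteq> l \<and> 0 < fst p i \<and> 0 < fst p l \<and> snd p i = snd p l \<longrightarrow> x i \<noteq> cent n x (fst p) (snd p) (snd p i)"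
    unfolding AE_all_countable
  proof (intro allI AE_finite_allI finite_confs finite_lessThan)
    fix n p i l assume "p \<in> confs n" "i \<in> {..<n}" "l \<in> {..<n}"
    then show "AE x in samples. i \<noteq> l \<and> 0 < fst p i \<and> 0 < fst p l \<and> snd p i = snd p l \<longrightarrow>
        x i \<noteq> cent n x (fst p) (snd p) (snd p i)"
      using AE_not_cent[of "fst p" "snd p" n i l]
      by (cases "i \<noteq> l \<and> 0 < fst p i \<and> 0 < fst p l \<and> snd p i = snd p l") auto
  qed
  ultimately show ?thesis
    using AE_support
  proof eventually_elim
    case (elim x)
    have xI: "\<forall>l<n. x l \<in> interior \<Omega>" for n using elim(3) hullP by auto
    show ?case
      unfolding tie_free_def
    proof (intro conjI allI ballI, clarify)
      fix n w a w' a' i assume c: "(w, a) \<in> confs n" "(w', a') \<in> confs n" "cost n x w a = cost n x w' a'" "i < n"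
      have "(score n x w a i - score n x w' a' i) \<bullet> b = 0" if "b \<in> Basis" for b
        using elim(1)[rule_format, OF c(1,2), of i b] that c xI by simp
      then have "score n x w a i - score n x w' a' i = 0" by (rule euclidean_all_zero_iff[THEN iffD1, OF ballI])
      then show "score n x w a i = score n x w' a' i" by simp
    next
      fix n p assume "p \<in> confs n"
      then show "case p of (w, a) \<Rightarrow> \<forall>i<n. \<forall>l<n. i \<noteq> l \<longrightarrow> 0 < w i \<longrightarrow> 0 < w l \<longrightarrow> a i = a l \<longrightarrow>
          x i \<noteq> cent n x w a (a i)"
        using elim(2) by (cases p) fastforce
    qed
  qed
qed

section \<open>Uniqueness of empirical optima up to relabelling\<close>

text \<open>A cell of mass at least 3 holds three weighted points; discarding the possible
  fractional index of each of two configurations leaves at least one.\<close>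

definition regular :: "nat \<Rightarrow> (nat \<Rightarrow> 'a) \<Rightarrow> (nat \<Rightarrow> real) \<Rightarrow> (nat \<Rightarrow> nat) \<Rightarrow> bool" where
  "regular n c w a \<longleftrightarrow> inj_on c {..<k} \<and> (\<forall>j<k. 3 \<le> mass n w a j)"

text \<open>Along a sequence of violations, \<open>compactness\<close> would give distinct limits of
  the codepoints and cell masses of order \<open>n\<close>.\<close>

lemma eventually_regular:
  assumes x: "good x"
  shows "\<forall>\<^sub>F n in sequentially. 1 \<le> n \<longrightarrow> (\<forall>c w a. opt_triple n x c w a \<longrightarrow> regular n c w a)"
proof (rule ccontr)
  assume "\<not> ?thesis"
  from not_eventually_sequentiallyD[OF this] obtain r where r: "strict_mono (r :: nat \<Rightarrow> nat)"
      "\<And>l. \<exists>c w a. 1 \<le> r l \<and> opt_triple (r l) x c w a \<and> \<not> regular (r l) c w a"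
    by blast
  from r(2) obtain c w a where t: "\<And>l. 1 \<le> r l" "\<And>l. opt_triple (r l) x (c l) (w l) (a l)"
      "\<And>l. \<not> regular (r l) (c l) (w l) (a l)"
    by metis
  obtain \<rho> cs \<delta> where \<rho>: "strict_mono (\<rho> :: nat \<Rightarrow> nat)" "optimal_codebook \<Omega> \<phi> k P h cs"
    "\<forall>j<k. (\<lambda>m. c (\<rho> m) j) \<longlonglongrightarrow> cs j" "0 < \<delta>"
    "\<forall>j<k. \<forall>\<^sub>F m in sequentially. \<delta> * real (r (\<rho> m)) \<le> mass (r (\<rho> m)) (w (\<rho> m)) (a (\<rho> m)) j"
    "(\<lambda>m. distortion (emp (r (\<rho> m)) x) (c (\<rho> m))) \<longlonglongrightarrow> opt_value"
    by (rule compactness[OF x r(1) t(1,2)])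
  have r\<rho>: "filterlim (\<lambda>m. r (\<rho> m)) at_top sequentially"
    using strict_mono_o[OF r(1) \<rho>(1)] by (intro filterlim_subseq) (simp add: comp_def)
  have big: "\<forall>\<^sub>F m in sequentially. 3 \<le> \<delta> * real (r (\<rho> m))"
  proof -
    have "filterlim (\<lambda>m. \<delta> * real (r (\<rho> m))) at_top sequentially"
      using \<rho>(4) by (intro filterlim_tendsto_pos_mult_at_top[OF tendsto_const]
          filterlim_compose[OF filterlim_real_sequentially r\<rho>])
    then show ?thesis by (simp add: filterlim_at_top)
  qed
  have "\<forall>\<^sub>F m in sequentially. \<forall>j\<in>{..<k}. 3 \<le> mass (r (\<rho> m)) (w (\<rho> m)) (a (\<rho> m)) j"
  proof (intro eventually_ball_finite ballI)
    fix j assume "j \<in> {..<k}"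
    then have "\<forall>\<^sub>F m in sequentially. \<delta> * real (r (\<rho> m)) \<le> mass (r (\<rho> m)) (w (\<rho> m)) (a (\<rho> m)) j"
      using \<rho>(5) by simp
    with big show "\<forall>\<^sub>F m in sequentially. 3 \<le> mass (r (\<rho> m)) (w (\<rho> m)) (a (\<rho> m)) j"
      by eventually_elim (rule order_trans)
  qed simp
  moreover have "\<forall>\<^sub>F m in sequentially. \<forall>i\<in>{..<k}. \<forall>j\<in>{..<k}. i \<noteq> j \<longrightarrow> c (\<rho> m) i \<noteq> c (\<rho> m) j"
  proof (intro eventually_ball_finite ballI)
    fix i j assume ij: "i \<in> {..<k}" "j \<in> {..<k}"
    show "\<forall>\<^sub>F m in sequentially. i \<noteq> j \<longrightarrow> c (\<rho> m) i \<noteq> c (\<rho> m) j"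
    proof (cases "i = j")
      case False
      then have "cs i - cs j \<noteq> 0" using optimal_codebook_inj[OF \<rho>(2)] ij by (auto simp: inj_on_def)
      moreover have "(\<lambda>m. c (\<rho> m) i - c (\<rho> m) j) \<longlonglongrightarrow> cs i - cs j" using ij \<rho>(3) by (intro tendsto_diff) auto
      ultimately have "\<forall>\<^sub>F m in sequentially. c (\<rho> m) i - c (\<rho> m) j \<noteq> 0" by (rule tendsto_imp_eventually_ne[rotated])
      then show ?thesis by eventually_elim auto
    qed auto
  qed auto
  ultimately have "\<forall>\<^sub>F m in sequentially. regular (r (\<rho> m)) (c (\<rho> m)) (w (\<rho> m)) (a (\<rho> m))"
    by eventually_elim (auto simp: regular_def inj_on_def)
  then obtain m where "regular (r (\<rho> m)) (c (\<rho> m)) (w (\<rho> m)) (a (\<rho> m))"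
    by (auto simp: eventually_sequentially)
  then show False using t(3) by blast
qed

text \<open>Take a point of the cell that has full weight in the first configuration and weight 0 or
  1 in the second. Weight 0 would make its score vanish, against \<open>tie_free\<close>; with
  weight 1, equal scores give equal gradients at the two centroids, hence equal codepoints.\<close>

lemma opt_triples_subset:
  assumes n: "1 \<le> n" and x: "\<forall>i<n. x i \<in> interior \<Omega>" and tf: "tie_free x"
    and opt: "opt_triple n x c w a" "(w, a) \<in> confs n" "regular n c w a"
    and opt': "opt_triple n x c' w' a'" "(w', a') \<in> confs n" "regular n c' w' a'"
  shows "c ` {..<k} \<subseteq> c' ` {..<k}"
proof
  have "cost n x w a = cost n x w' a'"
    using opt_triple_min_conf[OF n x opt(1,2)] opt_triple_min_conf[OF n x opt'(1,2)] opt(2) opt'(2)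
    by (intro antisym) (auto simp: min_conf_def)
  then have score: "score n x w a i = score n x w' a' i" if "i < n" for i
    using tf opt(2) opt'(2) that unfolding tie_free_def by blast
  note wa = confsD[OF opt(2)] note wa' = confsD[OF opt'(2)]
  have cent_eq: "c j = cent n x w a j \<and> cent n x w a j \<in> interior \<Omega>" if "j < k" for j
    using opt_triple_mean(1)[OF n x opt(1) that] cent_in[OF convex_interior_domain x, of w a j] wa opt(3) that
    by (force simp: regular_def)
  have cent_eq': "c' j = cent n x w' a' j \<and> cent n x w' a' j \<in> interior \<Omega>" if "j < k" for j
    using opt_triple_mean(1)[OF n x opt'(1) that] cent_in[OF convex_interior_domain x, of w' a' j] wa' opt'(3) that
    by (force simp: regular_def)
  have inj: "u = v" if "u \<in> interior \<Omega>" "v \<in> interior \<Omega>" "gradI u = gradI v" for u v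
    using inj_on_grad that interior_subset unfolding gradI_def inj_on_def by (metis subsetD)
  fix z assume "z \<in> c ` {..<k}"
  then obtain j where j: "j < k" "z = c j" by auto
  define C where "C = {i \<in> {..<n}. a i = j \<and> 0 < w i}"
  have finC: "finite C" by (simp add: C_def)
  have "mass n w a j = (\<Sum>i\<in>C. w i)"
    unfolding mass_def C_def using wa(1) by (intro sum.mono_neutral_right) (auto simp: le_less)
  also have "\<dots> \<le> (\<Sum>i\<in>C. 1)" using wa(1) by (intro sum_mono) (auto simp: C_def)
  finally have card: "3 \<le> card C" using opt(3) j by (fastforce simp: regular_def)
  obtain i0 where i0: "\<forall>i<n. i \<noteq> i0 \<longrightarrow> w i = 0 \<or> w i = 1" using wa(4) by blast
  obtain i0' where i0': "\<forall>i<n. i \<noteq> i0' \<longrightarrow> w' i = 0 \<or> w' i = 1" using wa'(4) by blast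
  have "C - {i0, i0'} \<noteq> {}"
  proof
    assume "C - {i0, i0'} = {}"
    then have "card C \<le> card {i0, i0'}" by (intro card_mono) auto
    also have "\<dots> \<le> 2" by (simp add: card_insert_if)
    finally show False using card by simp
  qed
  then obtain i where i: "i < n" "a i = j" "0 < w i" "i \<noteq> i0" "i \<noteq> i0'" by (auto simp: C_def)
  have w1: "w i = 1" using i i0 by force
  have "w' i \<noteq> 0"
  proof
    assume "w' i = 0"
    then have "gradI (x i) = gradI (cent n x w a (a i))" using score[OF i(1)] w1 by (simp add: score_def)
    then have "x i = cent n x w a (a i)" using inj x cent_eq i j by blast
    moreover have "\<exists>l\<in>C. l \<noteq> i"
    proof (rule ccontr)
      assume "\<not> (\<exists>l\<in>C. l \<noteq> i)"
      then have "card C \<le> card {i}" by (intro card_mono) auto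
      then show False using card by simp
    qed
    then obtain l where "l < n" "a l = j" "0 < w l" "l \<noteq> i" by (auto simp: C_def)
    ultimately show False using tf opt(2) i unfolding tie_free_def by fast
  qed
  then have w1': "w' i = 1" using i i0' by blast
  have a': "a' i < k" using wa'(2) i by blast
  have "gradI (cent n x w a j) = gradI (cent n x w' a' (a' i))"
    using score[OF i(1)] w1 w1' i by (simp add: score_def)
  then have "c j = c' (a' i)" using inj cent_eq[OF j(1)] cent_eq'[OF a'] by metis
  then show "z \<in> c' ` {..<k}" using j a' by auto
qed

lemma opt_triples_unique:
  assumes n: "1 \<le> n" and x: "\<forall>i<n. x i \<in> interior \<Omega>" and tf: "tie_free x"
    and opt: "opt_triple n x c w a" "(w, a) \<in> confs n" "regular n c w a"
    and opt': "opt_triple n x c' w' a'" "(w', a') \<in> confs n" "regular n c' w' a'"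
  obtains \<sigma> where "\<sigma> permutes {..<k}" "\<And>j. j < k \<Longrightarrow> c j = c' (\<sigma> j)"
proof -
  have sub: "c ` {..<k} \<subseteq> c' ` {..<k}" by (rule opt_triples_subset[OF n x tf opt opt'])
  have inj: "inj_on c {..<k}" "inj_on c' {..<k}" using opt(3) opt'(3) by (simp_all add: regular_def)
  define \<sigma> where "\<sigma> j = (if j < k then inv_into {..<k} c' (c j) else j)" for j
  have \<sigma>: "\<sigma> j < k \<and> c' (\<sigma> j) = c j" if "j < k" for j
  proof -
    have "c j \<in> c' ` {..<k}" using sub that by auto
    then show ?thesis using inv_into_into[of "c j" c' "{..<k}"] f_inv_into_f[of "c j" c' "{..<k}"] that
      by (simp add: \<sigma>_def)
  qed
  have "inj_on \<sigma> {..<k}" using inj(1) \<sigma> by (metis inj_on_def lessThan_iff)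
  moreover have "\<sigma> ` {..<k} \<subseteq> {..<k}" using \<sigma> by auto
  ultimately have "bij_betw \<sigma> {..<k} {..<k}" by (simp add: bij_betw_def endo_inj_surj)
  then have "\<sigma> permutes {..<k}" by (rule bij_imp_permutes) (simp add: \<sigma>_def)
  then show ?thesis using that \<sigma> by metis
qed

end

section \<open>Recurrent codebooks\<close>

lemma block_swap_block_swap [simp]: "block_swap m (block_swap m i) = i"
  by (auto simp: block_swap_def)

lemma block_swap_permutes:
  assumes "2 * m \<le> n"
  shows "block_swap m permutes {..<n}"
  unfolding permutes_def
proof (intro conjI allI impI)
  fix y show "\<exists>!i. block_swap m i = y"
    by (rule ex1I[of _ "block_swap m y"]) auto
qed (use assms in \<open>auto simp: block_swap_def\<close>)

text \<open>Only subsequences with \<open>1 \<le> r l\<close> are tested, since nothing is assumed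
  for the empty sample.\<close>

lemma tendsto_by_subsequences:
  fixes f :: "nat \<Rightarrow> real"
  assumes "\<And>r. strict_mono (r :: nat \<Rightarrow> nat) \<Longrightarrow> (\<And>l. 1 \<le> r l) \<Longrightarrow>
    \<exists>\<rho>. strict_mono (\<rho> :: nat \<Rightarrow> nat) \<and> (\<lambda>m. f (r (\<rho> m))) \<longlonglongrightarrow> y"
  shows "f \<longlonglongrightarrow> y"
proof (rule ccontr)
  assume "\<not> f \<longlonglongrightarrow> y"
  then obtain e where e: "0 < e" "\<not> (\<forall>\<^sub>F n in sequentially. dist (f n) y < e)" by (auto simp: tendsto_iff)
  have "\<not> (\<forall>\<^sub>F n in sequentially. 1 \<le> n \<longrightarrow> dist (f n) y < e)"
  proof
    assume "\<forall>\<^sub>F n in sequentially. 1 \<le> n \<longrightarrow> dist (f n) y < e"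
    with eventually_ge_at_top[of "1::nat"] have "\<forall>\<^sub>F n in sequentially. dist (f n) y < e"
      by eventually_elim simp
    with e(2) show False ..
  qed
  from not_eventually_sequentiallyD[OF this] obtain r where r: "strict_mono (r :: nat \<Rightarrow> nat)"
    "\<And>l. 1 \<le> r l" "\<And>l. \<not> dist (f (r l)) y < e" by blast
  obtain \<rho> where "strict_mono (\<rho> :: nat \<Rightarrow> nat)" "(\<lambda>m. f (r (\<rho> m))) \<longlonglongrightarrow> y" using assms[OF r(1,2)] by blast
  then have "\<forall>\<^sub>F m in sequentially. dist (f (r (\<rho> m))) y < e" using e(1) by (simp add: tendsto_iff)
  then show False using r(3) by (auto simp: eventually_sequentially)
qed

lemma codebook_dist_le:
  assumes "1 \<le> k" "\<sigma> permutes {..<k}" "\<And>j. j < k \<Longrightarrow> dist (c j) (c' (\<sigma> j)) \<le> e"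
  shows "codebook_dist k c c' \<le> e"
proof -
  have "codebook_dist k c c' \<le> Max ((\<lambda>i. norm (c i - c' (\<sigma> i))) ` {..<k})"
    unfolding codebook_dist_def using assms(2) by (intro Min_le) (auto intro: finite_permutations)
  also have "\<dots> \<le> e"
    using assms(1,3) by (intro Max.boundedI) (auto simp: dist_norm lessThan_empty_iff)
  finally show ?thesis .
qed

lemma codebook_dist_nonneg:
  assumes "1 \<le> k"
  shows "0 \<le> codebook_dist k c c'"
proof -
  have "0 \<le> Max ((\<lambda>i. norm (c i - c' (\<sigma> i))) ` {..<k})" for \<sigma>
    using assms by (intro order_trans[OF norm_ge_zero Max_ge[of _ "norm (c 0 - c' (\<sigma> 0))"]]) auto
  moreover have "finite {\<sigma>. \<sigma> permutes {..<k}}" "{\<sigma>. \<sigma> permutes {..<k}} \<noteq> {}"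
    using permutes_id[of "{..<k}"] by (auto intro: finite_permutations simp del: permutes_id)
  ultimately show ?thesis unfolding codebook_dist_def by (subst Min_ge_iff) auto
qed

context trimming
begin

section \<open>Compatibility of minimal configurations with permutations of the sample\<close>

lemma confs_permute:
  assumes conf: "(w, a) \<in> confs n" and \<pi>: "\<pi> permutes {..<n}"
  shows "(restrict (w \<circ> \<pi>) {..<n}, restrict (a \<circ> \<pi>) {..<n}) \<in> confs n"
proof -
  have \<pi>n: "\<pi> i < n" if "i < n" for i using permutes_in_image[OF \<pi>, of i] that by simp
  have "(\<Sum>i<n. restrict (w \<circ> \<pi>) {..<n} i) = (\<Sum>i<n. w i)"
    by (simp add: sum.permute[OF \<pi>, of w])
  moreover obtain i0 where i0: "\<forall>i<n. i \<noteq> i0 \<longrightarrow> w i = 0 \<or> w i = 1" using confsD(4)[OF conf] by blast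
  have "\<forall>i<n. i \<noteq> inv \<pi> i0 \<longrightarrow> restrict (w \<circ> \<pi>) {..<n} i = 0 \<or> restrict (w \<circ> \<pi>) {..<n} i = 1"
    using i0 \<pi>n permutes_inverses(2)[OF \<pi>] by (metis comp_apply lessThan_iff restrict_apply')
  ultimately show ?thesis using conf \<pi>n unfolding confs_def by (auto simp: PiE_iff)
qed

lemma sum_cell_permute:
  fixes f :: "nat \<Rightarrow> 'b::comm_monoid_add"
  assumes \<pi>: "\<pi> permutes {..<n}" and g: "\<And>i. i < n \<Longrightarrow> g i = f (\<pi> i)"
  shows "(\<Sum>i\<in>{i\<in>{..<n}. restrict (a \<circ> \<pi>) {..<n} i = j}. g i) = (\<Sum>i\<in>{i\<in>{..<n}. a i = j}. f i)"
proof -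
  have "(\<Sum>i\<in>{i\<in>{..<n}. a i = j}. f i) = (\<Sum>i<n. if a i = j then f i else 0)"
    by (rule sum.inter_filter) simp
  also have "\<dots> = (\<Sum>i<n. if a (\<pi> i) = j then f (\<pi> i) else 0)"
    by (subst sum.permute[OF \<pi>]) (simp add: comp_def)
  also have "\<dots> = (\<Sum>i<n. if restrict (a \<circ> \<pi>) {..<n} i = j then g i else 0)"
    using g by (intro sum.cong) auto
  also have "\<dots> = (\<Sum>i\<in>{i\<in>{..<n}. restrict (a \<circ> \<pi>) {..<n} i = j}. g i)"
    by (rule sum.inter_filter[symmetric]) simp
  finally show ?thesis by simp
qed

lemma mass_permute:
  assumes "\<pi> permutes {..<n}"
  shows "mass n (restrict (w \<circ> \<pi>) {..<n}) (restrict (a \<circ> \<pi>) {..<n}) j = mass n w a j"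
  unfolding mass_def by (rule sum_cell_permute[OF assms]) simp

lemma cent_permute:
  assumes "\<pi> permutes {..<n}"
  shows "cent n (x \<circ> \<pi>) (restrict (w \<circ> \<pi>) {..<n}) (restrict (a \<circ> \<pi>) {..<n}) j = cent n x w a j"
  unfolding cent_def mass_permute[OF assms]
  using sum_cell_permute[OF assms, of "\<lambda>i. restrict (w \<circ> \<pi>) {..<n} i *\<^sub>R (x \<circ> \<pi>) i" "\<lambda>i. w i *\<^sub>R x i" a j]
  by simp

lemma cost_permute:
  assumes "\<pi> permutes {..<n}"
  shows "cost n (x \<circ> \<pi>) (restrict (w \<circ> \<pi>) {..<n}) (restrict (a \<circ> \<pi>) {..<n}) = cost n x w a"
  unfolding cost_def mass_permute[OF assms] cent_permute[OF assms]
  by (simp add: sum.permute[OF assms, of "\<lambda>i. w i * phiI (x i)"])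

lemma min_conf_permute:
  assumes \<pi>: "\<pi> permutes {..<n}" and min: "min_conf n x w a"
  shows "min_conf n (x \<circ> \<pi>) (restrict (w \<circ> \<pi>) {..<n}) (restrict (a \<circ> \<pi>) {..<n})"
  unfolding min_conf_def
proof (intro conjI ballI, goal_cases)
  case 1
  show ?case using min by (intro confs_permute \<pi>) (simp add: min_conf_def)
next
  case (2 p)
  obtain w1 a1 where p: "p = (w1, a1)" by (cases p)
  with 2 have conf: "(w1, a1) \<in> confs n" by simp
  \<comment> \<open>A competitor for the permuted sample is pulled back by the inverse permutation;
    \<open>restrict\<close> keeps it extensional.\<close>
  define w2 where "w2 = restrict (w1 \<circ> inv \<pi>) {..<n}"
  define a2 where "a2 = restrict (a1 \<circ> inv \<pi>) {..<n}"
  have conf2: "(w2, a2) \<in> confs n"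
    unfolding w2_def a2_def by (rule confs_permute[OF conf permutes_inv[OF \<pi>]])
  have \<pi>n: "\<pi> i < n" if "i < n" for i using permutes_in_image[OF \<pi>, of i] that by simp
  have round_trip: "restrict (restrict (f \<circ> inv \<pi>) {..<n} \<circ> \<pi>) {..<n} = f" if "f \<in> extensional {..<n}"
    for f :: "nat \<Rightarrow> 'b"
  proof
    fix i show "restrict (restrict (f \<circ> inv \<pi>) {..<n} \<circ> \<pi>) {..<n} i = f i"
      using \<pi>n[of i] permutes_inverses(2)[OF \<pi>] that by (cases "i < n") (auto simp: extensional_def)
  qed
  have "w1 \<in> extensional {..<n}" "a1 \<in> extensional {..<n}" using conf by (auto simp: confs_def PiE_iff)
  then have "cost n (x \<circ> \<pi>) w1 a1 = cost n x w2 a2"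
    using cost_permute[OF \<pi>, of x w2 a2] by (simp add: w2_def a2_def round_trip)
  moreover have "cost n x w a \<le> cost n x w2 a2" using min conf2 by (auto simp: min_conf_def)
  ultimately show ?case using p cost_permute[OF \<pi>, of x w a] by simp
qed

lemma min_conf_exists:
  assumes n: "1 \<le> n" and x: "\<forall>i<n. x i \<in> interior \<Omega>"
  obtains w a where "min_conf n x w a"
proof -
  let ?f = "\<lambda>(w, a). cost n x w a"
  obtain z where "z \<in> interior \<Omega>" using interior_nonempty by auto
  then have "restrict (\<lambda>_. z) {..<k} \<in> codebooks \<Omega> k" using interior_subset by (auto simp: codebooks_def)
  then have "confs n \<noteq> {}" using confs_exist[OF n x] by blast
  then have "Min (?f ` confs n) \<in> ?f ` confs n" by (intro Min_in) (auto simp: finite_confs)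
  then obtain p where p: "p \<in> confs n" "Min (?f ` confs n) = ?f p" by auto
  have "?f p \<le> ?f p'" if "p' \<in> confs n" for p'
    unfolding p(2)[symmetric] using that by (intro Min_le) (auto simp: finite_confs)
  then show ?thesis using that[of "fst p" "snd p"] p(1) by (auto simp: min_conf_def case_prod_beta)
qed

end

context sampling
begin

text \<open>Stated for some minimal configuration instead of for \<open>c_hat\<close>: this makes it
  a measurable event, invariant under permutations of the first \<open>n\<close> points.\<close>

definition near :: "nat \<Rightarrow> (nat \<Rightarrow> 'a) \<Rightarrow> real \<Rightarrow> (nat \<Rightarrow> 'a) \<Rightarrow> bool" where
  "near n q \<rho> x \<longleftrightarrow> (\<exists>w a. min_conf n x w a \<and> (\<forall>j<k. dist (cent n x w a j) (q j) < \<rho>))"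

definition near_io :: "(nat \<Rightarrow> 'a) \<Rightarrow> real \<Rightarrow> (nat \<Rightarrow> 'a) set" where
  "near_io q \<rho> = {x \<in> space samples. \<forall>N. \<exists>n. N \<le> n \<and> near n q \<rho> x}"

lemma sets_near: "{x \<in> space samples. near n q \<rho> x} \<in> sets samples"
proof -
  have "{x \<in> space samples. \<exists>p\<in>confs n. (\<forall>p'\<in>confs n. cost n x (fst p) (snd p) \<le> cost n x (fst p') (snd p')) \<and>
      (\<forall>j\<in>{..<k}. dist (cent n x (fst p) (snd p) j) (q j) < \<rho>)} \<in> sets samples"
    by (intro sets.sets_Collect_finite_Ex sets.sets_Collect_conj sets.sets_Collect_finite_All finite_confs
        finite_lessThan borel_measurable_le borel_measurable_less borel_measurable_cost borel_measurable_dist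
        borel_measurable_cent borel_measurable_const)
  moreover have "near n q \<rho> x \<longleftrightarrow>
      (\<exists>p\<in>confs n. (\<forall>p'\<in>confs n. cost n x (fst p) (snd p) \<le> cost n x (fst p') (snd p')) \<and>
      (\<forall>j\<in>{..<k}. dist (cent n x (fst p) (snd p) j) (q j) < \<rho>))" for x
    unfolding near_def min_conf_def by (simp add: Bex_def Ball_def case_prod_beta split_paired_Ex split_paired_All)
  ultimately show ?thesis by simp
qed

lemma sets_near_io: "near_io q \<rho> \<in> sets samples"
  unfolding near_io_def
  by (intro sets.sets_Collect_countable_All sets.sets_Collect_countable_Ex sets.sets_Collect_conj
      sets.sets_Collect_const sets_near)

lemma near_permute:
  assumes "\<pi> permutes {..<n}" "near n q \<rho> x"
  shows "near n q \<rho> (\<lambda>i. x (\<pi> i))"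
proof -
  obtain w a where wa: "min_conf n x w a" "\<forall>j<k. dist (cent n x w a j) (q j) < \<rho>"
    using assms(2) by (auto simp: near_def)
  then have "near n q \<rho> (x \<circ> \<pi>)"
    unfolding near_def
    by (intro exI[of _ "restrict (w \<circ> \<pi>) {..<n}"] exI[of _ "restrict (a \<circ> \<pi>) {..<n}"])
      (simp add: min_conf_permute[OF assms(1)] cent_permute[OF assms(1)])
  then show ?thesis by (simp add: comp_def)
qed

text \<open>\<open>block_swap m\<close> permutes the first \<open>n\<close> indices as soon as
  \<open>2 * m \<le> n\<close>, and smaller \<open>n\<close> do not affect visits infinitely
  often.\<close>

lemma near_io_block_swap: "(\<lambda>i. x (block_swap m i)) \<in> near_io q \<rho> \<longleftrightarrow> x \<in> near_io q \<rho>"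
proof -
  have "(\<lambda>i. y (block_swap m i)) \<in> near_io q \<rho>" if y: "y \<in> near_io q \<rho>" for y
    unfolding near_io_def space_samples
  proof (clarsimp)
    fix N
    obtain n where n: "max N (2 * m) \<le> n" "near n q \<rho> y" using y unfolding near_io_def by blast
    then have "near n q \<rho> (\<lambda>i. y (block_swap m i))"
      by (intro near_permute[OF block_swap_permutes]) simp_all
    then show "\<exists>n\<ge>N. near n q \<rho> (\<lambda>i. y (block_swap m i))" using n(1) by (intro exI[of _ n]) simp
  qed
  note * = this
  show ?thesis
  proof
    assume "(\<lambda>i. x (block_swap m i)) \<in> near_io q \<rho>"
    from *[OF this] show "x \<in> near_io q \<rho>" by simp
  qed (rule *)
qed

lemma near_io_0_1:
  "(AE x in samples. x \<in> near_io q \<rho>) \<or> (AE x in samples. x \<notin> near_io q \<rho>)"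
proof -
  interpret S: prob_space samples by (rule prob_space_samples)
  have "S.prob (near_io q \<rho>) = 0 \<or> S.prob (near_io q \<rho>) = 1"
    by (rule hewitt_savage[OF prob_P space_P sets_near_io near_io_block_swap])
  then show ?thesis
  proof
    assume "S.prob (near_io q \<rho>) = 1"
    then show ?thesis using S.prob_eq_1[OF sets_near_io] by blast
  next
    assume "S.prob (near_io q \<rho>) = 0"
    then show ?thesis using S.prob_eq_0[OF sets_near_io] by blast
  qed
qed

text \<open>Fills the cells without mass when a minimal configuration is turned into a
  codebook.\<close>

definition base_codebook :: "nat \<Rightarrow> 'a" where "base_codebook = (SOME c. c \<in> codebooks \<Omega> k)"

lemma base_codebook: "base_codebook \<in> codebooks \<Omega> k"
  unfolding base_codebook_def using codebooks_nonempty some_in_eq by blast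

lemma recenter_eq_cent: "j < k \<Longrightarrow> 0 < mass n w a j \<Longrightarrow> recenter n x w a c j = cent n x w a j"
  by (simp add: recenter_def)

lemma good_interior: "good x \<Longrightarrow> \<forall>i<n. x i \<in> interior \<Omega>"
  using hullP by (auto simp: good_def)

text \<open>Passes from codepoints to centroids, which agree once the masses are positive.\<close>

lemma compactness_min_conf:
  assumes x: "good x" and r: "strict_mono r" "\<And>l. 1 \<le> r l" and min: "\<And>l. min_conf (r l) x (w l) (a l)"
  obtains \<rho> cs where "strict_mono (\<rho> :: nat \<Rightarrow> nat)" "optimal_codebook \<Omega> \<phi> k P h cs"
    "\<forall>j<k. (\<lambda>m. cent (r (\<rho> m)) x (w (\<rho> m)) (a (\<rho> m)) j) \<longlonglongrightarrow> cs j"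
proof -
  define c where "c l = recenter (r l) x (w l) (a l) base_codebook" for l
  have opt: "opt_triple (r l) x (c l) (w l) (a l)" for l
    unfolding c_def by (rule min_conf_opt_triple[OF r(2) good_interior[OF x] min base_codebook])
  obtain \<rho> cs \<delta> where \<rho>: "strict_mono (\<rho> :: nat \<Rightarrow> nat)" "optimal_codebook \<Omega> \<phi> k P h cs"
    "\<forall>j<k. (\<lambda>m. c (\<rho> m) j) \<longlonglongrightarrow> cs j" "0 < \<delta>"
    "\<forall>j<k. \<forall>\<^sub>F m in sequentially. \<delta> * real (r (\<rho> m)) \<le> mass (r (\<rho> m)) (w (\<rho> m)) (a (\<rho> m)) j"
    "(\<lambda>m. distortion (emp (r (\<rho> m)) x) (c (\<rho> m))) \<longlonglongrightarrow> opt_value"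
    by (rule compactness[OF x r opt])
  have "(\<lambda>m. cent (r (\<rho> m)) x (w (\<rho> m)) (a (\<rho> m)) j) \<longlonglongrightarrow> cs j" if j: "j < k" for j
  proof (rule Lim_transform_eventually)
    show "(\<lambda>m. c (\<rho> m) j) \<longlonglongrightarrow> cs j" using \<rho>(3) j by blast
    have "\<forall>\<^sub>F m in sequentially. \<delta> * real (r (\<rho> m)) \<le> mass (r (\<rho> m)) (w (\<rho> m)) (a (\<rho> m)) j" using \<rho>(5) j by blast
    then show "\<forall>\<^sub>F m in sequentially. c (\<rho> m) j = cent (r (\<rho> m)) x (w (\<rho> m)) (a (\<rho> m)) j"
    proof eventually_elim
      case (elim m)
      have "0 < \<delta> * real (r (\<rho> m))" using \<rho>(4) r(2)[of "\<rho> m"] by simp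
      then show ?case using elim j unfolding c_def by (intro recenter_eq_cent) auto
    qed
  qed
  then show ?thesis using that \<rho>(1,2) by blast
qed

text \<open>Otherwise every codebook has a neighbourhood that is almost surely visited only finitely often by
  the empirical optima. Countably many of these neighbourhoods cover the space of codebooks, which
  contradicts compactness.\<close>

lemma recurrent_codebook_exists: "\<exists>q. \<forall>\<rho>>0. AE x in samples. x \<in> near_io q \<rho>"
proof (rule ccontr)
  assume "\<not> ?thesis"
  then have "\<forall>q. \<exists>\<rho>. 0 < \<rho> \<and> (AE x in samples. x \<notin> near_io q \<rho>)" using near_io_0_1 by blast
  then obtain e where e: "\<And>q. 0 < e q" "\<And>q. AE x in samples. x \<notin> near_io q (e q)" by metis
  \<comment> \<open>Open in the product topology on sequences, which is second countable; only the
    first \<open>k\<close> entries are constrained.\<close>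
  define U where "U q = (\<Inter>j\<in>{..<k}. (\<lambda>c. c j) -` ball (q j) (e q))" for q :: "nat \<Rightarrow> 'a"
  have U_open: "open (U q)" for q
    unfolding U_def by (intro open_INT ballI open_vimage) auto
  have "\<And>S. S \<in> range U \<Longrightarrow> open S" using U_open by (elim rangeE) simp
  then obtain F' where F': "F' \<subseteq> range U" "countable F'" "\<Union>F' = \<Union>(range U)"
    by (rule Lindelof)
  then have "\<exists>Q. countable Q \<and> Q \<subseteq> UNIV \<and> F' = U ` Q" 
    using countable_subset_image[of F' U UNIV] by blast
  then obtain Q where Q: "countable Q" "F' = U ` Q" by blast
  have cover: "\<exists>q\<in>Q. c \<in> U q" for c
  proof -
    have "c \<in> U c" using e(1) by (simp add: U_def)
    then have "c \<in> \<Union>F'" using F'(3) by blast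
    then show ?thesis using Q by blast
  qed
  have "AE x in samples. \<forall>q\<in>Q. x \<notin> near_io q (e q)" using Q(1) e(2) by (simp add: AE_ball_countable)
  then have "AE x in samples. False"
    using AE_good
  proof eventually_elim
    case (elim x)
    have "\<exists>w a. min_conf (Suc l) x w a" for l
      using min_conf_exists[of "Suc l" x] good_interior[OF elim(2)] by (metis le_add1 plus_1_eq_Suc)
    then obtain w a where min: "\<And>l. min_conf (Suc l) x (w l) (a l)" by metis
    have "strict_mono Suc" by (simp add: strict_mono_def)
    moreover have "\<And>l. 1 \<le> Suc l" by simp
    ultimately obtain \<rho> cs where \<rho>: "strict_mono (\<rho> :: nat \<Rightarrow> nat)" "optimal_codebook \<Omega> \<phi> k P h cs"
      "\<forall>j<k. (\<lambda>m. cent (Suc (\<rho> m)) x (w (\<rho> m)) (a (\<rho> m)) j) \<longlonglongrightarrow> cs j"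
      by (rule compactness_min_conf[OF elim(2) _ _ min])
    obtain q where q: "q \<in> Q" "cs \<in> U q" using cover by blast
    have "\<forall>\<^sub>F m in sequentially. \<forall>j\<in>{..<k}. dist (cent (Suc (\<rho> m)) x (w (\<rho> m)) (a (\<rho> m)) j) (q j) < e q"
    proof (intro eventually_ball_finite ballI)
      fix j assume j: "j \<in> {..<k}"
      have "(\<lambda>m. dist (cent (Suc (\<rho> m)) x (w (\<rho> m)) (a (\<rho> m)) j) (q j)) \<longlonglongrightarrow> dist (cs j) (q j)"
        using \<rho>(3) j by (intro tendsto_dist tendsto_const) auto
      moreover have "dist (cs j) (q j) < e q" using q(2) j by (auto simp: U_def dist_commute)
      ultimately show "\<forall>\<^sub>F m in sequentially. dist (cent (Suc (\<rho> m)) x (w (\<rho> m)) (a (\<rho> m)) j) (q j) < e q"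
        by (rule order_tendstoD(2))
    qed simp
    then obtain m0 where m0: "\<And>m. m0 \<le> m \<Longrightarrow> near (Suc (\<rho> m)) q (e q) x"
      unfolding eventually_sequentially near_def using min by blast
    have "x \<in> near_io q (e q)"
      unfolding near_io_def space_samples
    proof clarsimp
      fix N
      have "N \<le> Suc (\<rho> (max N m0))" using seq_suble[OF \<rho>(1), of "max N m0"] by simp
      then show "\<exists>n\<ge>N. near n q (e q) x" using m0[of "max N m0"] by auto
    qed
    then show ?case using elim(1) q(1) by blast
  qed
  then show False using prob_space.AE_contr[OF prob_space_samples, of "\<lambda>_. False"] by simp
qed

lemma near_subsequence:
  assumes "\<forall>l. x \<in> near_io q (1 / real (Suc l))"
  obtains r where "strict_mono (r :: nat \<Rightarrow> nat)" "\<And>l. N \<le> r l" "\<And>l. near (r l) q (1 / real (Suc l)) x"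
proof -
  have ex: "\<exists>n\<ge>N'. near n q (1 / real (Suc l)) x" for N' l
    using assms unfolding near_io_def by blast
  have "\<exists>r. \<forall>l. (N \<le> r l \<and> near (r l) q (1 / real (Suc l)) x) \<and> r l < r (Suc l)"
  proof (rule dependent_nat_choice)
    show "\<exists>n. N \<le> n \<and> near n q (1 / real (Suc 0)) x" using ex by blast
    fix n l :: nat
    obtain n' where "max N (Suc n) \<le> n'" "near n' q (1 / real (Suc (Suc l))) x" using ex by blast
    then show "\<exists>n'. (N \<le> n' \<and> near n' q (1 / real (Suc (Suc l))) x) \<and> n < n'" by auto
  qed
  then show ?thesis using that by (auto simp: strict_mono_Suc_iff)
qed

text \<open>The visiting centroids converge to \<open>q\<close> by the shrinking radii, and a
  subsequence of them has an optimal limit by compactness.\<close>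

lemma recurrent_codebook_optimal:
  assumes x: "good x" and q: "\<forall>l. x \<in> near_io q (1 / real (Suc l))"
  shows "optimal_codebook \<Omega> \<phi> k P h (restrict q {..<k})"
proof -
  obtain r where r: "strict_mono (r :: nat \<Rightarrow> nat)" "\<And>l. 1 \<le> r l" "\<And>l. near (r l) q (1 / real (Suc l)) x"
    using near_subsequence[OF q] by blast
  from r(3) obtain w a where wa: "\<And>l. min_conf (r l) x (w l) (a l)"
      "\<And>l j. j < k \<Longrightarrow> dist (cent (r l) x (w l) (a l) j) (q j) < 1 / real (Suc l)"
    unfolding near_def by metis
  obtain \<rho> cs where \<rho>: "strict_mono (\<rho> :: nat \<Rightarrow> nat)" "optimal_codebook \<Omega> \<phi> k P h cs"
    "\<forall>j<k. (\<lambda>m. cent (r (\<rho> m)) x (w (\<rho> m)) (a (\<rho> m)) j) \<longlonglongrightarrow> cs j"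
    by (rule compactness_min_conf[OF x r(1,2) wa(1)])
  have "cs j = q j" if j: "j < k" for j
  proof (rule LIMSEQ_unique)
    show "(\<lambda>m. cent (r (\<rho> m)) x (w (\<rho> m)) (a (\<rho> m)) j) \<longlonglongrightarrow> cs j" using \<rho>(3) j by blast
    have null: "(\<lambda>m. 1 / real (Suc (\<rho> m))) \<longlonglongrightarrow> 0"
      using LIMSEQ_subseq_LIMSEQ[OF LIMSEQ_inverse_real_of_nat \<rho>(1)] by (simp add: comp_def inverse_eq_divide)
    have "(\<lambda>m. dist (cent (r (\<rho> m)) x (w (\<rho> m)) (a (\<rho> m)) j) (q j)) \<longlonglongrightarrow> 0"
    proof (rule tendsto_sandwich[OF _ _ tendsto_const null])
      show "\<forall>\<^sub>F m in sequentially. dist (cent (r (\<rho> m)) x (w (\<rho> m)) (a (\<rho> m)) j) (q j) \<le> 1 / real (Suc (\<rho> m))"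
        by (intro always_eventually allI less_imp_le wa(2) j)
    qed simp
    then show "(\<lambda>m. cent (r (\<rho> m)) x (w (\<rho> m)) (a (\<rho> m)) j) \<longlonglongrightarrow> q j"
      by (rule tendsto_dist_iff[THEN iffD2])
  qed
  note eq = this
  have cs: "cs \<in> {..<k} \<rightarrow>\<^sub>E \<Omega>" using \<rho>(2) by (simp add: optimal_codebook_iff codebooks_def)
  \<comment> \<open>Both functions are \<open>undefined\<close> outside \<open>{..<k}\<close>, so
    agreement on the codepoints is equality.\<close>
  have ext: "cs i = undefined" if "\<not> i < k" for i
    by (rule PiE_arb[OF cs]) (use that in simp)
  have "restrict q {..<k} = cs"
  proof
    fix i show "restrict q {..<k} i = cs i" 
      by (cases "i < k") (simp_all add: eq ext)
  qed
  then show ?thesis using \<rho>(2) by simp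
qed

text \<open>A visit concerns some minimal configuration, not the given optimum \<open>c n\<close>.
  For large \<open>n\<close> both are regular, and \<open>opt_triples_unique\<close> makes them
  relabellings of each other, which \<open>codebook_dist\<close> does not see.\<close>

lemma recurrent_codebook_subsequence:
  assumes x: "good x" "tie_free x" and q: "\<forall>l. x \<in> near_io q (1 / real (Suc l))"
    and c: "\<And>n. 1 \<le> n \<Longrightarrow> optimal_codebook \<Omega> \<phi> k (emp n x) h (c n)"
  shows "\<exists>r. strict_mono r \<and> (\<lambda>l. codebook_dist k (c (r l)) (restrict q {..<k})) \<longlonglongrightarrow> 0"
proof -
  obtain N where N: "\<And>n c w a. N \<le> n \<Longrightarrow> 1 \<le> n \<Longrightarrow> opt_triple n x c w a \<Longrightarrow> regular n c w a"
    using eventually_regular[OF x(1)] unfolding eventually_sequentially by blast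
  obtain r where r: "strict_mono (r :: nat \<Rightarrow> nat)" "\<And>l. max 1 N \<le> r l" "\<And>l. near (r l) q (1 / real (Suc l)) x"
    using near_subsequence[OF q] by blast
  have "codebook_dist k (c (r l)) (restrict q {..<k}) \<le> 1 / real (Suc l)" for l
  proof -
    have n: "1 \<le> r l" "N \<le> r l" using r(2)[of l] by auto
    note xI = good_interior[OF x(1), of "r l"]
    obtain w a where wa: "(w, a) \<in> confs (r l)" "opt_triple (r l) x (c (r l)) w a"
      by (rule optimal_opt_triple[OF n(1) xI c[OF n(1)]])
    obtain w' a' where wa': "min_conf (r l) x w' a'" "\<forall>j<k. dist (cent (r l) x w' a' j) (q j) < 1 / real (Suc l)"
      using r(3)[of l] by (auto simp: near_def)
    define c' where "c' = recenter (r l) x w' a' base_codebook"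
    have opt': "opt_triple (r l) x c' w' a'"
      unfolding c'_def by (rule min_conf_opt_triple[OF n(1) xI wa'(1) base_codebook])
    note reg' = N[OF n(2,1) opt']
    have c'_cent: "c' j = cent (r l) x w' a' j" if "j < k" for j
      using reg' that unfolding c'_def regular_def by (intro recenter_eq_cent) force+
    have "(w', a') \<in> confs (r l)" using wa'(1) by (simp add: min_conf_def)
    then obtain \<sigma> where \<sigma>: "\<sigma> permutes {..<k}" "\<And>j. j < k \<Longrightarrow> c (r l) j = c' (\<sigma> j)"
      using opt_triples_unique[OF n(1) xI x(2) wa(2,1) N[OF n(2,1) wa(2)] opt' _ reg'] by blast
    show ?thesis
    proof (rule codebook_dist_le[OF k \<sigma>(1)])
      fix j assume j: "j < k"
      then have "\<sigma> j < k" using permutes_in_image[OF \<sigma>(1), of j] by simp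
      then show "dist (c (r l) j) (restrict q {..<k} (\<sigma> j)) \<le> 1 / real (Suc l)"
        using wa'(2) \<sigma>(2)[OF j] c'_cent by (simp add: less_imp_le)
    qed
  qed
  then have le: "\<forall>\<^sub>F l in sequentially. codebook_dist k (c (r l)) (restrict q {..<k}) \<le> 1 / real (Suc l)"
    by (intro always_eventually allI)
  have null: "(\<lambda>l. 1 / real (Suc l)) \<longlonglongrightarrow> 0"
    using LIMSEQ_inverse_real_of_nat by (simp add: inverse_eq_divide)
  have "(\<lambda>l. codebook_dist k (c (r l)) (restrict q {..<k})) \<longlonglongrightarrow> 0"
    by (rule tendsto_sandwich[OF _ le tendsto_const null]) (intro always_eventually allI codebook_dist_nonneg k)
  then show ?thesis using r(1) by blast
qed

section \<open>Convergence of the values, and of the codebooks if the optimum is unique\<close>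

lemma optimal_compactness:
  assumes x: "good x" and c: "\<And>n. 1 \<le> n \<Longrightarrow> optimal_codebook \<Omega> \<phi> k (emp n x) h (c n)"
    and r: "strict_mono r" "\<And>l. 1 \<le> r l"
  obtains \<rho> cs where "strict_mono (\<rho> :: nat \<Rightarrow> nat)" "optimal_codebook \<Omega> \<phi> k P h cs"
    "\<forall>j<k. (\<lambda>m. c (r (\<rho> m)) j) \<longlonglongrightarrow> cs j"
    "(\<lambda>m. distortion (emp (r (\<rho> m)) x) (c (r (\<rho> m)))) \<longlonglongrightarrow> opt_value"
proof -
  have "\<exists>w a. opt_triple (r l) x (c (r l)) w a" for l
    using optimal_opt_triple[OF r(2) good_interior[OF x] c[OF r(2)]] by metis
  then obtain w a where opt: "\<And>l. opt_triple (r l) x (c (r l)) (w l) (a l)" by metis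
  obtain \<rho> cs \<delta> where "strict_mono (\<rho> :: nat \<Rightarrow> nat)" "optimal_codebook \<Omega> \<phi> k P h cs"
    "\<forall>j<k. (\<lambda>m. c (r (\<rho> m)) j) \<longlonglongrightarrow> cs j" "0 < \<delta>"
    "\<forall>j<k. \<forall>\<^sub>F m in sequentially. \<delta> * real (r (\<rho> m)) \<le> mass (r (\<rho> m)) (w (\<rho> m)) (a (\<rho> m)) j"
    "(\<lambda>m. distortion (emp (r (\<rho> m)) x) (c (r (\<rho> m)))) \<longlonglongrightarrow> opt_value"
    by (rule compactness[OF x r opt])
  then show ?thesis using that by blast
qed

lemma optimal_values_converge:
  assumes x: "good x" and c: "\<And>n. 1 \<le> n \<Longrightarrow> optimal_codebook \<Omega> \<phi> k (emp n x) h (c n)"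
  shows "(\<lambda>n. distortion (emp n x) (c n)) \<longlonglongrightarrow> opt_value"
proof (rule tendsto_by_subsequences)
  fix r assume r: "strict_mono (r :: nat \<Rightarrow> nat)" "\<And>l. 1 \<le> r l"
  obtain \<rho> b where "strict_mono (\<rho> :: nat \<Rightarrow> nat)" "optimal_codebook \<Omega> \<phi> k P h b"
    "\<forall>j<k. (\<lambda>m. c (r (\<rho> m)) j) \<longlonglongrightarrow> b j"
    "(\<lambda>m. distortion (emp (r (\<rho> m)) x) (c (r (\<rho> m)))) \<longlonglongrightarrow> opt_value"
    by (rule optimal_compactness[OF x c r])
  then show "\<exists>\<rho>. strict_mono (\<rho> :: nat \<Rightarrow> nat) \<and>
      (\<lambda>m. distortion (emp (r (\<rho> m)) x) (c (r (\<rho> m)))) \<longlonglongrightarrow> opt_value" by blast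
qed

text \<open>The relabelling may change with the subsequence, but \<open>codebook_dist\<close> takes
  the minimum over all of them.\<close>

lemma unique_optimum_converges:
  assumes x: "good x" and c: "\<And>n. 1 \<le> n \<Longrightarrow> optimal_codebook \<Omega> \<phi> k (emp n x) h (c n)"
    and unique: "\<And>b. optimal_codebook \<Omega> \<phi> k P h b \<Longrightarrow> \<exists>\<sigma>. \<sigma> permutes {..<k} \<and> (\<forall>i<k. b i = cs (\<sigma> i))"
  shows "(\<lambda>n. codebook_dist k (c n) cs) \<longlonglongrightarrow> 0"
proof (rule tendsto_by_subsequences)
  fix r assume r: "strict_mono (r :: nat \<Rightarrow> nat)" "\<And>l. 1 \<le> r l"
  obtain \<rho> b where \<rho>: "strict_mono (\<rho> :: nat \<Rightarrow> nat)" "optimal_codebook \<Omega> \<phi> k P h b"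
    "\<forall>j<k. (\<lambda>m. c (r (\<rho> m)) j) \<longlonglongrightarrow> b j"
    "(\<lambda>m. distortion (emp (r (\<rho> m)) x) (c (r (\<rho> m)))) \<longlonglongrightarrow> opt_value"
    by (rule optimal_compactness[OF x c r])
  obtain \<sigma> where \<sigma>: "\<sigma> permutes {..<k}" "\<forall>i<k. b i = cs (\<sigma> i)" using unique[OF \<rho>(2)] by blast
  have "(\<lambda>m. codebook_dist k (c (r (\<rho> m))) cs) \<longlonglongrightarrow> 0"
  proof (rule tendsto_sandwich[OF _ _ tendsto_const])
    show "(\<lambda>m. \<Sum>j<k. dist (c (r (\<rho> m)) j) (b j)) \<longlonglongrightarrow> 0"
      using \<rho>(3) by (intro tendsto_null_sum) (simp add: tendsto_dist_iff[symmetric])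
    have "codebook_dist k (c (r (\<rho> m))) cs \<le> (\<Sum>j<k. dist (c (r (\<rho> m)) j) (b j))" for m
    proof (rule codebook_dist_le[OF k \<sigma>(1)])
      fix j assume j: "j < k"
      have "dist (c (r (\<rho> m)) j) (b j) \<le> (\<Sum>j<k. dist (c (r (\<rho> m)) j) (b j))"
        using j by (intro member_le_sum) auto
      then show "dist (c (r (\<rho> m)) j) (cs (\<sigma> j)) \<le> (\<Sum>j<k. dist (c (r (\<rho> m)) j) (b j))" using \<sigma>(2) j by simp
    qed
    then show "\<forall>\<^sub>F m in sequentially. codebook_dist k (c (r (\<rho> m))) cs \<le> (\<Sum>j<k. dist (c (r (\<rho> m)) j) (b j))"
      by simp
  qed (intro always_eventually allI codebook_dist_nonneg k)
  then show "\<exists>\<rho>. strict_mono (\<rho> :: nat \<Rightarrow> nat) \<and> (\<lambda>m. codebook_dist k (c (r (\<rho> m))) cs) \<longlonglongrightarrow> 0" using \<rho>(1) by blast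
qed

end

section \<open>Convergence of empirical optima\<close>

lemma integrable_norm_sq_of_powr:
  fixes P :: "'a::euclidean_space measure"
  assumes "prob_space P" "sets P = sets borel" "2 < p" "integrable P (\<lambda>u. norm u powr p)"
  shows "integrable P (\<lambda>u. (norm u)\<^sup>2)"
proof (rule Bochner_Integration.integrable_bound)
  interpret prob_space P by fact
  show "integrable P (\<lambda>u. 1 + norm u powr p)" using assms(4) by simp
  show "(\<lambda>u. (norm u)\<^sup>2) \<in> borel_measurable P" using assms(2) by (simp cong: measurable_cong_sets)
  have "(norm u)\<^sup>2 \<le> 1 + norm u powr p" for u :: 'a
  proof (cases "norm u \<le> 1")
    case True
    then have "(norm u)\<^sup>2 \<le> 1" by (simp add: power_le_one)
    then show ?thesis by (simp add: add_increasing2)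
  next
    case False
    then have "(norm u)\<^sup>2 = norm u powr 2" by (subst powr_realpow[symmetric]) auto
    also have "\<dots> \<le> norm u powr p" using False assms(3) by (intro powr_mono) auto
    finally show ?thesis by simp
  qed
  then show "AE u in P. norm ((norm u)\<^sup>2) \<le> norm (1 + norm u powr p)"
    by (intro AE_I2) (simp add: add_nonneg_nonneg)
qed

text \<open>The joint law of an i.i.d. sequence is the product measure, so almost sure statements on
  sequence space pull back.\<close>

lemma AE_iid_sequence:
  fixes X :: "nat \<Rightarrow> 'w \<Rightarrow> 'a::euclidean_space"
  assumes M: "prob_space M" and P: "sets P = sets borel"
    and indep: "prob_space.indep_vars M (\<lambda>_. borel) X UNIV" and law: "\<And>i. distr M borel (X i) = P"
    and AE: "AE x in PiM UNIV (\<lambda>_::nat. P). Q x"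
  shows "AE \<omega> in M. Q (\<lambda>i. X i \<omega>)"
proof -
  interpret prob_space M by fact
  have X: "random_variable borel (X i)" for i using indep by (simp add: indep_vars_def)
  have sets: "sets (PiM UNIV (\<lambda>_::nat. borel :: 'a measure)) = sets (PiM UNIV (\<lambda>_::nat. P))"
    using P by (intro sets_PiM_cong) auto
  have "distr M (PiM UNIV (\<lambda>_::nat. borel)) (\<lambda>\<omega>. \<lambda>i\<in>UNIV. X i \<omega>) = PiM UNIV (\<lambda>i. distr M borel (X i))"
    using indep X by (subst (asm) indep_vars_iff_distr_eq_PiM') auto
  then have "distr M (PiM UNIV (\<lambda>_::nat. borel)) (\<lambda>\<omega> i. X i \<omega>) = PiM UNIV (\<lambda>_::nat. P)"
    by (simp add: law restrict_UNIV)
  moreover have "distr M (PiM UNIV (\<lambda>_::nat. borel)) (\<lambda>\<omega> i. X i \<omega>) = distr M (PiM UNIV (\<lambda>_::nat. P)) (\<lambda>\<omega> i. X i \<omega>)"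
    by (rule distr_cong[OF refl sets refl])
  ultimately have eq: "distr M (PiM UNIV (\<lambda>_::nat. P)) (\<lambda>\<omega> i. X i \<omega>) = PiM UNIV (\<lambda>_::nat. P)" by simp
  have "(\<lambda>\<omega> i. X i \<omega>) \<in> M \<rightarrow>\<^sub>M PiM UNIV (\<lambda>_::nat. borel)"
    using X by (intro measurable_PiM_single') auto
  then have "(\<lambda>\<omega> i. X i \<omega>) \<in> M \<rightarrow>\<^sub>M PiM UNIV (\<lambda>_::nat. P)"
    using sets by (simp cong: measurable_cong_sets)
  then show ?thesis by (rule AE_distrD) (simp only: eq AE)
qed

text \<open>Uniqueness is understood up to relabelling, because the distortion does not see the
  order of the codepoints. In the second claim \<open>c_opt\<close> is deterministic, while the
  subsequence may depend on the sample.\<close>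

theorem theorem10:
  fixes \<Omega> :: "'a::euclidean_space set"
    and \<phi> :: "'a \<Rightarrow> real"
    and k :: nat
    and h p :: real
    and P :: "'a measure"
    and M :: "'w measure"
    and X :: "nat \<Rightarrow> 'w \<Rightarrow> 'a"
    and c_hat :: "nat \<Rightarrow> 'w \<Rightarrow> nat \<Rightarrow> 'a"
  assumes h: "0 < h" "h < 1"
    and k: "1 \<le> k"
    and \<Omega>: "convex \<Omega>"
    and \<phi>: "strictly_convex_on \<Omega> \<phi>" "C2_on \<Omega> \<phi>"
    and P: "prob_space P" "sets P = sets borel"
    and F0: "closure (convex hull (measure_support P)) \<subseteq> interior \<Omega>"
    and ac: "absolutely_continuous lborel P"
    and moment: "2 < p" "integrable P (\<lambda>u. norm u powr p)"
    and M: "prob_space M"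
    and iid: "prob_space.indep_vars M (\<lambda>_. borel) X UNIV" "\<And>i. distr M borel (X i) = P"
    and c_hat: "\<And>n. 1 \<le> n \<Longrightarrow>
      AE \<omega> in M. optimal_codebook \<Omega> \<phi> k (empirical_measure X n \<omega>) h (c_hat n \<omega>)"
  shows "\<exists>c_opt. optimal_codebook \<Omega> \<phi> k P h c_opt \<and>
    (AE \<omega> in M. (\<lambda>n. trimmed_distortion \<Omega> \<phi> k (empirical_measure X n \<omega>) h (c_hat n \<omega>))
        \<longlonglongrightarrow> trimmed_distortion \<Omega> \<phi> k P h c_opt) \<and>
    (AE \<omega> in M. \<exists>r. strict_mono r \<and>
        (\<lambda>n. codebook_dist k (c_hat (r n) \<omega>) c_opt) \<longlonglongrightarrow> 0) \<and>
    ((\<forall>c. optimal_codebook \<Omega> \<phi> k P h c \<longrightarrow>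
        (\<exists>\<sigma>. \<sigma> permutes {..<k} \<and> (\<forall>i<k. c i = c_opt (\<sigma> i)))) \<longrightarrow>
      (AE \<omega> in M. (\<lambda>n. codebook_dist k (c_hat n \<omega>) c_opt) \<longlonglongrightarrow> 0))"
proof -
  interpret P: prob_space P by (rule P(1))
  have ne: "measure_support P \<noteq> {}"
  proof
    assume "measure_support P = {}"
    then have "AE u in P. False" using AE_measure_support[OF P(2)] by simp
    then show False using P.AE_contr[of "\<lambda>_. False"] by simp
  qed
  then have ne': "interior \<Omega> \<noteq> {}"
    using F0 hull_subset[of "measure_support P" convex] closure_subset[of "convex hull measure_support P"] by blast
  interpret sampling \<Omega> \<phi> k h P
    by unfold_locales
      (use h k \<phi> P F0 ac ne' integrable_norm_sq_of_powr[OF P moment] in auto)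
  note seq = AE_iid_sequence[OF M P(2) iid]
  obtain q where q: "\<And>\<rho>. 0 < \<rho> \<Longrightarrow> AE x in samples. x \<in> near_io q \<rho>"
    using recurrent_codebook_exists by blast
  define c_opt where "c_opt = restrict q {..<k}"
  have io: "AE x in samples. \<forall>l. x \<in> near_io q (1 / real (Suc l))"
    unfolding AE_all_countable by (intro allI q) simp
  \<comment> \<open>Optimality of \<open>c_opt\<close> does not involve the sample, so holding
    almost surely means holding.\<close>
  have "AE x in samples. optimal_codebook \<Omega> \<phi> k P h c_opt"
    using AE_good io unfolding c_opt_def by eventually_elim (rule recurrent_codebook_optimal)
  then have opt: "optimal_codebook \<Omega> \<phi> k P h c_opt"
    using prob_space.AE_contr[OF prob_space_samples, of "\<lambda>_. optimal_codebook \<Omega> \<phi> k P h c_opt"]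
    by (cases "optimal_codebook \<Omega> \<phi> k P h c_opt") simp_all
  then have val: "distortion P c_opt = opt_value"
    using opt_value_le by (auto simp: optimal_codebook_iff intro: antisym)
  have "AE \<omega> in M. \<forall>n. 1 \<le> n \<longrightarrow> optimal_codebook \<Omega> \<phi> k (emp n (\<lambda>i. X i \<omega>)) h (c_hat n \<omega>)"
    unfolding AE_all_countable
  proof
    fix n show "AE \<omega> in M. 1 \<le> n \<longrightarrow> optimal_codebook \<Omega> \<phi> k (emp n (\<lambda>i. X i \<omega>)) h (c_hat n \<omega>)"
      using c_hat[of n] by (cases "1 \<le> n") (simp_all add: empirical_measure_eq_emp[of X])
  qed
  moreover have "AE \<omega> in M. good (\<lambda>i. X i \<omega>)" by (rule seq[OF AE_good])
  moreover have "AE \<omega> in M. tie_free (\<lambda>i. X i \<omega>)" by (rule seq[OF AE_tie_free])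
  moreover have "AE \<omega> in M. \<forall>l. (\<lambda>i. X i \<omega>) \<in> near_io q (1 / real (Suc l))" by (rule seq[OF io])
  ultimately have all: "AE \<omega> in M. (\<forall>n. 1 \<le> n \<longrightarrow> optimal_codebook \<Omega> \<phi> k (emp n (\<lambda>i. X i \<omega>)) h (c_hat n \<omega>)) \<and>
      good (\<lambda>i. X i \<omega>) \<and> tie_free (\<lambda>i. X i \<omega>) \<and> (\<forall>l. (\<lambda>i. X i \<omega>) \<in> near_io q (1 / real (Suc l)))"
    by eventually_elim blast
  show ?thesis
  proof (intro exI[of _ c_opt] conjI opt impI)
    show "AE \<omega> in M. (\<lambda>n. trimmed_distortion \<Omega> \<phi> k (empirical_measure X n \<omega>) h (c_hat n \<omega>))
        \<longlonglongrightarrow> trimmed_distortion \<Omega> \<phi> k P h c_opt"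
      using all
    proof eventually_elim
      case (elim \<omega>)
      show ?case
        unfolding empirical_measure_eq_emp[of X] val using elim by (intro optimal_values_converge) blast+
    qed
    show "AE \<omega> in M. \<exists>r. strict_mono r \<and> (\<lambda>n. codebook_dist k (c_hat (r n) \<omega>) c_opt) \<longlonglongrightarrow> 0"
      using all
    proof eventually_elim
      case (elim \<omega>)
      show ?case
        unfolding c_opt_def
        by (rule recurrent_codebook_subsequence[where c="\<lambda>n. c_hat n \<omega>" and x="\<lambda>i. X i \<omega>"]) (use elim in blast)+
    qed
    assume unique: "\<forall>c. optimal_codebook \<Omega> \<phi> k P h c \<longrightarrow>
        (\<exists>\<sigma>. \<sigma> permutes {..<k} \<and> (\<forall>i<k. c i = c_opt (\<sigma> i)))"
    show "AE \<omega> in M. (\<lambda>n. codebook_dist k (c_hat n \<omega>) c_opt) \<longlonglongrightarrow> 0"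
      using all
    proof eventually_elim
      case (elim \<omega>)
      show ?case
        by (rule unique_optimum_converges[where c="\<lambda>n. c_hat n \<omega>" and x="\<lambda>i. X i \<omega>"]) (use elim unique in blast)+
    qed
  qed
qed

end
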